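(* Let $(M,g)$ be a Hermitian manifold, let $\nabla$ be its Bismut connection, and let $T$ be the torsion of $\nabla$. Assume that $T$ is parallel, i.e. $\nabla T=0$. Let $T^c$ be the torsion of the Chern connection of $(M,g)$. Then for $X,Y\in T^{1,0}_pM$, $[X,Y]_c=T^c(X,Y)$ defines a Lie bracket, which makes $T^{1,0}M$ a bundle of complex Lie algebras; likewise $T^c$ makes $T_{\mathbb{C}}M$ a bundle of complex Lie algebras. Moreover $T_{\mathbb{C}}M=T^{1,0}M\oplus T^{0,1}M$ is a direct sum of two ideals.
   Context: A Hermitian manifold is a complex manifold (with complex structure $J$) with a metric $g=\langle\cdot,\cdot\rangle$ satisfying $g(JX,JY)=g(X,Y)$. A connection is Hermitian if it preserves $g$ and $J$. The Bismut connection is the unique Hermitian connection whose torsion $T$ is totally skew-symmetric, i.e. $\langle T(x,y),z\rangle$ is a $3$-form. The Chern connection is the unique Hermitian connection $\nabla^c$ with $(\nabla^c)''=\bar\partial$. Torsion is $T(X,Y)=\nabla_XY-\nabla_YX-[X,Y]$ (similarly for $T^c$), extended complex bilinearly to $T_{\mathbb{C}}M=TM\otimes\mathbb{C}$. The bracket on $T_{\mathbb{C}}M$ is given fibrewise by $[X,Y]_c=T^c(X,Y)$ for all $X,Y\in T_{\mathbb{C},p}M$. A bundle of complex Lie algebras is a complex vector bundle with a complex Lie algebra structure on each fibre, locally trivial as a bundle of Lie algebras. "Direct sum of two ideals" means that at each point $T^{1,0}_pM$ and $T^{0,1}_pM$ are ideals of the Lie algebra $T_{\mathbb{C},p}M$.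 *)

theory Defs
  imports "HOL-Analysis.Analysis" "HOL-Library.Function_Algebras"
begin

text \<open>Functions into a real vector space form a real vector space pointwise.\<close>

instantiation "fun" :: (type, real_vector) real_vector
begin

definition scaleR_fun :: "real \<Rightarrow> ('a \<Rightarrow> 'b) \<Rightarrow> 'a \<Rightarrow> 'b" where
  "scaleR_fun r f = (\<lambda>x. r *\<^sub>R f x)"

instance
  by standard (auto simp: scaleR_fun_def plus_fun_def fun_eq_iff algebra_simps)

end


section \<open>Smooth and holomorphic maps between Euclidean spaces\<close>

text \<open>Both notions are used on open sets only.\<close>

primrec Ck_on :: "nat \<Rightarrow> 'a::euclidean_space set \<Rightarrow> ('a \<Rightarrow> 'b::real_normed_vector) \<Rightarrow> bool" where
  "Ck_on 0 S f \<longleftrightarrow> continuous_on S f"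
| "Ck_on (Suc k) S f \<longleftrightarrow> (\<forall>x\<in>S. f differentiable (at x)) \<and>
      (\<forall>v. Ck_on k S (\<lambda>x. frechet_derivative f (at x) v))"

definition smooth_on :: "'a::euclidean_space set \<Rightarrow> ('a \<Rightarrow> 'b::real_normed_vector) \<Rightarrow> bool" where
  "smooth_on S f \<longleftrightarrow> (\<forall>k. Ck_on k S f)"

text \<open>Several complex variables: smooth with complex-linear differential, i.e. the
  Cauchy-Riemann equations in each variable.\<close>

definition holomorphic_map_on :: "(complex^'n) set \<Rightarrow> (complex^'n \<Rightarrow> complex^'n) \<Rightarrow> bool" where
  "holomorphic_map_on S f \<longleftrightarrow> smooth_on S f \<and>
     (\<forall>z\<in>S. \<forall>c v. frechet_derivative f (at z) (c *s v) = c *s frechet_derivative f (at z) v)"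


section \<open>Complex manifolds\<close>

text \<open>The underlying space is a whole (Hausdorff, second countable) type \<open>'m\<close>; a complex structure
  of dimension \<open>CARD('n)\<close> is given by a holomorphic atlas. A chart is a pair of its domain and
  its coordinate map.\<close>

type_synonym ('m, 'n) chart = "'m set \<times> ('m \<Rightarrow> complex^'n)"

abbreviation chart_inv :: "('m, 'n) chart \<Rightarrow> complex^'n \<Rightarrow> 'm" where
  "chart_inv c \<equiv> inv_into (fst c) (snd c)"

definition complex_atlas :: "('m::topological_space, 'n::finite) chart set \<Rightarrow> bool" where
  "complex_atlas A \<longleftrightarrow>
     (\<Union>c\<in>A. fst c) = UNIV \<and>
     (\<forall>c\<in>A. open (fst c) \<and> open (snd c ` fst c) \<and>
        homeomorphism (fst c) (snd c ` fst c) (snd c) (chart_inv c)) \<and>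
     (\<forall>c\<in>A. \<forall>d\<in>A. holomorphic_map_on (snd c ` (fst c \<inter> fst d)) (snd d \<circ> chart_inv c))"

definition smooth_fun ::
    "('m, 'n::finite) chart set \<Rightarrow> 'm set \<Rightarrow> ('m \<Rightarrow> 'b::real_normed_vector) \<Rightarrow> bool" where
  "smooth_fun A U f \<longleftrightarrow> (\<forall>c\<in>A. smooth_on (snd c ` (U \<inter> fst c)) (f \<circ> chart_inv c))"


section \<open>Tangent vectors and vector fields\<close>

text \<open>A real tangent vector at \<open>p\<close> is the family of its coordinate vectors in all charts around \<open>p\<close>,
  related by the differentials of the coordinate changes. Here \<open>\<complex>\<^sup>n\<close> is read as \<open>\<real>\<^sup>2\<^sup>n\<close>: the
  coordinates of \<open>\<Sum> x\<^sup>k \<partial>/\<partial>x\<^sup>k + y\<^sup>k \<partial>/\<partial>y\<^sup>k\<close> are \<open>x\<^sup>k + \<i> y\<^sup>k\<close>, so that the complex structure \<open>J\<close> acts as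
  multiplication by \<open>\<i>\<close>. Entries at charts not around \<open>p\<close> are \<open>0\<close>.\<close>

type_synonym ('m, 'n) tvec = "('m, 'n) chart \<Rightarrow> complex^'n"

definition tangent_space :: "('m, 'n::finite) chart set \<Rightarrow> 'm \<Rightarrow> ('m, 'n) tvec set" where
  "tangent_space A p = {v.
     (\<forall>c. \<not> (c \<in> A \<and> p \<in> fst c) \<longrightarrow> v c = 0) \<and>
     (\<forall>c\<in>A. \<forall>d\<in>A. p \<in> fst c \<inter> fst d \<longrightarrow>
        v d = frechet_derivative (snd d \<circ> chart_inv c) (at (snd c p)) (v c))}"

definition Jop :: "('m, 'n::finite) tvec \<Rightarrow> ('m, 'n) tvec" where
  "Jop v = (\<lambda>c. \<i> *s v c)"

definition smooth_vf ::
    "('m, 'n::finite) chart set \<Rightarrow> 'm set \<Rightarrow> ('m \<Rightarrow> ('m, 'n) tvec) \<Rightarrow> bool" where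
  "smooth_vf A U X \<longleftrightarrow> (\<forall>p\<in>U. X p \<in> tangent_space A p) \<and>
     (\<forall>c\<in>A. smooth_on (snd c ` (U \<inter> fst c)) (\<lambda>z. X (chart_inv c z) c))"

text \<open>Derivative at \<open>p\<close> of a function along the vector with coordinates \<open>w\<close> in the chart \<open>c\<close>.\<close>

definition chart_deriv ::
    "('m, 'n::finite) chart \<Rightarrow> 'm \<Rightarrow> complex^'n \<Rightarrow> ('m \<Rightarrow> 'b::real_normed_vector) \<Rightarrow> 'b" where
  "chart_deriv c p w f = frechet_derivative (f \<circ> chart_inv c) (at (snd c p)) w"

text \<open>\<open>v(f)\<close> for \<open>v\<close> in the tangent space at \<open>p\<close> and \<open>f\<close> smooth near \<open>p\<close>; by the chain rule the
  chart does not matter.\<close>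

definition dir_deriv ::
    "('m, 'n::finite) chart set \<Rightarrow> 'm \<Rightarrow> ('m, 'n) tvec \<Rightarrow> ('m \<Rightarrow> 'b::real_normed_vector) \<Rightarrow> 'b" where
  "dir_deriv A p v f = (let c = (SOME c. c \<in> A \<and> p \<in> fst c) in chart_deriv c p (v c) f)"

definition lie_bracket ::
    "('m, 'n::finite) chart set \<Rightarrow> ('m \<Rightarrow> ('m, 'n) tvec) \<Rightarrow> ('m \<Rightarrow> ('m, 'n) tvec) \<Rightarrow> 'm \<Rightarrow> ('m, 'n) tvec" where
  "lie_bracket A X Y p = (\<lambda>c. if c \<in> A \<and> p \<in> fst c
     then chart_deriv c p (X p c) (\<lambda>q. Y q c) - chart_deriv c p (Y p c) (\<lambda>q. X q c) else 0)"


section \<open>Hermitian metrics and connections\<close>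

definition hermitian_metric ::
    "('m::topological_space, 'n::finite) chart set \<Rightarrow>
     ('m \<Rightarrow> ('m, 'n) tvec \<Rightarrow> ('m, 'n) tvec \<Rightarrow> real) \<Rightarrow> bool" where
  "hermitian_metric A g \<longleftrightarrow>
     (\<forall>p. \<forall>x\<in>tangent_space A p. \<forall>y\<in>tangent_space A p.
        g p x y = g p y x \<and>
        (\<forall>z\<in>tangent_space A p. g p (x + y) z = g p x z + g p y z) \<and>
        (\<forall>r. g p (r *\<^sub>R x) y = r * g p x y) \<and>
        (x \<noteq> 0 \<longrightarrow> g p x x > 0) \<and>
        g p (Jop x) (Jop y) = g p x y) \<and>
     (\<forall>U X Y. open U \<and> smooth_vf A U X \<and> smooth_vf A U Y \<longrightarrow> smooth_fun A U (\<lambda>p. g p (X p) (Y p)))"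

definition hermitian_manifold ::
    "('m::topological_space, 'n::finite) chart set \<Rightarrow>
     ('m \<Rightarrow> ('m, 'n) tvec \<Rightarrow> ('m, 'n) tvec \<Rightarrow> real) \<Rightarrow> bool" where
  "hermitian_manifold A g \<longleftrightarrow> complex_atlas A \<and> hermitian_metric A g"

text \<open>A connection on \<open>TM\<close>: \<open>nabla p v Y\<close> is the covariant derivative along the vector \<open>v\<close> at \<open>p\<close>
  of a vector field \<open>Y\<close> defined and smooth on some open neighbourhood of \<open>p\<close>; it only depends on
  \<open>Y\<close> near \<open>p\<close>. Values of \<open>nabla\<close> on other arguments are irrelevant.\<close>

type_synonym ('m, 'n) conn = "'m \<Rightarrow> ('m, 'n) tvec \<Rightarrow> ('m \<Rightarrow> ('m, 'n) tvec) \<Rightarrow> ('m, 'n) tvec"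

definition connection :: "('m::topological_space, 'n::finite) chart set \<Rightarrow> ('m, 'n) conn \<Rightarrow> bool" where
  "connection A nabla \<longleftrightarrow> (\<forall>U Y. open U \<and> smooth_vf A U Y \<longrightarrow>
     (\<forall>p\<in>U. \<forall>v\<in>tangent_space A p.
        nabla p v Y \<in> tangent_space A p \<and>
        (\<forall>w\<in>tangent_space A p. nabla p (v + w) Y = nabla p v Y + nabla p w Y) \<and>
        (\<forall>r. nabla p (r *\<^sub>R v) Y = r *\<^sub>R nabla p v Y) \<and>
        (\<forall>Z. smooth_vf A U Z \<longrightarrow> nabla p v (\<lambda>q. Y q + Z q) = nabla p v Y + nabla p v Z) \<and>
        (\<forall>f :: 'm \<Rightarrow> real. smooth_fun A U f \<longrightarrow>
           nabla p v (\<lambda>q. f q *\<^sub>R Y q) = dir_deriv A p v f *\<^sub>R Y p + f p *\<^sub>R nabla p v Y) \<and>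
        (\<forall>Z. (\<forall>q\<in>U. Z q = Y q) \<longrightarrow> nabla p v Z = nabla p v Y)) \<and>
     (\<forall>X. smooth_vf A U X \<longrightarrow> smooth_vf A U (\<lambda>p. nabla p (X p) Y)))"

definition hermitian_connection ::
    "('m::topological_space, 'n::finite) chart set \<Rightarrow>
     ('m \<Rightarrow> ('m, 'n) tvec \<Rightarrow> ('m, 'n) tvec \<Rightarrow> real) \<Rightarrow> ('m, 'n) conn \<Rightarrow> bool" where
  "hermitian_connection A g nabla \<longleftrightarrow> connection A nabla \<and>
     (\<forall>U Y Z. open U \<and> smooth_vf A U Y \<and> smooth_vf A U Z \<longrightarrow>
        (\<forall>p\<in>U. \<forall>v\<in>tangent_space A p.
           dir_deriv A p v (\<lambda>q. g q (Y q) (Z q)) = g p (nabla p v Y) (Z p) + g p (Y p) (nabla p v Z) \<and>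
           nabla p v (\<lambda>q. Jop (Y q)) = Jop (nabla p v Y)))"

text \<open>The torsion as a tensor: \<open>T(x, y) = \<nabla>\<^sub>X Y - \<nabla>\<^sub>Y X - [X, Y]\<close> at \<open>p\<close>, for smooth local extensions
  \<open>X\<close>, \<open>Y\<close> of \<open>x\<close>, \<open>y\<close>; tensoriality makes the choice of the extensions immaterial.\<close>

definition local_extension ::
    "('m::topological_space, 'n::finite) chart set \<Rightarrow> 'm \<Rightarrow> ('m, 'n) tvec \<Rightarrow> 'm \<Rightarrow> ('m, 'n) tvec" where
  "local_extension A p x = (SOME X. X p = x \<and> (\<exists>U. open U \<and> p \<in> U \<and> smooth_vf A U X))"

definition torsion ::
    "('m::topological_space, 'n::finite) chart set \<Rightarrow> ('m, 'n) conn \<Rightarrow>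
     'm \<Rightarrow> ('m, 'n) tvec \<Rightarrow> ('m, 'n) tvec \<Rightarrow> ('m, 'n) tvec" where
  "torsion A nabla p x y =
     (let X = local_extension A p x; Y = local_extension A p y
      in nabla p x Y - nabla p y X - lie_bracket A X Y p)"

definition bismut_connection ::
    "('m::topological_space, 'n::finite) chart set \<Rightarrow>
     ('m \<Rightarrow> ('m, 'n) tvec \<Rightarrow> ('m, 'n) tvec \<Rightarrow> real) \<Rightarrow> ('m, 'n) conn \<Rightarrow> bool" where
  "bismut_connection A g nabla \<longleftrightarrow> hermitian_connection A g nabla \<and>
     (\<forall>p. \<forall>x\<in>tangent_space A p. \<forall>y\<in>tangent_space A p. \<forall>z\<in>tangent_space A p.
        g p (torsion A nabla p x y) z = - g p (torsion A nabla p y x) z \<and>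
        g p (torsion A nabla p x y) z = - g p (torsion A nabla p x z) y)"

text \<open>\<open>(\<nabla>\<^sub>v T)(Y, Z) = \<nabla>\<^sub>v (T(Y, Z)) - T(\<nabla>\<^sub>v Y, Z) - T(Y, \<nabla>\<^sub>v Z) = 0\<close>.\<close>

definition parallel_torsion ::
    "('m::topological_space, 'n::finite) chart set \<Rightarrow> ('m, 'n) conn \<Rightarrow> bool" where
  "parallel_torsion A nabla \<longleftrightarrow>
     (\<forall>U Y Z. open U \<and> smooth_vf A U Y \<and> smooth_vf A U Z \<longrightarrow>
        (\<forall>p\<in>U. \<forall>v\<in>tangent_space A p.
           nabla p v (\<lambda>q. torsion A nabla q (Y q) (Z q))
             - torsion A nabla p (nabla p v Y) (Z p) - torsion A nabla p (Y p) (nabla p v Z) = 0))"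


section \<open>The complexified tangent bundle\<close>

text \<open>The pair \<open>(a, b)\<close> stands for \<open>a + \<i> b\<close> in \<open>T\<^sub>pM \<otimes> \<complex>\<close>. This formal \<open>\<i>\<close> is not \<open>J\<close>.\<close>

type_synonym ('m, 'n) ctvec = "('m, 'n) tvec \<times> ('m, 'n) tvec"

definition cscale :: "complex \<Rightarrow> 'v::real_vector \<times> 'v \<Rightarrow> 'v \<times> 'v" where
  "cscale c V = (Re c *\<^sub>R fst V - Im c *\<^sub>R snd V, Re c *\<^sub>R snd V + Im c *\<^sub>R fst V)"

definition TC :: "('m, 'n::finite) chart set \<Rightarrow> 'm \<Rightarrow> ('m, 'n) ctvec set" where
  "TC A p = tangent_space A p \<times> tangent_space A p"

definition T10 :: "('m, 'n::finite) chart set \<Rightarrow> 'm \<Rightarrow> ('m, 'n) ctvec set" where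
  "T10 A p = {V \<in> TC A p. map_prod Jop Jop V = cscale \<i> V}"

definition T01 :: "('m, 'n::finite) chart set \<Rightarrow> 'm \<Rightarrow> ('m, 'n) ctvec set" where
  "T01 A p = {V \<in> TC A p. map_prod Jop Jop V = cscale (- \<i>) V}"

definition smooth_cvf ::
    "('m, 'n::finite) chart set \<Rightarrow> 'm set \<Rightarrow> ('m \<Rightarrow> ('m, 'n) ctvec) \<Rightarrow> bool" where
  "smooth_cvf A U X \<longleftrightarrow> smooth_vf A U (\<lambda>p. fst (X p)) \<and> smooth_vf A U (\<lambda>p. snd (X p))"

text \<open>Complex bilinear extension of a real bilinear map.\<close>

definition cbilin :: "('v \<Rightarrow> 'w \<Rightarrow> 'u::ab_group_add) \<Rightarrow> 'v \<times> 'v \<Rightarrow> 'w \<times> 'w \<Rightarrow> 'u \<times> 'u" where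
  "cbilin b V W = (b (fst V) (fst W) - b (snd V) (snd W), b (fst V) (snd W) + b (snd V) (fst W))"

definition ctorsion ::
    "('m::topological_space, 'n::finite) chart set \<Rightarrow> ('m, 'n) conn \<Rightarrow>
     'm \<Rightarrow> ('m, 'n) ctvec \<Rightarrow> ('m, 'n) ctvec \<Rightarrow> ('m, 'n) ctvec" where
  "ctorsion A nabla p = cbilin (torsion A nabla p)"

definition cnabla ::
    "('m, 'n) conn \<Rightarrow> 'm \<Rightarrow> ('m, 'n) ctvec \<Rightarrow> ('m \<Rightarrow> ('m, 'n::finite) ctvec) \<Rightarrow> ('m, 'n) ctvec" where
  "cnabla nabla p V Y =
     (nabla p (fst V) (\<lambda>q. fst (Y q)) - nabla p (snd V) (\<lambda>q. snd (Y q)),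
      nabla p (fst V) (\<lambda>q. snd (Y q)) + nabla p (snd V) (\<lambda>q. fst (Y q)))"

text \<open>Holomorphic components \<open>(dz\<^sup>1(V), \<dots>, dz\<^sup>n(V))\<close> in the chart \<open>c\<close>, with \<open>dz\<^sup>k\<close> extended complex
  linearly.\<close>

definition dz :: "('m, 'n) chart \<Rightarrow> ('m, 'n::finite) ctvec \<Rightarrow> complex^'n" where
  "dz c V = fst V c + \<i> *s snd V c"

text \<open>\<open>\<Sum> w\<^sup>k \<partial>/\<partial>z\<^sup>k\<close>, where \<open>\<partial>/\<partial>z\<^sup>k = (\<partial>/\<partial>x\<^sup>k - \<i> \<partial>/\<partial>y\<^sup>k) / 2\<close>, from its components \<open>w\<close> in all charts;
  the real vector with coordinates \<open>w\<close> being \<open>a\<close>, this is \<open>(a - \<i> J a) / 2\<close>.\<close>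

definition holo_vec :: "('m, 'n::finite) tvec \<Rightarrow> ('m, 'n) ctvec" where
  "holo_vec a = ((1/2) *\<^sub>R a, - ((1/2) *\<^sub>R Jop a))"

text \<open>The \<open>\<partial>\<close>-bar operator of the holomorphic bundle \<open>T\<^sup>1\<^sup>,\<^sup>0M\<close>: for \<open>V\<close> of type \<open>(0,1)\<close> and a section
  \<open>Y = \<Sum> Y\<^sup>k \<partial>/\<partial>z\<^sup>k\<close>, it is \<open>\<Sum> V(Y\<^sup>k) \<partial>/\<partial>z\<^sup>k\<close>.\<close>

definition dbar ::
    "('m, 'n::finite) chart set \<Rightarrow> 'm \<Rightarrow> ('m, 'n) ctvec \<Rightarrow> ('m \<Rightarrow> ('m, 'n) ctvec) \<Rightarrow> ('m, 'n) ctvec" where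
  "dbar A p V Y = holo_vec (\<lambda>c. if c \<in> A \<and> p \<in> fst c
     then chart_deriv c p (fst V c) (\<lambda>q. dz c (Y q)) + \<i> *s chart_deriv c p (snd V c) (\<lambda>q. dz c (Y q))
     else 0)"

definition chern_connection ::
    "('m::topological_space, 'n::finite) chart set \<Rightarrow>
     ('m \<Rightarrow> ('m, 'n) tvec \<Rightarrow> ('m, 'n) tvec \<Rightarrow> real) \<Rightarrow> ('m, 'n) conn \<Rightarrow> bool" where
  "chern_connection A g nabla \<longleftrightarrow> hermitian_connection A g nabla \<and>
     (\<forall>U Y. open U \<and> smooth_cvf A U Y \<and> (\<forall>q\<in>U. Y q \<in> T10 A q) \<longrightarrow>
        (\<forall>p\<in>U. \<forall>V\<in>T01 A p. cnabla nabla p V Y = dbar A p V Y))"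


section \<open>Bundles of complex Lie algebras\<close>

definition complex_lie_algebra ::
    "(complex \<Rightarrow> 'v::ab_group_add \<Rightarrow> 'v) \<Rightarrow> 'v set \<Rightarrow> ('v \<Rightarrow> 'v \<Rightarrow> 'v) \<Rightarrow> bool" where
  "complex_lie_algebra smul L br \<longleftrightarrow> vector_space smul \<and> module.subspace smul L \<and>
     (\<forall>x\<in>L. \<forall>y\<in>L. br x y \<in> L) \<and>
     (\<forall>x\<in>L. \<forall>y\<in>L. \<forall>z\<in>L. br (x + y) z = br x z + br y z \<and> br z (x + y) = br z x + br z y) \<and>
     (\<forall>c. \<forall>x\<in>L. \<forall>y\<in>L. br (smul c x) y = smul c (br x y) \<and> br x (smul c y) = smul c (br x y)) \<and>
     (\<forall>x\<in>L. br x x = 0) \<and>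
     (\<forall>x\<in>L. \<forall>y\<in>L. \<forall>z\<in>L. br x (br y z) + br y (br z x) + br z (br x y) = 0)"

definition lie_ideal ::
    "(complex \<Rightarrow> 'v::ab_group_add \<Rightarrow> 'v) \<Rightarrow> 'v set \<Rightarrow> ('v \<Rightarrow> 'v \<Rightarrow> 'v) \<Rightarrow> 'v set \<Rightarrow> bool" where
  "lie_ideal smul L br I \<longleftrightarrow> module.subspace smul I \<and> I \<subseteq> L \<and> (\<forall>x\<in>L. \<forall>y\<in>I. br x y \<in> I)"

text \<open>A subbundle \<open>E\<close> of \<open>T\<^sub>\<complex>M\<close> of complex rank \<open>CARD('k)\<close> with a bracket on each fibre is a bundle of
  complex Lie algebras if each fibre is a complex Lie algebra and, locally, there are smooth
  trivializations \<open>U \<times> \<gg> \<rightarrow> E\<close> over \<open>U\<close> that are Lie algebra isomorphisms on fibres, where \<open>\<gg>\<close> is the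
  fixed vector space \<open>\<complex>\<^sup>k\<close> with some Lie bracket \<open>B\<close>. As the trivialization is fibrewise linear and
  injective, its smoothness as a map of vector bundles (and that of its inverse) amounts to
  smoothness of the sections \<open>q \<mapsto> \<Phi> q w\<close>.\<close>

definition lie_algebra_bundle ::
    "('m::topological_space, 'n::finite) chart set \<Rightarrow> 'k::finite itself \<Rightarrow>
     ('m \<Rightarrow> ('m, 'n) ctvec set) \<Rightarrow> ('m \<Rightarrow> ('m, 'n) ctvec \<Rightarrow> ('m, 'n) ctvec \<Rightarrow> ('m, 'n) ctvec) \<Rightarrow> bool" where
  "lie_algebra_bundle A k E br \<longleftrightarrow>
     (\<forall>p. E p \<subseteq> TC A p \<and> complex_lie_algebra cscale (E p) (br p)) \<and>
     (\<forall>p. \<exists>U (B :: complex^'k \<Rightarrow> complex^'k \<Rightarrow> complex^'k) \<Phi>.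
        open U \<and> p \<in> U \<and> complex_lie_algebra (*s) UNIV B \<and>
        (\<forall>q\<in>U. Vector_Spaces.linear (*s) cscale (\<Phi> q) \<and> bij_betw (\<Phi> q) UNIV (E q) \<and>
           (\<forall>v w. \<Phi> q (B v w) = br q (\<Phi> q v) (\<Phi> q w))) \<and>
        (\<forall>w. smooth_cvf A U (\<lambda>q. \<Phi> q w)))"

end

theory Submission
  imports Defs
begin

text \<open>Let \<open>R\<close> be the curvature of the Bismut connection \<open>\<nabla>\<close>. As \<open>T\<close> is skew and parallel, the cyclic sum
  of \<open>R(x, y)z\<close> is the cyclic sum of \<open>T(T(x, y), z)\<close>, which is a 4-form, so \<open>R\<close> is symmetric under
  exchange of pairs; as \<open>R\<close> commutes with \<open>J\<close>, it follows that \<open>R(Jx, Jy) = R(x, y)\<close>, i.e. \<open>R\<close> vanishes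
  on pairs of vectors of type \<open>(1,0)\<close>. Hence \<open>T\<close> satisfies the Jacobi identity on \<open>T\<^sup>1\<^sup>,\<^sup>0M\<close>, where
  \<open>T\<^sup>c = -T\<close>; on mixed pairs \<open>T\<^sup>c\<close> vanishes, because in holomorphic coordinates the Christoffel symbols
  of the Chern connection are complex bilinear.

  The bundle is locally trivial as a bundle of Lie algebras because \<open>T\<^sup>c\<close> is algebraic in \<open>T\<close> and \<open>J\<close>, hence
  \<open>\<nabla>\<close>-parallel: parallel transport along the rays from a point in a chart is a smooth family of
  isomorphisms that preserve the bracket. Parallel sections have constant length, so the frame is
  injective and parallel sections along rays are unique.\<close>

section \<open>Calculus of \<open>C\<^sup>k\<close> maps\<close>

text \<open>The geometry is done in one chart with real vectors: there \<open>J\<close> is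
  multiplication by \<open>\<i>\<close>, constant fields commute, the torsion is the antisymmetrized
  Christoffel symbol, and positivity of the metric is at hand. A complex identity on vectors x -
  \<i> J x is replaced by the combination of real terms that forms its real part. The curvature need
  not vanish, so in general no frame is parallel in all directions. A frame that is parallel in the
  radial direction alone suffices, because the Leibniz rule for \<open>Tor\<close> holds in each
  direction separately and sections only have to be compared along segments to the centre. The
  obstacle is smoothness of such a frame in all variables, also at the centre, where the radial
  field degenerates. The equation is therefore integrated to a fixed point equation on a whole ball,
  with the rays rescaled to the unit interval. Differentiating it reproduces the same operator with
  one more factor t under the integral and the same contraction factor, so one radius serves the
  derivatives of all orders.\<close>

definition ddir :: "('a::real_normed_vector \<Rightarrow> 'b::real_normed_vector) \<Rightarrow> 'a \<Rightarrow> 'a \<Rightarrow> 'b" where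
  "ddir f v x = frechet_derivative f (at x) v"

text \<open>\<open>ddir\<close> takes the point as its last argument, so that
  \<open>ddir f v\<close> is again a map of the same type and the recursion of \<open>Ck_on\<close>
  can be iterated on it.\<close>

lemma Ck_on_Suc_ddir:
  "Ck_on (Suc k) S f \<longleftrightarrow> (\<forall>x\<in>S. f differentiable (at x)) \<and> (\<forall>v. Ck_on k S (ddir f v))"
  by (simp add: ddir_def[abs_def])

declare Ck_on.simps(2) [simp del]

lemma ddir_eqI: "(f has_derivative f') (at x) \<Longrightarrow> ddir f v x = f' v"
  unfolding ddir_def using frechet_derivative_at by metis

lemma has_derivative_ddir: "f differentiable (at x) \<Longrightarrow> (f has_derivative (\<lambda>v. ddir f v x)) (at x)"
  unfolding ddir_def using frechet_derivative_works by blast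

lemma linear_ddir: "f differentiable (at x) \<Longrightarrow> linear (\<lambda>v. ddir f v x)"
  using has_derivative_ddir has_derivative_linear by blast

text \<open>\<open>frechet_derivative\<close> is a choice among the derivatives at \<open>x\<close>,
  and which maps are derivatives there depends only on the germ. The equality therefore covers
  points without a derivative as well.\<close>

lemma ddir_cong:
  assumes "open S" "\<And>x. x \<in> S \<Longrightarrow> f x = g x" "x \<in> S"
  shows "ddir f v x = ddir g v x"
proof -
  have eq: "(f has_derivative f') (at x) \<longleftrightarrow> (g has_derivative f') (at x)" for f'
    using has_derivative_transform_within_open[OF _ assms(1,3), of f _ UNIV g]
      has_derivative_transform_within_open[OF _ assms(1,3), of g _ UNIV f] assms(2) by auto
  show ?thesis unfolding ddir_def frechet_derivative_def eq ..
qed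

lemma differentiable_cong:
  assumes "open S" "\<And>x. x \<in> S \<Longrightarrow> f x = g x" "x \<in> S" "f differentiable (at x)"
  shows "g differentiable (at x)"
  using assms(4) has_derivative_transform_within_open[of f _ x UNIV S g] assms(1-3)
  unfolding differentiable_def by blast

lemma Ck_on_cong:
  assumes "open S" "\<And>x. x \<in> S \<Longrightarrow> f x = g x" "Ck_on k S f"
  shows "Ck_on k S g"
  using assms(2,3)
proof (induction k arbitrary: f g)
  case 0
  then show ?case using continuous_on_cong[of S S f g] by simp
next
  case (Suc k)
  have "Ck_on k S (ddir g v)" for v
    using Suc.IH[of "ddir f v", OF ddir_cong[OF assms(1) Suc.prems(1)]] Suc.prems(2)
    unfolding Ck_on_Suc_ddir by blast
  moreover have "g differentiable (at x)" if "x \<in> S" for x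
    using differentiable_cong[of S f g x] assms(1) Suc.prems that
    unfolding Ck_on_Suc_ddir by blast
  ultimately show ?case unfolding Ck_on_Suc_ddir by blast
qed

lemma Ck_on_subset: "Ck_on k S f \<Longrightarrow> T \<subseteq> S \<Longrightarrow> Ck_on k T f"
proof (induction k arbitrary: f)
  case 0
  then show ?case by (auto intro: continuous_on_subset)
next
  case (Suc k)
  then show ?case by (auto simp: Ck_on_Suc_ddir)
qed

lemma Ck_on_SucD: "Ck_on (Suc k) S f \<Longrightarrow> Ck_on k S f"
proof (induction k arbitrary: f)
  case 0
  then show ?case
    by (auto simp: Ck_on_Suc_ddir intro!: continuous_at_imp_continuous_on differentiable_imp_continuous_within)
next
  case (Suc k)
  then show ?case using Ck_on_Suc_ddir by blast
qed

lemma Ck_on_imp_continuous_on: "Ck_on k S f \<Longrightarrow> continuous_on S f"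
  by (induction k) (auto dest: Ck_on_SucD)

lemma ddir_const [simp]: "ddir (\<lambda>x. c) v = (\<lambda>x. 0)"
  by (rule ext) (simp add: ddir_def)

lemma Ck_on_const [simp, intro]: "Ck_on k S (\<lambda>x. c)"
  by (induction k arbitrary: c) (auto simp: Ck_on_Suc_ddir)

lemma ddir_bounded_linear:
  assumes "bounded_linear T" "f differentiable (at x)"
  shows "ddir (\<lambda>x. T (f x)) v x = T (ddir f v x)"
  by (rule ddir_eqI[OF bounded_linear.has_derivative[OF assms(1) has_derivative_ddir[OF assms(2)]]])

lemma Ck_on_bounded_linear:
  assumes "open S" "bounded_linear T" "Ck_on k S f"
  shows "Ck_on k S (\<lambda>x. T (f x))"
  using assms(3)
proof (induction k arbitrary: f)
  case 0
  then show ?case using assms(2) by (simp add: bounded_linear.continuous_on)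
next
  case (Suc k)
  have "Ck_on k S (ddir (\<lambda>x. T (f x)) v)" for v
    by (rule Ck_on_cong[OF assms(1) _ Suc.IH[of "ddir f v"]])
      (use Suc.prems ddir_bounded_linear[OF assms(2), symmetric] in \<open>auto simp: Ck_on_Suc_ddir\<close>)
  moreover have "(\<lambda>x. T (f x)) differentiable (at x)" if "x \<in> S" for x
    using Suc.prems that bounded_linear.has_derivative[OF assms(2)]
    unfolding Ck_on_Suc_ddir differentiable_def by blast
  ultimately show ?case by (simp add: Ck_on_Suc_ddir)
qed

lemma ddir_ident [simp]: "ddir (\<lambda>x. x) v = (\<lambda>x. v)"
  by (rule ext) (simp add: ddir_def)

lemma Ck_on_ident [simp, intro]: "Ck_on k S (\<lambda>x. x)"
  by (cases k) (auto simp: Ck_on_Suc_ddir)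

lemma ddir_add:
  assumes "f differentiable (at x)" "g differentiable (at x)"
  shows "ddir (\<lambda>x. f x + g x) v x = ddir f v x + ddir g v x"
  by (rule ddir_eqI) (intro has_derivative_add assms has_derivative_ddir)

lemma Ck_on_add:
  assumes "open S" "Ck_on k S f" "Ck_on k S g"
  shows "Ck_on k S (\<lambda>x. f x + g x)"
  using assms(2,3)
proof (induction k arbitrary: f g)
  case 0
  then show ?case by (simp add: continuous_on_add)
next
  case (Suc k)
  have "Ck_on k S (ddir (\<lambda>x. f x + g x) v)" for v
  proof (rule Ck_on_cong[OF assms(1) _ Suc.IH[of "ddir f v" "ddir g v"]])
    show "ddir f v x + ddir g v x = ddir (\<lambda>x. f x + g x) v x" if "x \<in> S" for x
      using ddir_add[of f x g v] Suc.prems that unfolding Ck_on_Suc_ddir by auto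
  qed (use Suc.prems in \<open>auto simp: Ck_on_Suc_ddir\<close>)
  then show ?case using Suc.prems by (simp add: Ck_on_Suc_ddir)
qed

lemma ddir_bilinear:
  assumes "bounded_bilinear opr" "f differentiable (at x)" "g differentiable (at x)"
  shows "ddir (\<lambda>x. opr (f x) (g x)) v x = opr (ddir f v x) (g x) + opr (f x) (ddir g v x)"
  using ddir_eqI[OF bounded_bilinear.FDERIV[OF assms(1) has_derivative_ddir[OF assms(2)] has_derivative_ddir[OF assms(3)]]]
  by (simp add: add.commute)

lemma differentiable_bilinear:
  assumes "bounded_bilinear opr" "f differentiable (at x)" "g differentiable (at x)"
  shows "(\<lambda>x. opr (f x) (g x)) differentiable (at x)"
  using bounded_bilinear.FDERIV[OF assms(1)] assms(2,3) unfolding differentiable_def by blast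

lemma Ck_on_bilinear:
  assumes "open S" "bounded_bilinear opr" "Ck_on k S f" "Ck_on k S g"
  shows "Ck_on k S (\<lambda>x. opr (f x) (g x))"
  using assms(3,4)
proof (induction k arbitrary: f g)
  case 0
  then show ?case using assms(2) by (simp add: bounded_bilinear.continuous_on)
next
  case (Suc k)
  note d = Suc.prems[unfolded Ck_on_Suc_ddir]
  have "Ck_on k S (ddir (\<lambda>x. opr (f x) (g x)) v)" for v
    using d Suc.prems[THEN Ck_on_SucD]
    by (intro Ck_on_cong[OF assms(1) _ Ck_on_add[OF assms(1) Suc.IH[of "ddir f v" g] Suc.IH[of f "ddir g v"]]])
      (auto simp: ddir_bilinear[OF assms(2)])
  moreover have "(\<lambda>x. opr (f x) (g x)) differentiable (at x)" if "x \<in> S" for x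
    using d that differentiable_bilinear[OF assms(2), of f x g] by blast
  ultimately show ?case by (simp add: Ck_on_Suc_ddir)
qed

lemma Ck_on_sum:
  assumes "open S" "\<And>i. i \<in> I \<Longrightarrow> Ck_on k S (f i)"
  shows "Ck_on k S (\<lambda>x. \<Sum>i\<in>I. f i x)"
  using assms(2)
proof (induction I rule: infinite_finite_induct)
  case (insert i I)
  then show ?case using Ck_on_add[OF assms(1), of k "f i"] by simp
qed simp_all

lemma linear_Basis_expand:
  fixes h :: "'a::euclidean_space \<Rightarrow> 'b::real_vector"
  assumes "linear h"
  shows "h v = (\<Sum>b\<in>Basis. (v \<bullet> b) *\<^sub>R h b)"
  using linear_sum[OF assms, of "\<lambda>b. (v \<bullet> b) *\<^sub>R b" Basis]
  by (simp add: euclidean_representation linear_cmul[OF assms])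

lemma ddir_Basis_expand:
  fixes f :: "'a::euclidean_space \<Rightarrow> 'b::real_normed_vector"
  assumes "f differentiable (at x)"
  shows "ddir f v x = (\<Sum>b\<in>Basis. (v \<bullet> b) *\<^sub>R ddir f b x)"
  by (rule linear_Basis_expand[OF linear_ddir[OF assms]])

lemma ddir_compose:
  assumes "h differentiable (at x)" "f differentiable (at (h x))"
  shows "ddir (\<lambda>x. f (h x)) v x = ddir f (ddir h v x) (h x)"
  using diff_chain_at[OF has_derivative_ddir[OF assms(1)] has_derivative_ddir[OF assms(2)]]
  by (intro ddir_eqI) (simp add: o_def)

text \<open>The chain rule differentiates \<open>f\<close> along the moving direction
  \<open>ddir h v x\<close>, whereas \<open>Ck_on\<close> speaks of fixed directions. Expanding that
  direction in \<open>Basis\<close> leaves the maps \<open>ddir f b\<close>, composed with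
  \<open>h\<close>, to which the induction hypothesis applies.\<close>

lemma Ck_on_compose:
  fixes h :: "'a::euclidean_space \<Rightarrow> 'b::euclidean_space" and f :: "'b \<Rightarrow> 'c::real_normed_vector"
  assumes "open S" "h ` S \<subseteq> T" "Ck_on k S h" "Ck_on k T f"
  shows "Ck_on k S (\<lambda>x. f (h x))"
  using assms(3,4)
proof (induction k arbitrary: f)
  case 0
  then show ?case using assms(2) by (simp add: continuous_on_compose2)
next
  case (Suc k)
  note d = Suc.prems[unfolded Ck_on_Suc_ddir]
  have "Ck_on k S (ddir (\<lambda>x. f (h x)) v)" for v
  proof (rule Ck_on_cong[OF assms(1)])
    show "Ck_on k S (\<lambda>x. \<Sum>b\<in>Basis. (ddir h v x \<bullet> b) *\<^sub>R ddir f b (h x))"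
      using d Suc.prems[THEN Ck_on_SucD]
      by (intro Ck_on_sum[OF assms(1)] Ck_on_bilinear[OF assms(1) bounded_bilinear_scaleR]
          Ck_on_bounded_linear[OF assms(1), of "\<lambda>y. y \<bullet> _"] bounded_linear_inner_left Suc.IH) auto
    show "(\<Sum>b\<in>Basis. (ddir h v x \<bullet> b) *\<^sub>R ddir f b (h x)) = ddir (\<lambda>x. f (h x)) v x" if "x \<in> S" for x
    proof -
      have h: "h differentiable (at x)" and f: "f differentiable (at (h x))"
        using d that assms(2) by blast+
      show ?thesis unfolding ddir_compose[OF h f] by (rule ddir_Basis_expand[OF f, symmetric])
    qed
  qed
  moreover have "(\<lambda>x. f (h x)) differentiable (at x)" if "x \<in> S" for x
  proof -
    have h: "h differentiable (at x)" and f: "f differentiable (at (h x))"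
      using d that assms(2) by blast+
    show ?thesis using differentiable_chain_at[OF h f] by (simp add: o_def)
  qed
  ultimately show ?case by (simp add: Ck_on_Suc_ddir)
qed

section \<open>Closure properties of smooth maps\<close>

lemma smooth_on_ddir: "smooth_on S f \<Longrightarrow> smooth_on S (ddir f v)"
  unfolding smooth_on_def by (metis Ck_on_Suc_ddir)

lemma smooth_on_differentiable: "smooth_on S f \<Longrightarrow> x \<in> S \<Longrightarrow> f differentiable (at x)"
  unfolding smooth_on_def by (metis Ck_on_Suc_ddir)

lemma smooth_on_continuous_on: "smooth_on S f \<Longrightarrow> continuous_on S f"
  unfolding smooth_on_def using Ck_on_imp_continuous_on by blast

lemma smooth_on_cong:
  "open S \<Longrightarrow> (\<And>x. x \<in> S \<Longrightarrow> f x = g x) \<Longrightarrow> smooth_on S f \<Longrightarrow> smooth_on S g"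
  unfolding smooth_on_def using Ck_on_cong by blast

lemma smooth_on_subset: "smooth_on S f \<Longrightarrow> T \<subseteq> S \<Longrightarrow> smooth_on T f"
  unfolding smooth_on_def using Ck_on_subset by blast

lemma smooth_on_const [simp, intro]: "smooth_on S (\<lambda>x. c)"
  by (simp add: smooth_on_def)

lemma smooth_on_ident [simp, intro]: "smooth_on S (\<lambda>x. x)"
  by (simp add: smooth_on_def)

lemma smooth_on_bounded_linear:
  "open S \<Longrightarrow> bounded_linear T \<Longrightarrow> smooth_on S f \<Longrightarrow> smooth_on S (\<lambda>x. T (f x))"
  unfolding smooth_on_def by (auto intro: Ck_on_bounded_linear)

lemma smooth_on_add: "open S \<Longrightarrow> smooth_on S f \<Longrightarrow> smooth_on S g \<Longrightarrow> smooth_on S (\<lambda>x. f x + g x)"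
  unfolding smooth_on_def using Ck_on_add by blast

lemma smooth_on_bilinear:
  "open S \<Longrightarrow> bounded_bilinear opr \<Longrightarrow> smooth_on S f \<Longrightarrow> smooth_on S g \<Longrightarrow> smooth_on S (\<lambda>x. opr (f x) (g x))"
  unfolding smooth_on_def by (auto intro: Ck_on_bilinear)

lemma smooth_on_sum:
  "open S \<Longrightarrow> (\<And>i. i \<in> I \<Longrightarrow> smooth_on S (f i)) \<Longrightarrow> smooth_on S (\<lambda>x. \<Sum>i\<in>I. f i x)"
  unfolding smooth_on_def by (auto intro: Ck_on_sum)

lemma smooth_on_minus: "open S \<Longrightarrow> smooth_on S f \<Longrightarrow> smooth_on S (\<lambda>x. - f x)"
  using smooth_on_bounded_linear[OF _ bounded_linear_minus[OF bounded_linear_ident]] .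

lemma smooth_on_diff: "open S \<Longrightarrow> smooth_on S f \<Longrightarrow> smooth_on S g \<Longrightarrow> smooth_on S (\<lambda>x. f x - g x)"
  using smooth_on_add[of S f "\<lambda>x. - g x"] smooth_on_minus[of S g] by simp

lemma smooth_on_compose:
  fixes h :: "'a::euclidean_space \<Rightarrow> 'b::euclidean_space" and f :: "'b \<Rightarrow> 'c::real_normed_vector"
  shows "open S \<Longrightarrow> h ` S \<subseteq> T \<Longrightarrow> smooth_on S h \<Longrightarrow> smooth_on T f \<Longrightarrow> smooth_on S (\<lambda>x. f (h x))"
  unfolding smooth_on_def using Ck_on_compose by blast

lemma smooth_on_ddir_along:
  fixes f :: "'a::euclidean_space \<Rightarrow> 'b::real_normed_vector"
  assumes "open S" "smooth_on S f" "smooth_on S X"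
  shows "smooth_on S (\<lambda>x. ddir f (X x) x)"
proof (rule smooth_on_cong[OF assms(1)])
  show "smooth_on S (\<lambda>x. \<Sum>b\<in>Basis. (X x \<bullet> b) *\<^sub>R ddir f b x)"
    using assms
    by (intro smooth_on_sum smooth_on_bilinear[OF _ bounded_bilinear_scaleR] smooth_on_ddir
        smooth_on_bounded_linear[of S "\<lambda>y. y \<bullet> _"] bounded_linear_inner_left)
  show "(\<Sum>b\<in>Basis. (X x \<bullet> b) *\<^sub>R ddir f b x) = ddir f (X x) x" if "x \<in> S" for x
    using ddir_Basis_expand[OF smooth_on_differentiable[OF assms(2) that], of "X x"] by simp
qed

section \<open>Symmetry of second derivatives\<close>

lemma mixed_difference:
  fixes f :: "'a::real_normed_vector \<Rightarrow> real"
  assumes "h > 0"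
    and S: "\<And>s t. 0 \<le> s \<Longrightarrow> s \<le> h \<Longrightarrow> 0 \<le> t \<Longrightarrow> t \<le> h \<Longrightarrow> x + s *\<^sub>R u + t *\<^sub>R v \<in> S"
    and f: "\<And>x. x \<in> S \<Longrightarrow> f differentiable (at x)"
    and fu: "\<And>x. x \<in> S \<Longrightarrow> ddir f u differentiable (at x)"
  shows "\<exists>s t. 0 \<le> s \<and> s \<le> h \<and> 0 \<le> t \<and> t \<le> h \<and>
    f (x + h *\<^sub>R u + h *\<^sub>R v) - f (x + h *\<^sub>R u) - f (x + h *\<^sub>R v) + f x = h * h * ddir (ddir f u) v (x + s *\<^sub>R u + t *\<^sub>R v)"
proof -
  have line: "((\<lambda>s. g (y + s *\<^sub>R w)) has_real_derivative ddir g w (y + s *\<^sub>R w)) (at s)"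
    if "g differentiable (at (y + s *\<^sub>R w))" for g :: "'a \<Rightarrow> real" and y w s
  proof -
    have "((\<lambda>s. y + s *\<^sub>R w) has_derivative (\<lambda>s. s *\<^sub>R w)) (at s)"
      by (auto intro!: derivative_eq_intros)
    from has_derivative_compose[OF this has_derivative_ddir[OF that]]
    show ?thesis
      using linear_cmul[OF linear_ddir[OF that]]
      by (simp add: has_field_derivative_def mult_commute_abs)
  qed
  \<comment> \<open>The second difference is \<open>\<phi> h - \<phi> 0\<close>. The mean value
    theorem along \<open>u\<close> turns it into \<open>h\<close> times a difference of
    \<open>ddir f u\<close> at two points that differ by \<open>h *\<^sub>R v\<close>; a second
    application along \<open>v\<close> gives the other factor \<open>h\<close>.\<close>
  define \<phi> where "\<phi> s = f ((x + h *\<^sub>R v) + s *\<^sub>R u) - f (x + s *\<^sub>R u)" for s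
  have "\<exists>s>0. s < h \<and> \<phi> h - \<phi> 0 = (h - 0) * (ddir f u ((x + h *\<^sub>R v) + s *\<^sub>R u) - ddir f u (x + s *\<^sub>R u))"
    unfolding \<phi>_def
  proof (rule MVT2[OF \<open>h > 0\<close>])
    fix s assume "0 \<le> s" "s \<le> h"
    then have "x + h *\<^sub>R v + s *\<^sub>R u \<in> S" "x + s *\<^sub>R u \<in> S"
      using S[of s h] S[of s 0] \<open>h > 0\<close> by (simp_all add: algebra_simps)
    then show "((\<lambda>s. f (x + h *\<^sub>R v + s *\<^sub>R u) - f (x + s *\<^sub>R u)) has_real_derivative
        ddir f u (x + h *\<^sub>R v + s *\<^sub>R u) - ddir f u (x + s *\<^sub>R u)) (at s)"
      by (intro DERIV_diff line f)
  qed
  then obtain s where s: "0 < s" "s < h" "\<phi> h - \<phi> 0 = h * (ddir f u (x + s *\<^sub>R u + h *\<^sub>R v) - ddir f u (x + s *\<^sub>R u + 0 *\<^sub>R v))"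
    by (auto simp: algebra_simps)
  have "\<exists>t>0. t < h \<and> ddir f u (x + s *\<^sub>R u + h *\<^sub>R v) - ddir f u (x + s *\<^sub>R u + 0 *\<^sub>R v) = (h - 0) * ddir (ddir f u) v (x + s *\<^sub>R u + t *\<^sub>R v)"
    by (rule MVT2[OF \<open>h > 0\<close>]) (use S s in \<open>auto intro!: line fu\<close>)
  then obtain t where "0 < t" "t < h" "ddir f u (x + s *\<^sub>R u + h *\<^sub>R v) - ddir f u (x + s *\<^sub>R u + 0 *\<^sub>R v) = h * ddir (ddir f u) v (x + s *\<^sub>R u + t *\<^sub>R v)"
    by auto
  with s show ?thesis
    by (intro exI[of _ s] exI[of _ t]) (auto simp: \<phi>_def algebra_simps)
qed

text \<open>The second difference over the parallelogram spanned by \<open>h *\<^sub>R u\<close> and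
  \<open>h *\<^sub>R v\<close> is symmetric in \<open>u\<close> and \<open>v\<close>, and it is
  \<open>h * h\<close> times a value of either mixed derivative near \<open>x\<close>. Continuity at
  \<open>x\<close> then excludes a gap between them.\<close>

lemma ddir_commute_real:
  fixes f :: "'a::euclidean_space \<Rightarrow> real"
  assumes S: "open S" "smooth_on S f" "x \<in> S"
  shows "ddir (ddir f u) v x = ddir (ddir f v) u x"
proof (rule ccontr)
  assume ne: "ddir (ddir f u) v x \<noteq> ddir (ddir f v) u x"
  \<comment> \<open>Half of the gap: one number cannot lie within \<open>e\<close> of both mixed
    derivatives.\<close>
  define e where "e = \<bar>ddir (ddir f u) v x - ddir (ddir f v) u x\<bar> / 2"
  have "e > 0" using ne by (simp add: e_def)
  have c: "isCont (ddir (ddir f a) b) x" for a b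
    using smooth_on_continuous_on[OF smooth_on_ddir[OF smooth_on_ddir[OF S(2)]]] S continuous_on_eq_continuous_at by blast
  obtain d1 where d1: "d1 > 0" "\<And>y. dist y x < d1 \<Longrightarrow> dist (ddir (ddir f u) v y) (ddir (ddir f u) v x) < e"
    using c[of u v] \<open>e > 0\<close> unfolding continuous_at_eps_delta by (auto simp: dist_norm)
  obtain d2 where d2: "d2 > 0" "\<And>y. dist y x < d2 \<Longrightarrow> dist (ddir (ddir f v) u y) (ddir (ddir f v) u x) < e"
    using c[of v u] \<open>e > 0\<close> unfolding continuous_at_eps_delta by (auto simp: dist_norm)
  obtain d3 where d3: "d3 > 0" "ball x d3 \<subseteq> S" using S openE by blast
  define d where "d = min d1 (min d2 d3)"
  \<comment> \<open>Keeps the whole parallelogram within \<open>d\<close> of \<open>x\<close>. The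
    summand \<open>1\<close> makes the denominator positive even for \<open>u = v = 0\<close>, and
    the estimate strict.\<close>
  define h where "h = d / (norm u + norm v + 1)"
  have pos: "norm u + norm v + 1 > 0" by (simp add: add_nonneg_pos)
  have "d > 0" using d1 d2 d3 by (simp add: d_def)
  then have "h > 0" using pos by (simp add: h_def)
  have near: "dist (x + s *\<^sub>R u + t *\<^sub>R v) x < d" if "0 \<le> s" "s \<le> h" "0 \<le> t" "t \<le> h" for s t
  proof -
    have "dist (x + s *\<^sub>R u + t *\<^sub>R v) x = norm (s *\<^sub>R u + t *\<^sub>R v)" by (simp add: dist_norm)
    also have "\<dots> \<le> s * norm u + t * norm v" using that by (metis norm_triangle_ineq abs_of_nonneg norm_scaleR)
    also have "\<dots> \<le> h * norm u + h * norm v" using that by (intro add_mono mult_right_mono) auto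
    also have "\<dots> < h * (norm u + norm v + 1)" using \<open>h > 0\<close> by (simp add: algebra_simps)
    also have "\<dots> = d" using pos by (simp add: h_def)
    finally show ?thesis .
  qed
  have inS: "x + s *\<^sub>R u + t *\<^sub>R v \<in> S" if "0 \<le> s" "s \<le> h" "0 \<le> t" "t \<le> h" for s t
    using near[OF that] d3 by (auto simp: d_def mem_ball dist_commute)
  note sm = smooth_on_differentiable[OF S(2)] smooth_on_differentiable[OF smooth_on_ddir[OF S(2)]]
  from mixed_difference[OF \<open>h > 0\<close> inS sm]
  obtain s1 t1 where 1: "0 \<le> s1" "s1 \<le> h" "0 \<le> t1" "t1 \<le> h"
    "f (x + h *\<^sub>R u + h *\<^sub>R v) - f (x + h *\<^sub>R u) - f (x + h *\<^sub>R v) + f x = h * h * ddir (ddir f u) v (x + s1 *\<^sub>R u + t1 *\<^sub>R v)"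
    by auto
  have inS': "x + s *\<^sub>R v + t *\<^sub>R u \<in> S" if "0 \<le> s" "s \<le> h" "0 \<le> t" "t \<le> h" for s t
    using inS[of t s] that by (simp add: algebra_simps)
  from mixed_difference[OF \<open>h > 0\<close> inS' sm]
  obtain s2 t2 where 2: "0 \<le> s2" "s2 \<le> h" "0 \<le> t2" "t2 \<le> h"
    "f (x + h *\<^sub>R v + h *\<^sub>R u) - f (x + h *\<^sub>R v) - f (x + h *\<^sub>R u) + f x = h * h * ddir (ddir f v) u (x + t2 *\<^sub>R u + s2 *\<^sub>R v)"
    by (auto simp: algebra_simps)
  have "h * h * ddir (ddir f u) v (x + s1 *\<^sub>R u + t1 *\<^sub>R v) = h * h * ddir (ddir f v) u (x + t2 *\<^sub>R u + s2 *\<^sub>R v)"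
    using 1(5) 2(5) by (simp add: algebra_simps)
  then have "ddir (ddir f u) v (x + s1 *\<^sub>R u + t1 *\<^sub>R v) = ddir (ddir f v) u (x + t2 *\<^sub>R u + s2 *\<^sub>R v)"
    using \<open>h > 0\<close> by simp
  moreover have "dist (ddir (ddir f u) v (x + s1 *\<^sub>R u + t1 *\<^sub>R v)) (ddir (ddir f u) v x) < e"
    using near[OF 1(1-4)] by (intro d1) (simp add: d_def)
  moreover have "dist (ddir (ddir f v) u (x + t2 *\<^sub>R u + s2 *\<^sub>R v)) (ddir (ddir f v) u x) < e"
    using near[OF 2(3,4,1,2)] by (intro d2) (simp add: d_def)
  ultimately show False unfolding e_def dist_real_def by (smt (verit) field_sum_of_halves)
qed

lemma ddir_commute:
  fixes f :: "'a::euclidean_space \<Rightarrow> 'b::euclidean_space"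
  assumes S: "open S" "smooth_on S f" "x \<in> S"
  shows "ddir (ddir f u) v x = ddir (ddir f v) u x"
proof (rule euclidean_eqI)
  fix b :: 'b assume "b \<in> Basis"
  have bl: "bounded_linear (\<lambda>y. y \<bullet> b)" by (rule bounded_linear_inner_left)
  have 1: "ddir (\<lambda>x. f x \<bullet> b) u y = ddir f u y \<bullet> b" if "y \<in> S" for u y
    using ddir_bounded_linear[OF bl] smooth_on_differentiable[OF S(2) that] by blast
  have 2: "ddir (ddir (\<lambda>x. f x \<bullet> b) u) v x = ddir (ddir f u) v x \<bullet> b" for u v
    using trans[OF ddir_cong[OF S(1) 1 S(3)] ddir_bounded_linear[OF bl smooth_on_differentiable[OF smooth_on_ddir[OF S(2)] S(3)]]] .
  show "ddir (ddir f u) v x \<bullet> b = ddir (ddir f v) u x \<bullet> b"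
    using ddir_commute_real[OF S(1) smooth_on_bounded_linear[OF S(1) bl S(2)] S(3)] unfolding 2 .
qed

section \<open>Radial integral equations\<close>

text \<open>A weighted mean of \<open>f\<close> over the segment from the origin to
  \<open>z\<close>. Each derivative in \<open>z\<close> brings out a factor \<open>t\<close> by the
  chain rule, so the weights \<open>t ^ j\<close> make the family closed under
  differentiation.\<close>

definition radint :: "nat \<Rightarrow> ('a::euclidean_space \<Rightarrow> 'b::banach) \<Rightarrow> 'a \<Rightarrow> 'b" where
  "radint j f z = integral {0..1} (\<lambda>t. t ^ j *\<^sub>R f (t *\<^sub>R z))"

lemma norm_scaleR_unit_le:
  fixes z :: "'a::real_normed_vector"
  shows "t \<in> {0..1} \<Longrightarrow> norm (t *\<^sub>R z) \<le> norm z"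
  by (auto intro: mult_left_le_one_le)

lemma scaleR_unit_in_ball:
  fixes z :: "'a::real_normed_vector"
  shows "t \<in> {0..1} \<Longrightarrow> z \<in> ball 0 r \<Longrightarrow> t *\<^sub>R z \<in> ball 0 r"
  using norm_scaleR_unit_le[of t z] by (auto simp del: norm_scaleR)

lemma continuous_on_radial:
  fixes f :: "'a::real_normed_vector \<Rightarrow> 'b::real_normed_vector"
  assumes "continuous_on (ball 0 r) f" "z \<in> ball 0 r"
  shows "continuous_on {0..1} (\<lambda>t. t ^ j *\<^sub>R f (t *\<^sub>R z))"
proof -
  have "(\<lambda>t. t *\<^sub>R z) ` {0..1} \<subseteq> ball 0 r" using scaleR_unit_in_ball[OF _ assms(2)] by blast
  then show ?thesis by (intro continuous_intros continuous_on_compose2[OF assms(1)])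
qed

lemma radial_image_subset: "(\<lambda>p. snd p *\<^sub>R fst p) ` (ball 0 r \<times> cbox 0 (1::real)) \<subseteq> ball (0::'a::real_normed_vector) r"
proof (rule image_subsetI)
  show "snd p *\<^sub>R fst p \<in> ball 0 r" if "p \<in> ball 0 r \<times> cbox 0 1" for p :: "'a \<times> real"
    using that scaleR_unit_in_ball[of "snd p" "fst p" r] by (auto simp: mem_Times_iff)
qed

text \<open>The weight is at most 1 on the unit interval, so the bound is the same for every
  \<open>j\<close>. It refers only to points no farther from the origin than \<open>z\<close>, which
  lets pointwise estimates be iterated.\<close>

lemma norm_radint_le:
  assumes "continuous_on (ball 0 r) f" "z \<in> ball 0 r" "\<And>y. norm y \<le> norm z \<Longrightarrow> norm (f y) \<le> C"
  shows "norm (radint j f z) \<le> C"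
proof -
  have "norm (t ^ j *\<^sub>R f (t *\<^sub>R z)) \<le> C" if t: "t \<in> {0..1}" for t
  proof -
    have "norm (t ^ j *\<^sub>R f (t *\<^sub>R z)) = t ^ j * norm (f (t *\<^sub>R z))" using t by simp
    also have "\<dots> \<le> 1 * norm (f (t *\<^sub>R z))" using t by (intro mult_right_mono power_le_one) auto
    also have "\<dots> \<le> C" using assms(3)[OF norm_scaleR_unit_le[OF t]] by simp
    finally show ?thesis .
  qed
  from integral_bound[OF _ continuous_on_radial[OF assms(1,2)] this] show ?thesis
    by (simp add: radint_def)
qed

lemma radint_add:
  assumes "continuous_on (ball 0 r) f" "continuous_on (ball 0 r) g" "z \<in> ball 0 r"
  shows "radint j (\<lambda>y. f y + g y) z = radint j f z + radint j g z"
  unfolding radint_def scaleR_add_right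
  using continuous_on_radial[OF assms(1,3)] continuous_on_radial[OF assms(2,3)]
  by (intro integral_add integrable_continuous_real)

lemma radint_diff:
  assumes "continuous_on (ball 0 r) f" "continuous_on (ball 0 r) g" "z \<in> ball 0 r"
  shows "radint j (\<lambda>y. f y - g y) z = radint j f z - radint j g z"
  unfolding radint_def scaleR_diff_right
  using continuous_on_radial[OF assms(1,3)] continuous_on_radial[OF assms(2,3)]
  by (intro integral_diff integrable_continuous_real)

lemma radint_cong:
  assumes "\<And>y. y \<in> ball 0 r \<Longrightarrow> f y = g y" "z \<in> ball 0 r"
  shows "radint j f z = radint j g z"
  unfolding radint_def using assms(1)[OF scaleR_unit_in_ball[OF _ assms(2)]] by (intro integral_cong) simp

lemma continuous_on_radint:
  assumes "continuous_on (ball 0 r) f"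
  shows "continuous_on (ball 0 r) (radint j f)"
proof -
  have "continuous_on (ball 0 r \<times> cbox 0 1) (\<lambda>(z, t::real). t ^ j *\<^sub>R f (t *\<^sub>R z))"
    unfolding split_beta
    by (intro continuous_intros continuous_on_compose2[OF assms _ radial_image_subset])
  from integral_continuous_on_param[OF this] show ?thesis
    by (simp add: radint_def[abs_def])
qed

lemma has_derivative_radint:
  fixes f :: "'a::euclidean_space \<Rightarrow> 'b::banach"
  assumes "Ck_on 1 (ball 0 r) f" "z \<in> ball 0 r"
  shows "(radint j f has_derivative (\<lambda>v. radint (Suc j) (ddir f v) z)) (at z)"
proof -
  have diff: "f differentiable (at y)" if "y \<in> ball 0 r" for y
    using assms that by (simp add: Ck_on_Suc_ddir)
  have cont: "continuous_on (ball 0 r) (ddir f v)" for v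
    using assms by (simp add: Ck_on_Suc_ddir)
  \<comment> \<open>The Leibniz rule asks for the derivative as a continuous map into bounded linear
    operators. In finite dimension this follows from the continuity of every
    \<open>ddir f v\<close>.\<close>
  define D where "D y = Blinfun (\<lambda>v. ddir f v y)" for y
  have D: "blinfun_apply (D y) v = ddir f v y" if "y \<in> ball 0 r" for y v
    unfolding D_def using has_derivative_bounded_linear[OF has_derivative_ddir[OF diff[OF that]]]
    by (simp add: bounded_linear_Blinfun_apply)
  have Dcont: "continuous_on (ball 0 r) D"
    by (rule continuous_on_blinfun_componentwise, rule continuous_on_eq[OF cont D[symmetric]])
  have rcont: "continuous_on (ball 0 r \<times> cbox 0 1) (\<lambda>(z, t::real). t ^ Suc j *\<^sub>R D (t *\<^sub>R z))"
    unfolding split_beta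
    by (intro continuous_intros continuous_on_compose2[OF Dcont _ radial_image_subset])
  have "((\<lambda>z. integral (cbox 0 1) (\<lambda>t. t ^ j *\<^sub>R f (t *\<^sub>R z))) has_derivative
      blinfun_apply (integral (cbox 0 1) (\<lambda>t. t ^ Suc j *\<^sub>R D (t *\<^sub>R z)))) (at z within ball 0 r)"
  proof (rule leibniz_rule[OF _ _ rcont assms(2) convex_ball])
    fix y :: 'a and t assume y: "y \<in> ball 0 r" and "t \<in> cbox 0 (1::real)"
    then have t: "t \<in> {0..1}" by simp
    have "((\<lambda>x. t *\<^sub>R x) has_derivative (\<lambda>x. t *\<^sub>R x)) (at y)" by (auto intro!: derivative_eq_intros)
    from has_derivative_compose[OF this has_derivative_ddir[OF diff[OF scaleR_unit_in_ball[OF t y]]]]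
    have "((\<lambda>x. f (t *\<^sub>R x)) has_derivative (\<lambda>v. ddir f (t *\<^sub>R v) (t *\<^sub>R y))) (at y)" .
    from has_derivative_scaleR_right[OF this, of "t ^ j"]
    have "((\<lambda>x. t ^ j *\<^sub>R f (t *\<^sub>R x)) has_derivative (\<lambda>v. t ^ j *\<^sub>R ddir f (t *\<^sub>R v) (t *\<^sub>R y))) (at y within ball 0 r)"
      by (rule has_derivative_at_withinI)
    also have "(\<lambda>v. t ^ j *\<^sub>R ddir f (t *\<^sub>R v) (t *\<^sub>R y)) = blinfun_apply (t ^ Suc j *\<^sub>R D (t *\<^sub>R y))"
      using D[OF scaleR_unit_in_ball[OF t y]] linear_cmul[OF linear_ddir[OF diff[OF scaleR_unit_in_ball[OF t y]]]]
      by (auto simp: fun_eq_iff scaleR_blinfun.rep_eq mult.commute)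
    finally show "((\<lambda>x. t ^ j *\<^sub>R f (t *\<^sub>R x)) has_derivative blinfun_apply (t ^ Suc j *\<^sub>R D (t *\<^sub>R y))) (at y within ball 0 r)" .
  next
    fix y :: 'a assume "y \<in> ball 0 r"
    from continuous_on_radial[OF Ck_on_imp_continuous_on[OF assms(1)] this]
    show "(\<lambda>t. t ^ j *\<^sub>R f (t *\<^sub>R y)) integrable_on cbox 0 1"
      by (simp add: integrable_continuous_real)
  qed
  moreover have "blinfun_apply (integral (cbox 0 1) (\<lambda>t. t ^ Suc j *\<^sub>R D (t *\<^sub>R z))) v = radint (Suc j) (ddir f v) z" for v
  proof -
    have "(\<lambda>t. t ^ Suc j *\<^sub>R D (t *\<^sub>R z)) integrable_on cbox 0 1"
      using integrable_continuous_real[OF continuous_on_radial[OF Dcont assms(2), of "Suc j"]] by simp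
    from blinfun_apply_integral[OF this, of v]
    show ?thesis unfolding radint_def
      using D scaleR_unit_in_ball[OF _ assms(2)] by (auto simp: scaleR_blinfun.rep_eq intro!: integral_cong)
  qed
  then have "blinfun_apply (integral (cbox 0 1) (\<lambda>t. t ^ Suc j *\<^sub>R D (t *\<^sub>R z))) = (\<lambda>v. radint (Suc j) (ddir f v) z)"
    by (rule ext)
  ultimately show ?thesis
    using assms(2) by (simp add: radint_def[abs_def] at_within_open[OF _ open_ball])
qed

lemma Ck_on_1I: "Ck_on (Suc k) S f \<Longrightarrow> Ck_on 1 S f"
  by (induction k) (auto dest: Ck_on_SucD)

lemma Ck_on_radint: "Ck_on k (ball 0 r) f \<Longrightarrow> Ck_on k (ball 0 r) (radint j f)"
proof (induction k arbitrary: f j)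
  case 0
  then show ?case by (simp add: continuous_on_radint)
next
  case (Suc k)
  note der = has_derivative_radint[OF Ck_on_1I[OF Suc.prems]]
  have "Ck_on k (ball 0 r) (ddir (radint j f) v)" for v
  proof (rule Ck_on_cong[OF open_ball])
    show "Ck_on k (ball 0 r) (radint (Suc j) (ddir f v))"
      using Suc.prems by (intro Suc.IH) (simp add: Ck_on_Suc_ddir)
    show "radint (Suc j) (ddir f v) z = ddir (radint j f) v z" if "z \<in> ball 0 r" for z
      using ddir_eqI[OF der[OF that]] by simp
  qed
  moreover have "radint j f differentiable (at z)" if "z \<in> ball 0 r" for z
    using der[OF that] differentiable_def by blast
  ultimately show ?case unfolding Ck_on_Suc_ddir by blast
qed

lemma smooth_on_radint: "smooth_on (ball 0 r) f \<Longrightarrow> smooth_on (ball 0 r) (radint j f)"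
  by (simp add: smooth_on_def Ck_on_radint)

lemma ddir_radint:
  assumes "smooth_on (ball 0 r) f" "z \<in> ball 0 r"
  shows "ddir (radint j f) v z = radint (Suc j) (ddir f v) z"
  using ddir_eqI[OF has_derivative_radint[OF _ assms(2), of f j]] assms(1) by (simp add: smooth_on_def)

text \<open>Integrate the derivative of \<open>t *\<^sub>R f (t *\<^sub>R z)\<close> over the unit
  interval. This identity recovers the differential equation from the integral equation.\<close>

lemma radint_euler:
  assumes "smooth_on (ball 0 r) f" "z \<in> ball 0 r"
  shows "radint 1 (ddir f z) z + radint 0 f z = f z"
proof -
  have c: "continuous_on (ball 0 r) f" "continuous_on (ball 0 r) (ddir f z)"
    using assms smooth_on_continuous_on smooth_on_ddir by blast+
  have "((\<lambda>t. t ^ 1 *\<^sub>R ddir f z (t *\<^sub>R z) + t ^ 0 *\<^sub>R f (t *\<^sub>R z)) has_integral 1 *\<^sub>R f (1 *\<^sub>R z) - 0 *\<^sub>R f (0 *\<^sub>R z)) {0..1}"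
  proof (rule fundamental_theorem_of_calculus)
    fix t :: real assume t: "t \<in> {0..1}"
    have d: "f differentiable (at (t *\<^sub>R z))"
      using smooth_on_differentiable[OF assms(1)] scaleR_unit_in_ball[OF t assms(2)] by blast
    have "((\<lambda>t. t *\<^sub>R z) has_derivative (\<lambda>s. s *\<^sub>R z)) (at t)" by (auto intro!: derivative_eq_intros)
    from has_derivative_compose[OF this has_derivative_ddir[OF d]]
    have "((\<lambda>t. f (t *\<^sub>R z)) has_vector_derivative ddir f z (t *\<^sub>R z)) (at t)"
      using linear_cmul[OF linear_ddir[OF d]] by (simp add: has_vector_derivative_def)
    from has_vector_derivative_scaleR[OF DERIV_ident this]
    have "((\<lambda>t. t *\<^sub>R f (t *\<^sub>R z)) has_vector_derivative (t *\<^sub>R ddir f z (t *\<^sub>R z) + f (t *\<^sub>R z))) (at t)"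
      by simp
    then show "((\<lambda>t. t *\<^sub>R f (t *\<^sub>R z)) has_vector_derivative (t ^ 1 *\<^sub>R ddir f z (t *\<^sub>R z) + t ^ 0 *\<^sub>R f (t *\<^sub>R z))) (at t within {0..1})"
      by (simp add: has_vector_derivative_at_within)
  qed simp
  moreover have "integral {0..1} (\<lambda>t. t ^ 1 *\<^sub>R ddir f z (t *\<^sub>R z) + t ^ 0 *\<^sub>R f (t *\<^sub>R z))
      = radint 1 (ddir f z) z + radint 0 f z"
    unfolding radint_def
    by (intro integral_add integrable_continuous_real continuous_on_radial[OF _ assms(2)] c)
  ultimately show ?thesis by (simp add: integral_unique)
qed

text \<open>Any ratio between \<open>1/2\<close>, the contraction factor of the integral operator below, and \<open>1\<close> would do.\<close>

definition gconv :: "real \<Rightarrow> (nat \<Rightarrow> 'a::euclidean_space \<Rightarrow> 'b::real_normed_vector) \<Rightarrow> bool" where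
  "gconv r f \<longleftrightarrow> (\<forall>\<rho><r. \<exists>C\<ge>0. \<forall>m z. norm z \<le> \<rho> \<longrightarrow> norm (f (Suc m) z - f m z) \<le> C * (3/4) ^ m)"

text \<open>Geometric convergence of all iterated derivatives of order at most \<open>k\<close>,
  each uniform on smaller balls: the condition under which the limit is of class
  \<open>C^k\<close>.\<close>

primrec cgeo :: "nat \<Rightarrow> real \<Rightarrow> (nat \<Rightarrow> 'a::euclidean_space \<Rightarrow> 'b::real_normed_vector) \<Rightarrow> bool" where
  "cgeo 0 r f \<longleftrightarrow> gconv r f"
| "cgeo (Suc k) r f \<longleftrightarrow> gconv r f \<and> (\<forall>v. cgeo k r (\<lambda>m. ddir (f m) v))"

lemma cgeo_gconv: "cgeo k r f \<Longrightarrow> gconv r f"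
  by (cases k) auto

lemma cgeo_SucD: "cgeo (Suc k) r f \<Longrightarrow> cgeo k r f"
  by (induction k arbitrary: f) auto

lemma gconv_cong:
  assumes "\<And>m z. z \<in> ball 0 r \<Longrightarrow> f m z = g m z" "gconv r f"
  shows "gconv r g"
  unfolding gconv_def
proof (intro allI impI)
  fix \<rho> assume "\<rho> < r"
  then obtain C where "C \<ge> 0" "\<And>m z. norm z \<le> \<rho> \<Longrightarrow> norm (f (Suc m) z - f m z) \<le> C * (3/4) ^ m"
    using assms(2) unfolding gconv_def by blast
  then show "\<exists>C\<ge>0. \<forall>m z. norm z \<le> \<rho> \<longrightarrow> norm (g (Suc m) z - g m z) \<le> C * (3/4) ^ m"
    using \<open>\<rho> < r\<close> by (intro exI[of _ C]) (simp flip: assms(1))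
qed

lemma cgeo_cong:
  assumes "\<And>m z. z \<in> ball 0 r \<Longrightarrow> f m z = g m z" "cgeo k r f"
  shows "cgeo k r g"
  using assms
proof (induction k arbitrary: f g)
  case 0
  then show ?case using gconv_cong[of r f g] by simp
next
  case (Suc k)
  have "cgeo k r (\<lambda>m. ddir (g m) v)" for v
  proof (rule Suc.IH[of "\<lambda>m. ddir (f m) v"])
    show "ddir (f m) v z = ddir (g m) v z" if "z \<in> ball 0 r" for m z
      by (rule ddir_cong[OF open_ball Suc.prems(1) that])
  qed (use Suc.prems in simp)
  then show ?case using Suc.prems gconv_cong[of r f g] by simp
qed

lemma gconv_const: "gconv r (\<lambda>m. f)"
  unfolding gconv_def by (intro allI impI exI[of _ 0]) simp

lemma cgeo_const: "cgeo k r (\<lambda>m. f)"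
  by (induction k arbitrary: f) (auto simp: gconv_const)

lemma gconv_add:
  assumes "gconv r f" "gconv r g"
  shows "gconv r (\<lambda>m z. f m z + g m z)"
  unfolding gconv_def
proof (intro allI impI)
  fix \<rho> assume "\<rho> < r"
  obtain C where C: "C \<ge> 0" "\<And>m z. norm z \<le> \<rho> \<Longrightarrow> norm (f (Suc m) z - f m z) \<le> C * (3/4) ^ m"
    using assms(1) \<open>\<rho> < r\<close> unfolding gconv_def by blast
  obtain D where D: "D \<ge> 0" "\<And>m z. norm z \<le> \<rho> \<Longrightarrow> norm (g (Suc m) z - g m z) \<le> D * (3/4) ^ m"
    using assms(2) \<open>\<rho> < r\<close> unfolding gconv_def by blast
  show "\<exists>C\<ge>0. \<forall>m z. norm z \<le> \<rho> \<longrightarrow> norm (f (Suc m) z + g (Suc m) z - (f m z + g m z)) \<le> C * (3/4) ^ m"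
  proof (intro exI[of _ "C + D"] conjI allI impI)
    fix m and z :: 'a assume "norm z \<le> \<rho>"
    from norm_triangle_mono[OF C(2)[OF this] D(2)[OF this], of m m]
    show "norm (f (Suc m) z + g (Suc m) z - (f m z + g m z)) \<le> (C + D) * (3/4) ^ m"
      by (simp add: algebra_simps)
  qed (use C D in simp)
qed

lemma cgeo_add:
  assumes "cgeo k r f" "cgeo k r g"
    "\<And>m. smooth_on (ball 0 r) (f m)" "\<And>m. smooth_on (ball 0 r) (g m)"
  shows "cgeo k r (\<lambda>m z. f m z + g m z)"
  using assms
proof (induction k arbitrary: f g)
  case 0
  then show ?case by (simp add: gconv_add)
next
  case (Suc k)
  have "cgeo k r (\<lambda>m. ddir (\<lambda>z. f m z + g m z) v)" for v
  proof (rule cgeo_cong[OF _ Suc.IH[of "\<lambda>m. ddir (f m) v" "\<lambda>m. ddir (g m) v"]])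
    show "ddir (f m) v z + ddir (g m) v z = ddir (\<lambda>z. f m z + g m z) v z" if "z \<in> ball 0 r" for m z
      using ddir_add[of "f m" z "g m" v] smooth_on_differentiable[OF Suc.prems(3) that]
        smooth_on_differentiable[OF Suc.prems(4) that] by simp
  qed (use Suc.prems in \<open>auto intro: smooth_on_ddir\<close>)
  then show ?case using Suc.prems by (simp add: gconv_add)
qed

text \<open>The fixed factor \<open>l\<close> may be unbounded on the open ball but is bounded on
  the compact ball of radius \<open>\<rho>\<close>. This is why the constants in
  \<open>gconv\<close> depend on \<open>\<rho>\<close>.\<close>

lemma gconv_bilinear:
  fixes l :: "'a::euclidean_space \<Rightarrow> 'b::real_normed_vector" and f :: "nat \<Rightarrow> 'a \<Rightarrow> 'c::real_normed_vector"
    and opr :: "'b \<Rightarrow> 'c \<Rightarrow> 'd::real_normed_vector"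
  assumes "bounded_bilinear opr" "continuous_on (ball 0 r) l" "gconv r f"
  shows "gconv r (\<lambda>m z. opr (l z) (f m z))"
  unfolding gconv_def
proof (intro allI impI)
  fix \<rho> assume "\<rho> < r"
  obtain C where C: "C \<ge> 0" "\<And>m z. norm z \<le> \<rho> \<Longrightarrow> norm (f (Suc m) z - f m z) \<le> C * (3/4) ^ m"
    using assms(3) \<open>\<rho> < r\<close> unfolding gconv_def by blast
  obtain K where K: "K > 0" "\<And>a b. norm (opr a b) \<le> norm a * norm b * K"
    using bounded_bilinear.pos_bounded[OF assms(1)] by blast
  have sub: "cball 0 \<rho> \<subseteq> ball (0::'a) r" using \<open>\<rho> < r\<close> by auto
  have "bounded (l ` cball 0 \<rho>)"
    by (intro compact_imp_bounded compact_continuous_image continuous_on_subset[OF assms(2) sub] compact_cball)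
  then obtain B where B: "B > 0" "\<And>z. norm z \<le> \<rho> \<Longrightarrow> norm (l z) \<le> B"
    unfolding bounded_pos by auto
  show "\<exists>C\<ge>0. \<forall>m z. norm z \<le> \<rho> \<longrightarrow> norm (opr (l z) (f (Suc m) z) - opr (l z) (f m z)) \<le> C * (3/4) ^ m"
  proof (intro exI[of _ "B * C * K"] conjI allI impI)
    fix m and z :: 'a assume z: "norm z \<le> \<rho>"
    have "norm (opr (l z) (f (Suc m) z) - opr (l z) (f m z)) = norm (opr (l z) (f (Suc m) z - f m z))"
      by (simp add: bounded_bilinear.diff_right[OF assms(1)])
    also have "\<dots> \<le> norm (l z) * norm (f (Suc m) z - f m z) * K" by (rule K)
    also have "\<dots> \<le> B * (C * (3/4) ^ m) * K"
      using B C K z by (intro mult_right_mono mult_mono) auto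
    finally show "norm (opr (l z) (f (Suc m) z) - opr (l z) (f m z)) \<le> B * C * K * (3/4) ^ m"
      by (simp add: mult_ac)
  qed (use B C K in simp)
qed

lemma cgeo_bilinear:
  assumes "bounded_bilinear opr" "smooth_on (ball 0 r) l" "cgeo k r f" "\<And>m. smooth_on (ball 0 r) (f m)"
  shows "cgeo k r (\<lambda>m z. opr (l z) (f m z))"
  using assms(2-)
proof (induction k arbitrary: l f)
  case 0
  then show ?case by (simp add: gconv_bilinear[OF assms(1)] smooth_on_continuous_on)
next
  case (Suc k)
  have "cgeo k r (\<lambda>m. ddir (\<lambda>z. opr (l z) (f m z)) v)" for v
  proof (rule cgeo_cong)
    show "cgeo k r (\<lambda>m z. opr (ddir l v z) (f m z) + opr (l z) (ddir (f m) v z))"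
      using Suc.prems cgeo_SucD[OF Suc.prems(2)]
      by (intro cgeo_add Suc.IH smooth_on_bilinear[OF open_ball assms(1)] smooth_on_ddir) auto
    show "opr (ddir l v z) (f m z) + opr (l z) (ddir (f m) v z) = ddir (\<lambda>z. opr (l z) (f m z)) v z"
      if "z \<in> ball 0 r" for m z
      using ddir_bilinear[OF assms(1) smooth_on_differentiable[OF Suc.prems(1) that] smooth_on_differentiable[OF Suc.prems(3) that]]
      by simp
  qed
  then show ?case
    using Suc.prems gconv_bilinear[OF assms(1) smooth_on_continuous_on[OF Suc.prems(1)]] by simp
qed

lemma gconv_radint:
  assumes "gconv r f" "\<And>m. continuous_on (ball 0 r) (f m)"
  shows "gconv r (\<lambda>m. radint j (f m))"
  unfolding gconv_def
proof (intro allI impI)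
  fix \<rho> assume "\<rho> < r"
  obtain C where C: "C \<ge> 0" "\<And>m z. norm z \<le> \<rho> \<Longrightarrow> norm (f (Suc m) z - f m z) \<le> C * (3/4) ^ m"
    using assms(1) \<open>\<rho> < r\<close> unfolding gconv_def by blast
  show "\<exists>C\<ge>0. \<forall>m z. norm z \<le> \<rho> \<longrightarrow> norm (radint j (f (Suc m)) z - radint j (f m) z) \<le> C * (3/4) ^ m"
  proof (intro exI[of _ C] conjI allI impI)
    fix m and z :: 'a assume z: "norm z \<le> \<rho>"
    then have zr: "z \<in> ball 0 r" using \<open>\<rho> < r\<close> by simp
    show "norm (radint j (f (Suc m)) z - radint j (f m) z) \<le> C * (3/4) ^ m"
      unfolding radint_diff[OF assms(2,2) zr, symmetric]
      by (rule norm_radint_le[OF _ zr]) (use C z assms(2) in \<open>auto intro!: continuous_intros\<close>)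
  qed (use C in simp)
qed

lemma cgeo_radint:
  assumes "cgeo k r f" "\<And>m. smooth_on (ball 0 r) (f m)"
  shows "cgeo k r (\<lambda>m. radint j (f m))"
  using assms
proof (induction k arbitrary: f j)
  case 0
  then show ?case by (simp add: gconv_radint smooth_on_continuous_on)
next
  case (Suc k)
  have "cgeo k r (\<lambda>m. ddir (radint j (f m)) v)" for v
  proof (rule cgeo_cong)
    show "cgeo k r (\<lambda>m. radint (Suc j) (ddir (f m) v))"
      using Suc.prems by (intro Suc.IH smooth_on_ddir) auto
    show "radint (Suc j) (ddir (f m) v) z = ddir (radint j (f m)) v z" if "z \<in> ball 0 r" for m z
      using ddir_radint[OF Suc.prems(2) that] by simp
  qed
  then show ?case
    using Suc.prems gconv_radint[of r f j] by (simp add: smooth_on_continuous_on)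
qed

section \<open>Limits of geometrically convergent sequences\<close>

definition glim :: "(nat \<Rightarrow> 'a \<Rightarrow> 'b::banach) \<Rightarrow> 'a \<Rightarrow> 'b" where
  "glim f z = f 0 z + (\<Sum>i. f (Suc i) z - f i z)"

text \<open>The telescoping form of \<open>glim\<close> is made for the Weierstrass test: the
  increments are dominated by a geometric series.\<close>

lemma glim_uniform:
  fixes f :: "nat \<Rightarrow> 'a::euclidean_space \<Rightarrow> 'b::banach"
  assumes "gconv r f" "\<rho> < r"
  shows "uniform_limit (cball 0 \<rho>) f (glim f) sequentially"
proof -
  obtain C where C: "\<And>m z. norm z \<le> \<rho> \<Longrightarrow> norm (f (Suc m) z - f m z) \<le> C * (3/4) ^ m"
    using assms unfolding gconv_def by blast
  have "summable (\<lambda>m. C * (3/4) ^ m :: real)" by (intro summable_mult summable_geometric) simp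
  from Weierstrass_m_test[OF _ this, of "cball 0 \<rho>" "\<lambda>m z. f (Suc m) z - f m z"]
  have "uniform_limit (cball 0 \<rho>) (\<lambda>n z. \<Sum>i<n. f (Suc i) z - f i z) (\<lambda>z. \<Sum>i. f (Suc i) z - f i z) sequentially"
    using C by simp
  from uniform_limit_add[OF uniform_limit_const[where c="f 0"] this]
  moreover have "f 0 z + (\<Sum>i<n. f (Suc i) z - f i z) = f n z" for n z
    using sum_lessThan_telescope[of "\<lambda>i. f i z" n] by simp
  ultimately show ?thesis by (simp add: glim_def[abs_def])
qed

lemma glim_tendsto:
  assumes "gconv r f" "z \<in> ball 0 r"
  shows "(\<lambda>m. f m z) \<longlonglongrightarrow> glim f z"
  using tendsto_uniform_limitI[OF glim_uniform[OF assms(1), of "norm z"]] assms(2) by simp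

lemma in_smaller_ball:
  assumes "(z::'a::real_normed_vector) \<in> ball 0 r"
  obtains \<rho> where "\<rho> < r" "z \<in> ball 0 \<rho>"
  using assms dense[of "norm z" r] by auto

lemma continuous_on_glim:
  fixes f :: "nat \<Rightarrow> 'a::euclidean_space \<Rightarrow> 'b::banach"
  assumes "gconv r f" "\<And>m. continuous_on (ball 0 r) (f m)"
  shows "continuous_on (ball 0 r) (glim f)"
proof (rule continuous_at_imp_continuous_on, rule ballI)
  fix z :: 'a assume "z \<in> ball 0 r"
  then obtain \<rho> where \<rho>: "\<rho> < r" "z \<in> ball 0 \<rho>" by (rule in_smaller_ball)
  have "continuous_on (cball 0 \<rho>) (glim f)"
    using \<rho> by (intro uniform_limit_theorem[OF _ glim_uniform[OF assms(1) \<rho>(1)]] always_eventually allI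
        continuous_on_subset[OF assms(2)]) auto
  then have "continuous_on (ball 0 \<rho>) (glim f)" by (rule continuous_on_subset) auto
  then show "isCont (glim f) z" using \<rho>(2) continuous_on_eq_continuous_at open_ball by blast
qed

text \<open>Termwise differentiation needs the derivatives to converge uniformly in operator norm.
  Uniform convergence along the finitely many basis directions is enough, because the derivatives
  and their limits are linear in the direction.\<close>

lemma has_derivative_glim:
  fixes f :: "nat \<Rightarrow> 'a::euclidean_space \<Rightarrow> 'b::banach"
  assumes "cgeo 1 r f" "\<And>m. smooth_on (ball 0 r) (f m)" "z \<in> ball 0 r"
  shows "(glim f has_derivative (\<lambda>v. glim (\<lambda>m. ddir (f m) v) z)) (at z)"
proof -
  have g0: "gconv r f" and g1: "gconv r (\<lambda>m. ddir (f m) v)" for v using assms(1) by simp_all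
  obtain \<rho> where \<rho>: "\<rho> < r" "z \<in> ball 0 \<rho>" using assms(3) by (rule in_smaller_ball)
  have sub: "ball 0 \<rho> \<subseteq> ball (0::'a) r" using \<rho> by auto
  define G where "G y v = glim (\<lambda>m. ddir (f m) v) y" for y v
  have lin: "ddir (f m) v y = (\<Sum>b\<in>Basis. (v \<bullet> b) *\<^sub>R ddir (f m) b y)" if "y \<in> ball 0 r" for m v y
    using ddir_Basis_expand[OF smooth_on_differentiable[OF assms(2) that]] .
  have Glin: "G y v = (\<Sum>b\<in>Basis. (v \<bullet> b) *\<^sub>R G y b)" if y: "y \<in> ball 0 r" for v y
  proof (rule LIMSEQ_unique)
    show "(\<lambda>m. ddir (f m) v y) \<longlonglongrightarrow> G y v" unfolding G_def by (rule glim_tendsto[OF g1 y])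
    show "(\<lambda>m. ddir (f m) v y) \<longlonglongrightarrow> (\<Sum>b\<in>Basis. (v \<bullet> b) *\<^sub>R G y b)"
      unfolding lin[OF y, of _ v] G_def by (intro tendsto_sum tendsto_scaleR tendsto_const glim_tendsto[OF g1 y])
  qed
  have "\<exists>g. \<forall>x\<in>ball 0 \<rho>. (\<lambda>n. f n x) \<longlonglongrightarrow> g x \<and> (g has_derivative G x) (at x within ball 0 \<rho>)"
  proof (rule has_derivative_sequence)
    show "convex (ball (0::'a) \<rho>)" by simp
    show "(f n has_derivative (\<lambda>v. ddir (f n) v x)) (at x within ball 0 \<rho>)" if "x \<in> ball 0 \<rho>" for n x
      by (rule has_derivative_at_withinI[OF has_derivative_ddir[OF
            smooth_on_differentiable[OF assms(2) subsetD[OF sub that]]]])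
    show "z \<in> ball 0 \<rho>" by fact
    show "(\<lambda>n. f n z) \<longlonglongrightarrow> glim f z" by (rule glim_tendsto[OF g0 assms(3)])
    fix e :: real assume "e > 0"
    \<comment> \<open>A vector \<open>h\<close> has \<open>DIM('a)\<close> coordinates, each at most
      \<open>norm h\<close>, so the errors along the basis vectors add up to at most
      \<open>e * norm h\<close>.\<close>
    define e' where "e' = e / (real DIM('a))"
    have "e' > 0" using \<open>e > 0\<close> by (simp add: e'_def)
    have "\<forall>\<^sub>F n in sequentially. \<forall>b\<in>Basis. \<forall>x\<in>cball 0 \<rho>. dist (ddir (f n) b x) (G x b) < e'"
      unfolding G_def by (intro eventually_ball_finite ballI uniform_limitD[OF glim_uniform[OF g1 \<rho>(1)] \<open>e' > 0\<close>]) simp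
    then show "\<forall>\<^sub>F n in sequentially. \<forall>x\<in>ball 0 \<rho>. \<forall>h. norm (ddir (f n) h x - G x h) \<le> e * norm h"
    proof eventually_elim
      case (elim n)
      show ?case
      proof (intro ballI allI)
        fix x h :: 'a assume x: "x \<in> ball 0 \<rho>"
        then have xr: "x \<in> ball 0 r" using sub by blast
        have "norm (ddir (f n) h x - G x h) = norm (\<Sum>b\<in>Basis. (h \<bullet> b) *\<^sub>R (ddir (f n) b x - G x b))"
          unfolding lin[OF xr, of n h] Glin[OF xr, of h] by (simp add: sum_subtractf scaleR_diff_right)
        also have "\<dots> \<le> (\<Sum>b\<in>(Basis::'a set). norm h * e')"
        proof (rule sum_norm_le)
          fix b :: 'a assume b: "b \<in> Basis"
          have "x \<in> cball 0 \<rho>" using x by simp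
          then have "dist (ddir (f n) b x) (G x b) < e'" using elim b by blast
          then have "norm (ddir (f n) b x - G x b) \<le> e'" by (simp add: dist_norm)
          then show "norm ((h \<bullet> b) *\<^sub>R (ddir (f n) b x - G x b)) \<le> norm h * e'"
            using Basis_le_norm[OF b, of h] by (auto intro!: mult_mono)
        qed
        also have "\<dots> = e * norm h" by (simp add: e'_def)
        finally show "norm (ddir (f n) h x - G x h) \<le> e * norm h" .
      qed
    qed
  qed
  then obtain g where g: "\<And>x. x \<in> ball 0 \<rho> \<Longrightarrow> (\<lambda>n. f n x) \<longlonglongrightarrow> g x"
    "\<And>x. x \<in> ball 0 \<rho> \<Longrightarrow> (g has_derivative G x) (at x within ball 0 \<rho>)" by blast
  have eq: "g x = glim f x" if "x \<in> ball 0 \<rho>" for x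
    using LIMSEQ_unique[OF g(1)[OF that] glim_tendsto[OF g0]] that sub by blast
  have "(g has_derivative G z) (at z)" using g(2)[OF \<rho>(2)] \<rho>(2) by (simp add: at_within_open[OF _ open_ball])
  from has_derivative_transform_within_open[OF this open_ball \<rho>(2) eq]
  show ?thesis unfolding G_def .
qed

lemma Ck_on_glim:
  fixes f :: "nat \<Rightarrow> 'a::euclidean_space \<Rightarrow> 'b::banach"
  assumes "cgeo k r f" "\<And>m. smooth_on (ball 0 r) (f m)"
  shows "Ck_on k (ball 0 r) (glim f)"
  using assms
proof (induction k arbitrary: f)
  case 0
  then show ?case by (simp add: continuous_on_glim smooth_on_continuous_on)
next
  case (Suc k)
  have "cgeo 1 r f" using Suc.prems(1) cgeo_gconv by auto
  note der = has_derivative_glim[OF this Suc.prems(2)]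
  have "Ck_on k (ball 0 r) (ddir (glim f) v)" for v
  proof (rule Ck_on_cong[OF open_ball])
    show "Ck_on k (ball 0 r) (glim (\<lambda>m. ddir (f m) v))"
      using Suc.prems by (intro Suc.IH smooth_on_ddir) auto
    show "glim (\<lambda>m. ddir (f m) v) z = ddir (glim f) v z" if "z \<in> ball 0 r" for z
      using ddir_eqI[OF der[OF that]] by simp
  qed
  moreover have "glim f differentiable (at z)" if "z \<in> ball 0 r" for z
    using der[OF that] differentiable_def by blast
  ultimately show ?case unfolding Ck_on_Suc_ddir by blast
qed

section \<open>The Picard operator along rays\<close>

lemmas smooth_on_blinfun_apply = smooth_on_bilinear[OF _ bounded_bilinear_blinfun_apply]

text \<open>For \<open>j = 0\<close> this is the Picard integral of
  \<open>ddir F z z = N z (F z) z\<close> over the segment from \<open>0\<close> to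
  \<open>z\<close>. \<open>N\<close> takes the fibre vector first and the direction second; the
  direction \<open>z\<close> is the same along the whole ray and stands outside the integral. Larger
  \<open>j\<close> arise by differentiation.\<close>

definition transport_op ::
    "nat \<Rightarrow> ('a::euclidean_space \<Rightarrow> 'b \<Rightarrow>\<^sub>L 'a \<Rightarrow>\<^sub>L 'b) \<Rightarrow> ('a \<Rightarrow> 'b::banach) \<Rightarrow> 'a \<Rightarrow> 'b" where
  "transport_op j N f z = blinfun_apply (radint j (\<lambda>y. N y (f y)) z) z"

lemma smooth_on_transport_op:
  assumes "smooth_on (ball 0 r) N" "smooth_on (ball 0 r) f"
  shows "smooth_on (ball 0 r) (transport_op j N f)"
  unfolding transport_op_def[abs_def]
  by (intro smooth_on_blinfun_apply[OF open_ball] smooth_on_radint assms smooth_on_ident)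

text \<open>Three things depend on \<open>z\<close>: the coefficient \<open>N\<close>, the direction
  outside the integral and the function \<open>f\<close>. Only the last term contains a derivative
  of \<open>f\<close>, and there the operator returns unchanged except for
  \<open>j + 1\<close>.\<close>

lemma ddir_transport_op:
  assumes N: "smooth_on (ball 0 r) N" and f: "smooth_on (ball 0 r) f" and z: "z \<in> ball 0 r"
  shows "ddir (transport_op j N f) v z =
    transport_op (Suc j) (ddir N v) f z + blinfun_apply (radint j (\<lambda>y. N y (f y)) z) v
    + transport_op (Suc j) N (ddir f v) z"
proof -
  define P where "P y = N y (f y)" for y
  have P: "smooth_on (ball 0 r) P"
    unfolding P_def[abs_def] by (intro smooth_on_blinfun_apply[OF open_ball] N f)
  have dP: "ddir P v y = blinfun_apply (ddir N v y) (f y) + N y (ddir f v y)"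
    if "y \<in> ball 0 r" for y
    unfolding P_def[abs_def]
    by (rule ddir_bilinear[OF bounded_bilinear_blinfun_apply smooth_on_differentiable[OF N that] smooth_on_differentiable[OF f that]])
  have "ddir (transport_op j N f) v z = blinfun_apply (ddir (radint j P) v z) z + blinfun_apply (radint j P z) (ddir (\<lambda>z. z) v z)"
    unfolding transport_op_def[abs_def] P_def[symmetric]
    by (rule ddir_bilinear[OF bounded_bilinear_blinfun_apply smooth_on_differentiable[OF smooth_on_radint[OF P] z]]) simp
  also have "ddir (radint j P) v z = radint (Suc j) (ddir P v) z" by (rule ddir_radint[OF P z])
  also have "\<dots> = radint (Suc j) (\<lambda>y. blinfun_apply (ddir N v y) (f y) + N y (ddir f v y)) z"
    by (rule radint_cong[OF dP z])
  also have "\<dots> = radint (Suc j) (\<lambda>y. blinfun_apply (ddir N v y) (f y)) z + radint (Suc j) (\<lambda>y. N y (ddir f v y)) z"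
    by (intro radint_add[OF _ _ z] smooth_on_continuous_on smooth_on_blinfun_apply[OF open_ball] smooth_on_ddir N f)
  finally show ?thesis
    by (simp add: transport_op_def[abs_def] P_def plus_blinfun.rep_eq add_ac)
qed

text \<open>A contraction by \<open>1/2\<close>, uniformly in \<open>j\<close>: the weight is at
  most 1, and \<open>small\<close> absorbs the factor \<open>norm z < r\<close>. A bound on the ball
  of radius \<open>norm z\<close> yields one at \<open>z\<close>, so the estimate iterates on every
  smaller ball.\<close>

lemma norm_transport_op_diff_le:
  fixes N :: "'a::euclidean_space \<Rightarrow> 'b::banach \<Rightarrow>\<^sub>L 'a \<Rightarrow>\<^sub>L 'b"
  assumes N: "continuous_on (ball 0 r) N" and f: "continuous_on (ball 0 r) f" and g: "continuous_on (ball 0 r) g"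
    and small: "\<And>y w. y \<in> ball 0 r \<Longrightarrow> norm (N y w) * r \<le> norm w / 2"
    and z: "z \<in> ball 0 r" and C: "\<And>y. norm y \<le> norm z \<Longrightarrow> norm (f y - g y) \<le> C"
  shows "norm (transport_op j N f z - transport_op j N g z) \<le> C / 2"
proof -
  have r: "0 < r" using z by (metis ball_empty empty_iff not_le)
  have c: "continuous_on (ball 0 r) (\<lambda>y. N y (h y))" if "continuous_on (ball 0 r) h" for h
    by (rule bounded_bilinear.continuous_on[OF bounded_bilinear_blinfun_apply N that])
  have "transport_op j N f z - transport_op j N g z =
      blinfun_apply (radint j (\<lambda>y. N y (f y) - N y (g y)) z) z"
    unfolding transport_op_def radint_diff[OF c[OF f] c[OF g] z] by (simp add: minus_blinfun.rep_eq)
  also have "\<dots> = blinfun_apply (radint j (\<lambda>y. N y (f y - g y)) z) z"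
    by (simp add: blinfun.diff_right)
  also have "norm \<dots> \<le> norm (radint j (\<lambda>y. N y (f y - g y)) z) * norm z"
    by (rule norm_blinfun)
  also have "\<dots> \<le> (C / 2 / r) * norm z"
  proof (intro mult_right_mono norm_radint_le[OF _ z])
    show "continuous_on (ball 0 r) (\<lambda>y. N y (f y - g y))"
      by (intro c continuous_intros f g)
    fix y :: 'a assume y: "norm y \<le> norm z"
    then have "norm (N y (f y - g y)) * r \<le> norm (f y - g y) / 2"
      using z by (intro small) simp
    also have "\<dots> \<le> C / 2" using C[OF y] by simp
    finally show "norm (N y (f y - g y)) \<le> C / 2 / r" using r by (simp add: field_simps)
  qed simp
  also have "\<dots> \<le> (C / 2 / r) * r"
  proof (rule mult_left_mono)
    have "0 \<le> C" using C[of z] norm_ge_zero[of "f z - g z"] by linarith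
    then show "0 \<le> C / 2 / r" using r by simp
  qed (use z in simp)
  finally show ?thesis using r by simp
qed

lemma gconv_fixpoint:
  fixes N :: "'a::euclidean_space \<Rightarrow> 'b::banach \<Rightarrow>\<^sub>L 'a \<Rightarrow>\<^sub>L 'b"
  assumes N: "continuous_on (ball 0 r) N" and F: "\<And>m. continuous_on (ball 0 r) (F m)"
    and small: "\<And>y w. y \<in> ball 0 r \<Longrightarrow> norm (N y w) * r \<le> norm w / 2"
    and rec: "\<And>m z. z \<in> ball 0 r \<Longrightarrow> F (Suc m) z = H m z + transport_op j N (F m) z"
    and H: "gconv r H"
  shows "gconv r F"
  unfolding gconv_def
proof (intro allI impI)
  fix \<rho> assume "\<rho> < r"
  obtain C where C: "C \<ge> 0" "\<And>m z. norm z \<le> \<rho> \<Longrightarrow> norm (H (Suc m) z - H m z) \<le> C * (3/4) ^ m"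
    using H \<open>\<rho> < r\<close> unfolding gconv_def by blast
  have sub: "cball 0 \<rho> \<subseteq> ball (0::'a) r" using \<open>\<rho> < r\<close> by auto
  have "bounded ((\<lambda>z. F 1 z - F 0 z) ` cball 0 \<rho>)"
    by (intro compact_imp_bounded compact_continuous_image continuous_on_subset[OF _ sub] continuous_intros F compact_cball)
  then obtain B where B: "B > 0" "\<And>z. norm z \<le> \<rho> \<Longrightarrow> norm (F 1 z - F 0 z) \<le> B"
    unfolding bounded_pos by auto
  \<comment> \<open>\<open>B\<close> starts the induction. In its step the increment is at most
    \<open>C + K / 2\<close> times \<open>(3/4) ^ m\<close>, and \<open>4 * C \<le> K\<close> bounds
    this factor by \<open>3/4 * K\<close>.\<close>
  define K where "K = max B (4 * C)"
  have "norm (F (Suc m) z - F m z) \<le> K * (3/4) ^ m" if "norm z \<le> \<rho>" for m z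
    using that
  proof (induction m arbitrary: z)
    case 0
    then show ?case using B(2)[of z] by (simp add: K_def)
  next
    case (Suc m)
    have z: "z \<in> ball 0 r" using Suc.prems \<open>\<rho> < r\<close> by simp
    have "norm (transport_op j N (F (Suc m)) z - transport_op j N (F m) z) \<le> K * (3/4) ^ m / 2"
      using Suc.prems by (intro norm_transport_op_diff_le[OF N F F small z] Suc.IH) auto
    from norm_triangle_mono[OF C(2)[OF Suc.prems] this, of m]
    have "norm (F (Suc (Suc m)) z - F (Suc m) z) \<le> C * (3/4) ^ m + K * (3/4) ^ m / 2"
      unfolding rec[OF z] by (simp add: algebra_simps)
    also have "\<dots> = (C + K / 2) * (3/4) ^ m" by (simp add: algebra_simps)
    also have "\<dots> \<le> (K * (3/4)) * (3/4) ^ m"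
      by (rule mult_right_mono) (auto simp: K_def)
    finally show ?case by simp
  qed
  then show "\<exists>C\<ge>0. \<forall>m z. norm z \<le> \<rho> \<longrightarrow> norm (F (Suc m) z - F m z) \<le> C * (3/4) ^ m"
    using B by (intro exI[of _ K]) (auto simp: K_def)
qed

text \<open>The derivatives of the iterates satisfy an iteration of the same form, with \<open>j + 1\<close> in place of
  \<open>j\<close> and an inhomogeneity that involves only lower derivatives of the iterates.\<close>

lemma cgeo_fixpoint:
  fixes N :: "'a::euclidean_space \<Rightarrow> 'b::banach \<Rightarrow>\<^sub>L 'a \<Rightarrow>\<^sub>L 'b"
  assumes N: "smooth_on (ball 0 r) N"
    and small: "\<And>y w. y \<in> ball 0 r \<Longrightarrow> norm (N y w) * r \<le> norm w / 2"
    and "\<And>m. smooth_on (ball 0 r) (F m)" "\<And>m. smooth_on (ball 0 r) (H m)"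
    and "\<And>m z. z \<in> ball 0 r \<Longrightarrow> F (Suc m) z = H m z + transport_op j N (F m) z"
    and "cgeo k r H"
  shows "cgeo k r F"
  using assms(3-)
proof (induction k arbitrary: F H j)
  case 0
  then show ?case
    using gconv_fixpoint[OF smooth_on_continuous_on[OF N] _ small, of F H j]
    by (simp add: smooth_on_continuous_on)
next
  case (Suc k)
  note F = Suc.prems(1) and H = Suc.prems(2) and rec = Suc.prems(3)
  have Fk: "cgeo k r F" by (rule Suc.IH[OF F H rec cgeo_SucD[OF Suc.prems(4)]])
  have "cgeo k r (\<lambda>m. ddir (F m) v)" for v
  proof -
    \<comment> \<open>\<open>H1\<close> and \<open>H2\<close> are the terms of
      \<open>ddir_transport_op\<close> that do not differentiate \<open>F m\<close>. By
      \<open>Fk\<close> they converge to order \<open>k\<close>, so they may join the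
      inhomogeneity.\<close>
    define H1 where "H1 m z = transport_op (Suc j) (ddir N v) (F m) z" for m z
    define H2 where "H2 m z = blinfun_apply (radint j (\<lambda>y. N y (F m y)) z) v" for m z
    have sm1: "smooth_on (ball 0 r) (H1 m)" for m
      unfolding H1_def[abs_def] by (intro smooth_on_transport_op smooth_on_ddir N F)
    have sm2: "smooth_on (ball 0 r) (H2 m)" for m
      unfolding H2_def[abs_def]
      by (intro smooth_on_blinfun_apply[OF open_ball] smooth_on_radint N F smooth_on_const)
    have sr: "smooth_on (ball 0 r) (radint i (\<lambda>y. M y (F m y)))"
      if "smooth_on (ball 0 r) M" for m i and M :: "'a \<Rightarrow> 'b \<Rightarrow>\<^sub>L 'a \<Rightarrow>\<^sub>L 'b"
      by (intro smooth_on_blinfun_apply[OF open_ball] smooth_on_radint that F)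
    have cr: "cgeo k r (\<lambda>m. radint i (\<lambda>y. M y (F m y)))"
      if "smooth_on (ball 0 r) M" for i and M :: "'a \<Rightarrow> 'b \<Rightarrow>\<^sub>L 'a \<Rightarrow>\<^sub>L 'b"
      by (intro cgeo_radint cgeo_bilinear[OF bounded_bilinear_blinfun_apply] smooth_on_blinfun_apply[OF open_ball] that F Fk)
    have c1: "cgeo k r H1"
      unfolding H1_def[abs_def] transport_op_def
      by (rule cgeo_bilinear[OF bounded_bilinear.flip[OF bounded_bilinear_blinfun_apply] smooth_on_ident cr sr])
        (intro smooth_on_ddir N)+
    have c2: "cgeo k r H2"
      unfolding H2_def[abs_def]
      by (rule cgeo_bilinear[OF bounded_bilinear.flip[OF bounded_bilinear_blinfun_apply] smooth_on_const cr sr]) (rule N)+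
    show ?thesis
    proof (rule Suc.IH)
      show "smooth_on (ball 0 r) (ddir (F m) v)" for m by (rule smooth_on_ddir[OF F])
      show "smooth_on (ball 0 r) (\<lambda>z. ddir (H m) v z + (H1 m z + H2 m z))" for m
        by (intro smooth_on_add[OF open_ball] smooth_on_ddir[OF H] sm1 sm2)
      show "cgeo k r (\<lambda>m z. ddir (H m) v z + (H1 m z + H2 m z))"
        using Suc.prems(4)
        by (intro cgeo_add c1 c2 sm1 sm2 smooth_on_add[OF open_ball] smooth_on_ddir[OF H]) auto
      fix m and z :: 'a assume z: "z \<in> ball 0 r"
      have "ddir (F (Suc m)) v z = ddir (\<lambda>z. H m z + transport_op j N (F m) z) v z"
        by (rule ddir_cong[OF open_ball rec z])
      also have "\<dots> = ddir (H m) v z + ddir (transport_op j N (F m)) v z"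
        by (rule ddir_add[OF smooth_on_differentiable[OF H z] smooth_on_differentiable[OF smooth_on_transport_op[OF N F] z]])
      finally show "ddir (F (Suc m)) v z = ddir (H m) v z + (H1 m z + H2 m z) + transport_op (Suc j) N (ddir (F m) v) z"
        unfolding ddir_transport_op[OF N F z] H1_def H2_def by (simp add: add_ac)
    qed
  qed
  moreover have "gconv r F"
    using cgeo_gconv[OF Fk] .
  ultimately show ?case by simp
qed

text \<open>A smooth solution of the ordinary differential equation along all rays from the origin at once,
  obtained from the integral equation \<open>F = w + transport_op 0 N F\<close>.\<close>

lemma radial_transport:
  fixes N :: "'a::euclidean_space \<Rightarrow> 'b::banach \<Rightarrow>\<^sub>L 'a \<Rightarrow>\<^sub>L 'b"
  assumes N: "smooth_on (ball 0 r) N" and r: "0 < r"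
    and small: "\<And>y w. y \<in> ball 0 r \<Longrightarrow> norm (N y w) * r \<le> norm w / 2"
  obtains F where "smooth_on (ball 0 r) F" "F 0 = w"
    "\<And>z. z \<in> ball 0 r \<Longrightarrow> ddir F z z = N z (F z) z"
proof -
  define f where "f = rec_nat (\<lambda>z. w) (\<lambda>_ g z. w + transport_op 0 N g z)"
  have f0: "f 0 = (\<lambda>z. w)" and fS: "\<And>m. f (Suc m) = (\<lambda>z. w + transport_op 0 N (f m) z)"
    by (simp_all add: f_def)
  have sm: "smooth_on (ball 0 r) (f m)" for m
    by (induction m) (auto simp: f0 fS intro!: smooth_on_add smooth_on_transport_op[OF N])
  have cg: "cgeo k r f" for k
    by (rule cgeo_fixpoint[OF N small sm, where H="\<lambda>m z. w" and j=0]) (auto simp: fS cgeo_const)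
  have g: "gconv r f" using cg[of 0] by simp
  define F where "F = glim f"
  have F: "smooth_on (ball 0 r) F"
    unfolding F_def smooth_on_def using Ck_on_glim[OF cg sm] by blast
  have eq: "F z = w + transport_op 0 N F z" if z: "z \<in> ball 0 r" for z
  proof (rule LIMSEQ_unique)
    show "(\<lambda>m. f (Suc m) z) \<longlonglongrightarrow> F z"
      unfolding F_def by (rule LIMSEQ_Suc[OF glim_tendsto[OF g z]])
    have "(\<lambda>m. transport_op 0 N (f m) z) \<longlonglongrightarrow> transport_op 0 N F z"
    proof (rule LIMSEQ_I)
      fix e :: real assume "e > 0"
      have "uniform_limit (cball 0 (norm z)) f F sequentially"
        unfolding F_def using z by (intro glim_uniform[OF g]) simp
      from uniform_limitD[OF this \<open>e > 0\<close>]
      obtain M where M: "\<And>m y. m \<ge> M \<Longrightarrow> norm y \<le> norm z \<Longrightarrow> norm (f m y - F y) < e"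
        unfolding eventually_sequentially dist_norm Ball_def mem_cball_0 by blast
      have "norm (transport_op 0 N (f m) z - transport_op 0 N F z) < e" if "m \<ge> M" for m
      proof -
        have "norm (transport_op 0 N (f m) z - transport_op 0 N F z) \<le> e / 2"
          using M[OF that] by (intro norm_transport_op_diff_le[OF smooth_on_continuous_on[OF N]
                smooth_on_continuous_on[OF sm] smooth_on_continuous_on[OF F] small z]) (auto intro: less_imp_le)
        then show ?thesis using \<open>e > 0\<close> by simp
      qed
      then show "\<exists>M. \<forall>m\<ge>M. norm (transport_op 0 N (f m) z - transport_op 0 N F z) < e" by blast
    qed
    then show "(\<lambda>m. f (Suc m) z) \<longlonglongrightarrow> w + transport_op 0 N F z"
      unfolding fS by (intro tendsto_add tendsto_const)
  qed
  show ?thesis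
  proof (rule that[OF F])
    show "F 0 = w" using eq[of 0] r by (simp add: transport_op_def)
  next
    fix z :: 'a assume z: "z \<in> ball 0 r"
    define P where "P y = N y (F y)" for y
    have P: "smooth_on (ball 0 r) P"
      unfolding P_def[abs_def] by (intro smooth_on_blinfun_apply[OF open_ball] N F)
    have "ddir F z z = ddir (\<lambda>z. w + transport_op 0 N F z) z z"
      by (rule ddir_cong[OF open_ball eq z])
    also have "\<dots> = ddir (\<lambda>y. blinfun_apply (radint 0 P y) y) z z"
      using smooth_on_differentiable[OF smooth_on_transport_op[OF N F] z]
      by (subst ddir_add) (auto simp: transport_op_def[abs_def] P_def[abs_def])
    also have "\<dots> = blinfun_apply (ddir (radint 0 P) z z) z + blinfun_apply (radint 0 P z) (ddir (\<lambda>y. y) z z)"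
      by (rule ddir_bilinear[OF bounded_bilinear_blinfun_apply smooth_on_differentiable[OF smooth_on_radint[OF P] z]]) simp
    \<comment> \<open>The derivative is taken in the direction \<open>z\<close> itself, so both
      operators act on the same vector and \<open>radint_euler\<close> collapses their sum to
      \<open>P z\<close>.\<close>
    also have "\<dots> = blinfun_apply (radint 1 (ddir P z) z + radint 0 P z) z"
      using ddir_radint[OF P z] by (simp add: plus_blinfun.rep_eq)
    also have "\<dots> = blinfun_apply (P z) z" unfolding radint_euler[OF P z] ..
    finally show "ddir F z z = N z (F z) z" unfolding P_def .
  qed
qed

section \<open>Local geometry of a connection with parallel skew torsion\<close>

text \<open>The product rule for a point-dependent linear map that is known only through its values
  \<open>L y b\<close> on fixed vectors, as the metric, the torsion and the differential of a
  coordinate change are. Expanding \<open>X\<close> in \<open>Basis\<close> reduces it to products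
  with scalar functions.\<close>

lemma linear_family_differentiable:
  fixes L :: "'a::real_normed_vector \<Rightarrow> 'b::euclidean_space \<Rightarrow> 'c::real_normed_vector"
  assumes S: "open S" "z \<in> S" and lin: "\<And>y. y \<in> S \<Longrightarrow> linear (L y)"
    and L: "\<And>b. (\<lambda>y. L y b) differentiable (at z)" and X: "X differentiable (at z)"
  shows "(\<lambda>y. L y (X y)) differentiable (at z)"
    and "ddir (\<lambda>y. L y (X y)) u z = ddir (\<lambda>y. L y (X z)) u z + L z (ddir X u z)"
proof -
  have eq: "(\<Sum>b\<in>Basis. (x \<bullet> b) *\<^sub>R L y b) = L y x" if "y \<in> S" for x y
    by (rule linear_Basis_expand[OF lin[OF that], symmetric])
  have inner: "((\<lambda>y. X y \<bullet> b) has_derivative (\<lambda>u. ddir X u z \<bullet> b)) (at z)" for b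
    by (rule bounded_linear.has_derivative[OF bounded_linear_inner_left has_derivative_ddir[OF X]])
  have "((\<lambda>y. \<Sum>b\<in>Basis. (X y \<bullet> b) *\<^sub>R L y b) has_derivative
      (\<lambda>u. \<Sum>b\<in>Basis. (X z \<bullet> b) *\<^sub>R ddir (\<lambda>y. L y b) u z + (ddir X u z \<bullet> b) *\<^sub>R L z b)) (at z)"
    by (intro has_derivative_sum has_derivative_scaleR inner has_derivative_ddir L)
  then have der: "((\<lambda>y. L y (X y)) has_derivative
      (\<lambda>u. \<Sum>b\<in>Basis. (X z \<bullet> b) *\<^sub>R ddir (\<lambda>y. L y b) u z + (ddir X u z \<bullet> b) *\<^sub>R L z b)) (at z)"
    by (rule has_derivative_transform_within_open[OF _ S]) (rule eq)
  then show "(\<lambda>y. L y (X y)) differentiable (at z)" using differentiable_def by blast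
  have "((\<lambda>y. \<Sum>b\<in>Basis. (X z \<bullet> b) *\<^sub>R L y b) has_derivative
      (\<lambda>u. \<Sum>b\<in>Basis. (X z \<bullet> b) *\<^sub>R ddir (\<lambda>y. L y b) u z)) (at z)"
    by (intro has_derivative_sum has_derivative_scaleR_right has_derivative_ddir L)
  then have "((\<lambda>y. L y (X z)) has_derivative (\<lambda>u. \<Sum>b\<in>Basis. (X z \<bullet> b) *\<^sub>R ddir (\<lambda>y. L y b) u z)) (at z)"
    by (rule has_derivative_transform_within_open[OF _ S]) (rule eq)
  from ddir_eqI[OF this] ddir_eqI[OF der]
  show "ddir (\<lambda>y. L y (X y)) u z = ddir (\<lambda>y. L y (X z)) u z + L z (ddir X u z)"
    unfolding linear_Basis_expand[OF lin[OF S(2)], of "ddir X u z"] by (simp add: sum.distrib)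
qed

lemma linear_family_smooth:
  fixes L :: "'a::euclidean_space \<Rightarrow> 'b::euclidean_space \<Rightarrow> 'c::real_normed_vector"
  assumes S: "open S" and lin: "\<And>y. y \<in> S \<Longrightarrow> linear (L y)"
    and L: "\<And>b. smooth_on S (\<lambda>y. L y b)" and X: "smooth_on S X"
  shows "smooth_on S (\<lambda>y. L y (X y))"
proof (rule smooth_on_cong[OF S])
  show "(\<Sum>b\<in>Basis. (X y \<bullet> b) *\<^sub>R L y b) = L y (X y)" if "y \<in> S" for y
    by (rule linear_Basis_expand[OF lin[OF that], symmetric])
  show "smooth_on S (\<lambda>y. \<Sum>b\<in>Basis. (X y \<bullet> b) *\<^sub>R L y b)"
    by (intro smooth_on_sum smooth_on_bilinear[OF S bounded_bilinear_scaleR] L S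
        smooth_on_bounded_linear[OF S bounded_linear_inner_left X])
qed

lemma bilinear_family_differentiable:
  fixes B :: "'a::real_normed_vector \<Rightarrow> 'b::euclidean_space \<Rightarrow> 'c::euclidean_space \<Rightarrow> 'd::real_normed_vector"
  assumes S: "open S" "z \<in> S" and bil: "\<And>y. y \<in> S \<Longrightarrow> bilinear (B y)"
    and B: "\<And>a b. (\<lambda>y. B y a b) differentiable (at z)"
    and X: "X differentiable (at z)" and Y: "Y differentiable (at z)"
  shows "(\<lambda>y. B y (X y) (Y y)) differentiable (at z)"
    and "ddir (\<lambda>y. B y (X y) (Y y)) u z =
      ddir (\<lambda>y. B y (X z) (Y z)) u z + B z (ddir X u z) (Y z) + B z (X z) (ddir Y u z)"
proof -
  have lin1: "linear (\<lambda>x. B y x b)" and lin2: "linear (B y x)" if "y \<in> S" for y b x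
    using bil[OF that] by (auto simp: bilinear_def)
  have dY: "(\<lambda>y. B y a (Y y)) differentiable (at z)" for a
    by (rule linear_family_differentiable(1)[OF S lin2 B Y])
  show "(\<lambda>y. B y (X y) (Y y)) differentiable (at z)"
    by (rule linear_family_differentiable(1)[OF S lin1 dY X])
  have "ddir (\<lambda>y. B y (X y) (Y y)) u z = ddir (\<lambda>y. B y (X z) (Y y)) u z + B z (ddir X u z) (Y z)"
    by (rule linear_family_differentiable(2)[OF S lin1 dY X])
  also have "ddir (\<lambda>y. B y (X z) (Y y)) u z = ddir (\<lambda>y. B y (X z) (Y z)) u z + B z (X z) (ddir Y u z)"
    by (rule linear_family_differentiable(2)[OF S lin2 B Y])
  finally show "ddir (\<lambda>y. B y (X y) (Y y)) u z =
      ddir (\<lambda>y. B y (X z) (Y z)) u z + B z (ddir X u z) (Y z) + B z (X z) (ddir Y u z)"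
    by (simp add: add_ac)
qed

lemma bilinear_family_smooth:
  fixes B :: "'a::euclidean_space \<Rightarrow> 'b::euclidean_space \<Rightarrow> 'c::euclidean_space \<Rightarrow> 'd::real_normed_vector"
  assumes S: "open S" and bil: "\<And>y. y \<in> S \<Longrightarrow> bilinear (B y)"
    and B: "\<And>a b. smooth_on S (\<lambda>y. B y a b)" and X: "smooth_on S X" and Y: "smooth_on S Y"
  shows "smooth_on S (\<lambda>y. B y (X y) (Y y))"
proof -
  have lin1: "linear (\<lambda>x. B y x b)" and lin2: "linear (B y x)" if "y \<in> S" for y b x
    using bil[OF that] by (auto simp: bilinear_def)
  show ?thesis
    by (rule linear_family_smooth[OF S lin1 linear_family_smooth[OF S lin2 B Y] X])
qed

text \<open>A Hermitian connection read in a holomorphic chart. \<open>Gam\<close> is the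
  Christoffel symbol, direction of differentiation first; because of torsion it is in general not
  symmetric. \<open>J\<close> is constant since the coordinates are holomorphic, and
  \<open>Gam_J\<close> and \<open>G_compat\<close> express that \<open>J\<close> and the metric are
  parallel, tested on constant fields.\<close>

locale metric_chart =
  fixes Om :: "'v::euclidean_space set" and Gam :: "'v \<Rightarrow> 'v \<Rightarrow> 'v \<Rightarrow> 'v"
    and G :: "'v \<Rightarrow> 'v \<Rightarrow> 'v \<Rightarrow> real" and J :: "'v \<Rightarrow> 'v"
  assumes open_Om: "open Om"
    and Gam_bilinear: "z \<in> Om \<Longrightarrow> bilinear (Gam z)"
    and Gam_smooth: "smooth_on Om (\<lambda>z. Gam z u v)"
    and J_linear: "linear J" and J_J: "J (J x) = - x"
    and Gam_J: "z \<in> Om \<Longrightarrow> Gam z u (J v) = J (Gam z u v)"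
    and G_bilinear: "z \<in> Om \<Longrightarrow> bilinear (G z)"
    and G_sym: "z \<in> Om \<Longrightarrow> G z x y = G z y x"
    and G_pos: "z \<in> Om \<Longrightarrow> x \<noteq> 0 \<Longrightarrow> G z x x > 0"
    and G_J: "z \<in> Om \<Longrightarrow> G z (J x) (J y) = G z x y"
    and G_smooth: "smooth_on Om (\<lambda>z. G z u v)"
    and G_compat: "z \<in> Om \<Longrightarrow> ddir (\<lambda>z. G z v w) u z = G z (Gam z u v) w + G z v (Gam z u w)"
begin

section \<open>Torsion, covariant derivative and curvature in coordinates\<close>

definition Tor :: "'v \<Rightarrow> 'v \<Rightarrow> 'v \<Rightarrow> 'v" where
  "Tor z u v = Gam z u v - Gam z v u"

definition nab :: "('v \<Rightarrow> 'v) \<Rightarrow> 'v \<Rightarrow> 'v \<Rightarrow> 'v" where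
  "nab X u z = ddir X u z + Gam z u (X z)"

text \<open>The curvature \<open>R(u, v)w\<close>: the constant fields \<open>u\<close> and
  \<open>v\<close> commute, and the covariant derivative along \<open>v\<close> of the constant
  field \<open>w\<close> is \<open>\<lambda>y. Gam y v w\<close>.\<close>

definition Cur :: "'v \<Rightarrow> 'v \<Rightarrow> 'v \<Rightarrow> 'v \<Rightarrow> 'v" where
  "Cur z u v w = nab (\<lambda>y. Gam y v w) u z - nab (\<lambda>y. Gam y u w) v z"

lemma Tor_bilinear: "z \<in> Om \<Longrightarrow> bilinear (Tor z)"
  using Gam_bilinear[of z] unfolding bilinear_def Tor_def[abs_def]
  by (auto intro!: linear_compose_sub)

lemma Tor_smooth: "smooth_on Om (\<lambda>z. Tor z u v)"
  unfolding Tor_def by (intro smooth_on_diff open_Om Gam_smooth)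

lemma Tor_antisym: "Tor z v u = - Tor z u v"
  by (simp add: Tor_def)

lemma G_nondegenerate: "z \<in> Om \<Longrightarrow> (\<And>w. G z x w = G z y w) \<Longrightarrow> x = y"
  using G_pos[of z "x - y"] bilinear_lsub[OF G_bilinear, of z x y "x - y"] by force

lemma nab_const [simp]: "nab (\<lambda>y. c) u z = Gam z u c"
  by (simp add: nab_def)

lemma G_differentiable: "z \<in> Om \<Longrightarrow> (\<lambda>y. G y u v) differentiable (at z)"
  by (rule smooth_on_differentiable[OF G_smooth])

lemma Tor_differentiable: "z \<in> Om \<Longrightarrow> (\<lambda>y. Tor y u v) differentiable (at z)"
  by (rule smooth_on_differentiable[OF Tor_smooth])

lemma G_nab:
  assumes z: "z \<in> Om" and X: "X differentiable (at z)" and Y: "Y differentiable (at z)"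
  shows "ddir (\<lambda>y. G y (X y) (Y y)) u z = G z (nab X u z) (Y z) + G z (X z) (nab Y u z)"
proof -
  have "ddir (\<lambda>y. G y (X y) (Y y)) u z =
      ddir (\<lambda>y. G y (X z) (Y z)) u z + G z (ddir X u z) (Y z) + G z (X z) (ddir Y u z)"
    by (rule bilinear_family_differentiable(2)[where S=Om])
      (auto intro: open_Om z X Y G_bilinear G_differentiable)
  then show ?thesis
    unfolding G_compat[OF z] nab_def
    by (simp add: bilinear_ladd[OF G_bilinear[OF z]] bilinear_radd[OF G_bilinear[OF z]])
qed

lemma nab_diff:
  assumes "z \<in> Om" "X differentiable (at z)" "Y differentiable (at z)"
  shows "nab (\<lambda>y. X y - Y y) u z = nab X u z - nab Y u z"
  unfolding nab_def
  using ddir_eqI[OF has_derivative_diff[OF has_derivative_ddir[OF assms(2)] has_derivative_ddir[OF assms(3)]]]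
  by (simp add: bilinear_rsub[OF Gam_bilinear[OF assms(1)]])

lemma nab_add:
  assumes "z \<in> Om" "X differentiable (at z)" "Y differentiable (at z)"
  shows "nab (\<lambda>y. X y + Y y) u z = nab X u z + nab Y u z"
  unfolding nab_def ddir_add[OF assms(2,3)]
  by (simp add: bilinear_radd[OF Gam_bilinear[OF assms(1)]])

lemma nab_scale:
  assumes "z \<in> Om" "X differentiable (at z)"
  shows "nab (\<lambda>y. c *\<^sub>R X y) u z = c *\<^sub>R nab X u z"
  unfolding nab_def ddir_bounded_linear[OF bounded_linear_scaleR_right assms(2)]
  by (simp add: bilinear_rmul[OF Gam_bilinear[OF assms(1)]] scaleR_add_right)

lemma nab_J:
  assumes "z \<in> Om" "X differentiable (at z)"
  shows "nab (\<lambda>y. J (X y)) u z = J (nab X u z)"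
  unfolding nab_def ddir_bounded_linear[OF linear_conv_bounded_linear[THEN iffD1, OF J_linear] assms(2)]
    Gam_J[OF assms(1)] linear_add[OF J_linear] ..

lemma Gam_differentiable: "z \<in> Om \<Longrightarrow> (\<lambda>y. Gam y u v) differentiable (at z)"
  by (rule smooth_on_differentiable[OF Gam_smooth])

text \<open>Differentiate \<open>G_compat\<close> once more. The terms with one covariant derivative
  on each argument are together symmetric in \<open>u\<close> and \<open>v\<close>, so the symmetry
  of the second derivatives of \<open>G\<close> leaves exactly the two curvature terms.\<close>

lemma Cur_skew:
  assumes z: "z \<in> Om"
  shows "G z (Cur z u v w) x = - G z (Cur z u v x) w"
proof -
  note gd = Gam_differentiable
  have second: "ddir (ddir (\<lambda>y. G y w x) v) u z =
      G z (nab (\<lambda>y. Gam y v w) u z) x + G z (Gam z v w) (Gam z u x) +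
      G z (Gam z u w) (Gam z v x) + G z w (nab (\<lambda>y. Gam y v x) u z)" for u v
  proof -
    have "ddir (ddir (\<lambda>y. G y w x) v) u z = ddir (\<lambda>y. G y (Gam y v w) x + G y w (Gam y v x)) u z"
      by (rule ddir_cong[OF open_Om G_compat z])
    also have "\<dots> = ddir (\<lambda>y. G y (Gam y v w) x) u z + ddir (\<lambda>y. G y w (Gam y v x)) u z"
      by (rule ddir_add; rule bilinear_family_differentiable(1)[where B=G, OF open_Om z])
        (auto intro: G_bilinear G_differentiable[OF z] gd[OF z])
    finally show ?thesis
      unfolding G_nab[OF z gd[OF z] differentiable_const] G_nab[OF z differentiable_const gd[OF z]] by simp
  qed
  from ddir_commute[OF open_Om G_smooth z, of w x v u]
  show ?thesis
    unfolding second Cur_def bilinear_lsub[OF G_bilinear[OF z]]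
    using G_sym[OF z, of w "nab (\<lambda>y. Gam y v x) u z"] G_sym[OF z, of w "nab (\<lambda>y. Gam y u x) v z"] by linarith
qed

end

locale bismut_chart = metric_chart Om Gam G J
  for Om :: "'v::euclidean_space set" and Gam G J +
  assumes Tor_skew: "z \<in> Om \<Longrightarrow> G z (Tor z x y) w = - G z (Tor z x w) y"
    and Tor_parallel: "z \<in> Om \<Longrightarrow> nab (\<lambda>y. Tor y v w) u z = Tor z (Gam z u v) w + Tor z v (Gam z u w)"
begin

section \<open>First Bianchi identity and symmetries of the curvature\<close>

lemma nab_Tor:
  assumes z: "z \<in> Om" and X: "X differentiable (at z)" and Y: "Y differentiable (at z)"
  shows "nab (\<lambda>y. Tor y (X y) (Y y)) u z = Tor z (nab X u z) (Y z) + Tor z (X z) (nab Y u z)"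
proof -
  have "nab (\<lambda>y. Tor y (X y) (Y y)) u z =
      nab (\<lambda>y. Tor y (X z) (Y z)) u z + Tor z (ddir X u z) (Y z) + Tor z (X z) (ddir Y u z)"
  proof -
    have "ddir (\<lambda>y. Tor y (X y) (Y y)) u z =
        ddir (\<lambda>y. Tor y (X z) (Y z)) u z + Tor z (ddir X u z) (Y z) + Tor z (X z) (ddir Y u z)"
      by (rule bilinear_family_differentiable(2)[where S=Om])
        (auto intro: open_Om z X Y Tor_bilinear Tor_differentiable)
    then show ?thesis unfolding nab_def by simp
  qed
  then show ?thesis
    unfolding Tor_parallel[OF z]
    by (simp add: nab_def bilinear_ladd[OF Tor_bilinear[OF z]] bilinear_radd[OF Tor_bilinear[OF z]])
qed

text \<open>Group the six terms of the curvature sum by the direction of differentiation. Each pair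
  is the covariant derivative of the torsion of two constant fields, which
  \<open>Tor_parallel\<close> expresses by \<open>Tor\<close> and \<open>Gam\<close>; the remaining
  Christoffel symbols combine to torsions.\<close>

lemma first_Bianchi:
  assumes z: "z \<in> Om"
  shows "Cur z u v w + Cur z v w u + Cur z w u v =
    Tor z (Tor z u v) w + Tor z (Tor z v w) u + Tor z (Tor z w u) v"
proof -
  have *: "nab (\<lambda>y. Gam y v w) u z - nab (\<lambda>y. Gam y w v) u z = Tor z (Gam z u v) w - Tor z (Gam z u w) v" for u v w
    using Tor_parallel[OF z, of v w u] Tor_antisym[of z "Gam z u w" v]
      nab_diff[OF z Gam_differentiable[OF z] Gam_differentiable[OF z], of v w w v u]
    by (simp add: Tor_def[abs_def])
  have "Cur z u v w + Cur z v w u + Cur z w u v =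
    (nab (\<lambda>y. Gam y v w) u z - nab (\<lambda>y. Gam y w v) u z) +
    (nab (\<lambda>y. Gam y w u) v z - nab (\<lambda>y. Gam y u w) v z) +
    (nab (\<lambda>y. Gam y u v) w z - nab (\<lambda>y. Gam y v u) w z)"
    unfolding Cur_def by (simp add: algebra_simps)
  also have "\<dots> = (Tor z (Gam z u v) w - Tor z (Gam z v u) w) + (Tor z (Gam z v w) u - Tor z (Gam z w v) u)
     + (Tor z (Gam z w u) v - Tor z (Gam z u w) v)"
    unfolding * by (simp add: algebra_simps)
  finally show ?thesis
    unfolding bilinear_lsub[OF Tor_bilinear[OF z], symmetric] by (simp add: Tor_def[of z u v] Tor_def[of z v w] Tor_def[of z w u])
qed

lemma Cur_antisym: "Cur z v u w = - Cur z u v w"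
  by (simp add: Cur_def)

text \<open>Let \<open>b(u, v, w, x)\<close> be the sum of \<open>R u v w x\<close> over cyclic
  shifts of \<open>u, v, w\<close>. The skew-symmetries of \<open>R\<close> alone give \<open>b(u,
  v, w, x) + b(v, w, x, u) - b(w, x, u, v) - b(x, u, v, w) = 2 (R u v w x - R w x u v)\<close>. For
  a 4-form \<open>b\<close> the left side vanishes, since a cyclic shift of all four arguments is
  odd.\<close>

lemma Cur_pair_symmetric:
  assumes z: "z \<in> Om"
  shows "G z (Cur z u v w) x = G z (Cur z w x u) v"
proof -
  define R where "R u v w x = G z (Cur z u v w) x" for u v w x
  define t where "t u v w x = G z (Tor z u v) (Tor z w x)" for u v w x
  have tt: "G z (Tor z (Tor z u v) w) x = t u v w x" for u v w x
    using Tor_skew[OF z, of w "Tor z u v" x] Tor_antisym[of z "Tor z u v" w] G_sym[OF z, of "Tor z u v"]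
    by (simp add: t_def bilinear_lneg[OF G_bilinear[OF z]])
  have t: "t u v w x = - t v u w x" "t u v w x = t w x u v" for u v w x
    using Tor_antisym[of z v u] G_sym[OF z, of "Tor z u v"] by (simp_all add: t_def bilinear_lneg[OF G_bilinear[OF z]])
  have cyc: "R u v w x + R v w u x + R w u v x = t u v w x + t v w u x + t w u v x" for u v w x
    using arg_cong[OF first_Bianchi[OF z, of u v w], of "\<lambda>y. G z y x"]
    by (simp add: R_def tt bilinear_ladd[OF G_bilinear[OF z]])
  \<comment> \<open>The terms of the four cyclic sums, first in \<open>R\<close> and then in
    \<open>t\<close>, are brought to common representatives under these symmetries, so that a linear
    combination of the sums remains.\<close>
  have R: "R u v w x = - R v u w x" "R u v w x = - R u v x w" for u v w x
    using Cur_antisym[of z u v w] Cur_skew[OF z, of u v w x] by (simp_all add: R_def bilinear_lneg[OF G_bilinear[OF z]])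
  have "R w u v x = - R u w v x" "R v w x u = - R v w u x" "R w x v u = - R w x u v" "R x v w u = R v x u w"
    "R x u w v = R u x v w" "R u w x v = - R u w v x" "R x u v w = - R u x v w" "R u v x w = - R u v w x"
    using R(1)[of w u v x] R(2)[of v w x u] R(2)[of w x v u] R(1)[of x v w u] R(2)[of v x w u]
      R(1)[of x u w v] R(2)[of u x w v] R(2)[of u w x v] R(1)[of x u v w] R(2)[of u v x w] by linarith+
  moreover have "t v w u x = t u x v w" "t w u v x = - t u w v x" "t v w x u = - t u x v w"
    "t w x v u = - t u v w x" "t x v w u = t u w v x" "t w x u v = t u v w x" "t x u w v = t u x v w"
    "t u w x v = - t u w v x" "t x u v w = - t u x v w" "t u v x w = - t u v w x" "t v x u w = t u w v x"
    using t(2)[of v w u x] t(1)[of w u v x] t(2)[of v w x u] t(1)[of x u v w] t(2)[of w x v u] t(1)[of v u w x]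
      t(1)[of x v w u] t(2)[of v x w u] t(1)[of w u v x] t(2)[of w x u v] t(1)[of x u w v] t(2)[of u x w v] t(1)[of w v u x]
      t(2)[of u w x v] t(1)[of x v u w] t(2)[of u v x w] t(1)[of x w u v] t(2)[of v x u w] by linarith+
  ultimately have "R u v w x = R w x u v"
    using cyc[of u v w x] cyc[of v w x u] cyc[of w x u v] cyc[of x u v w] by linarith
  then show ?thesis by (simp add: R_def)
qed

lemma Cur_J: "z \<in> Om \<Longrightarrow> Cur z u v (J w) = J (Cur z u v w)"
proof -
  assume z: "z \<in> Om"
  have "nab (\<lambda>y. Gam y a (J w)) b z = J (nab (\<lambda>y. Gam y a w) b z)" for a b
  proof -
    have "nab (\<lambda>y. Gam y a (J w)) b z = nab (\<lambda>y. J (Gam y a w)) b z"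
      unfolding nab_def using ddir_cong[OF open_Om Gam_J z] Gam_J[OF z] by simp
    then show ?thesis unfolding nab_J[OF z Gam_differentiable[OF z]] .
  qed
  then show ?thesis by (simp add: Cur_def linear_diff[OF J_linear])
qed

text \<open>Pair symmetry moves \<open>J u\<close> and \<open>J v\<close> out of the two-form slots
  of the curvature into the other two, where \<open>J\<close> commutes with the curvature and
  preserves the metric.\<close>

lemma Cur_J_J:
  assumes z: "z \<in> Om"
  shows "Cur z (J u) (J v) w = Cur z u v w"
proof (rule G_nondegenerate[OF z])
  fix x
  have "G z (Cur z (J u) (J v) w) x = G z (J (Cur z w x u)) (J v)"
    unfolding Cur_pair_symmetric[OF z, of "J u"] Cur_J[OF z] ..
  then show "G z (Cur z (J u) (J v) w) x = G z (Cur z u v w) x"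
    unfolding G_J[OF z] Cur_pair_symmetric[OF z, of u v] .
qed

lemma Cur_J_left:
  assumes z: "z \<in> Om"
  shows "Cur z (J u) v w = - Cur z u (J v) w"
proof (rule G_nondegenerate[OF z])
  fix x
  have "G z (Cur z (J u) v w) x = - G z (Cur z w x (J u)) (J (J v))"
    unfolding Cur_pair_symmetric[OF z, of "J u"] J_J bilinear_rneg[OF G_bilinear[OF z]] by simp
  also have "\<dots> = - G z (Cur z u (J v) w) x"
    unfolding Cur_J[OF z] G_J[OF z] Cur_pair_symmetric[OF z, of u] ..
  finally show "G z (Cur z (J u) v w) x = G z (- Cur z u (J v) w) x"
    by (simp add: bilinear_lneg[OF G_bilinear[OF z]])
qed

text \<open>The real form of the bracket \<open>[X, Y] = -T(X, Y)\<close> of vectors \<open>X = x - \<i> Jx\<close>, \<open>Y = y - \<i> Jy\<close> of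
  type \<open>(1,0)\<close>.\<close>

definition Br :: "'v \<Rightarrow> 'v \<Rightarrow> 'v \<Rightarrow> 'v" where
  "Br z x y = (1/2) *\<^sub>R (Tor z (J x) (J y) - Tor z x y)"

text \<open>This is the vanishing of the Nijenhuis tensor of the constant \<open>J\<close>, written
  with the torsion because \<open>J\<close> is parallel. Equivalently, the torsion of two vectors of
  type (1,0) is of type (1,0).\<close>

lemma Tor_J_J:
  assumes z: "z \<in> Om"
  shows "Tor z (J x) (J y) = J (Tor z (J x) y) + J (Tor z x (J y)) + Tor z x y"
  unfolding Tor_def Gam_J[OF z] linear_diff[OF J_linear] J_J
  by simp

lemma Br_bilinear: "z \<in> Om \<Longrightarrow> bilinear (Br z)"
proof -
  assume z: "z \<in> Om"
  note T = bilinear_ladd[OF Tor_bilinear[OF z]] bilinear_radd[OF Tor_bilinear[OF z]]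
    bilinear_lmul[OF Tor_bilinear[OF z]] bilinear_rmul[OF Tor_bilinear[OF z]]
    linear_add[OF J_linear] linear_cmul[OF J_linear]
  show ?thesis
    unfolding bilinear_def Br_def[abs_def]
    by (auto intro!: linearI simp: T algebra_simps)
qed

lemma Br_antisym: "Br z y x = - Br z x y"
  unfolding Br_def Tor_antisym[of z y x] Tor_antisym[of z "J y" "J x"] by (simp add: scaleR_diff_right)

lemma Br_J_left:
  assumes z: "z \<in> Om"
  shows "Br z (J x) y = - (1/2) *\<^sub>R (Tor z x (J y) + Tor z (J x) y)"
  by (simp add: Br_def J_J bilinear_lneg[OF Tor_bilinear[OF z]] algebra_simps)

text \<open>Together with antisymmetry this makes \<open>Br z\<close> complex bilinear for
  \<open>J\<close>. It is \<open>Tor_J_J\<close> in another form.\<close>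

lemma J_Br:
  assumes z: "z \<in> Om"
  shows "J (Br z x y) = Br z (J x) y"
proof -
  have "J (Tor z (J x) (J y) - Tor z x y) = - Tor z (J x) y - Tor z x (J y)"
    unfolding Tor_J_J[OF z, of x y] by (simp add: linear_add[OF J_linear] J_J)
  then have "J (Br z x y) = (1/2) *\<^sub>R (- Tor z (J x) y - Tor z x (J y))"
    by (simp add: Br_def linear_cmul[OF J_linear])
  then show ?thesis unfolding Br_J_left[OF z] by (simp add: scaleR_add_right scaleR_diff_right)
qed

text \<open>The right side is the real part of \<open>T(T(X, Y), W)\<close> for
  \<open>X = x - \<i> J x\<close> and \<open>Y\<close>, \<open>W\<close> formed likewise from
  \<open>y\<close>, \<open>w\<close>, written out so that the Bianchi sums can be recognized in
  it.\<close>

lemma Br_Br: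
  assumes z: "z \<in> Om"
  shows "4 *\<^sub>R Br z (Br z x y) w =
    Tor z (Tor z x y) w - Tor z (Tor z (J x) (J y)) w - Tor z (Tor z x (J y)) (J w) - Tor z (Tor z (J x) y) (J w)"
proof -
  note T = bilinear_ladd[OF Tor_bilinear[OF z]] bilinear_lsub[OF Tor_bilinear[OF z]] bilinear_lmul[OF Tor_bilinear[OF z]]
  have "Br z (Br z x y) w = (1/2) *\<^sub>R (Tor z (Br z (J x) y) (J w) - Tor z (Br z x y) w)"
    by (simp add: Br_def[of z "Br z x y"] J_Br[OF z])
  also have "\<dots> = (1/2) *\<^sub>R ((- (1/2)) *\<^sub>R (Tor z (Tor z x (J y)) (J w) + Tor z (Tor z (J x) y) (J w))
      - (1/2) *\<^sub>R (Tor z (Tor z (J x) (J y)) w - Tor z (Tor z x y) w))"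
    unfolding Br_J_left[OF z] unfolding Br_def by (simp only: T)
  finally show ?thesis by (simp only:) (simp add: algebra_simps)
qed

text \<open>The Jacobi identity is the first Bianchi identity on vectors of type \<open>(1,0)\<close>, where the
  curvature term vanishes by \<open>R(Ju, Jv) = R(u, v)\<close>.\<close>

lemma Br_Jacobi:
  assumes z: "z \<in> Om"
  shows "Br z (Br z x y) w + Br z (Br z y w) x + Br z (Br z w x) y = 0"
proof -
  define b where "b u v w = Tor z (Tor z u v) w + Tor z (Tor z v w) u + Tor z (Tor z w u) v" for u v w
  have b: "b u v w = Cur z u v w + Cur z v w u + Cur z w u v" for u v w
    using first_Bianchi[OF z] by (simp add: b_def)
  \<comment> \<open>The four terms are the real part of the trilinear extension of \<open>b\<close>
    on vectors of type (1,0).\<close>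
  have "4 *\<^sub>R (Br z (Br z x y) w + Br z (Br z y w) x + Br z (Br z w x) y)
      = b x y w - b (J x) (J y) w - b x (J y) (J w) - b (J x) y (J w)"
    unfolding scaleR_add_right Br_Br[OF z] b_def by (simp add: algebra_simps)
  also have "\<dots> = 0"
    unfolding b Cur_J[OF z] Cur_J_J[OF z] unfolding Cur_J_left[OF z] linear_neg[OF J_linear] by simp
  finally show ?thesis by simp
qed

text \<open>With \<open>D = \<nabla> - \<nabla>\<^sup>c\<close>, whose last two slots are skew and \<open>J\<close>-invariant, and \<open>X, Y, Z\<close> of type
  \<open>(1,0)\<close>: evaluating \<open>T - T\<^sup>c\<close> on \<open>(X, Z', Y)\<close>, \<open>Z'\<close> the conjugate of \<open>Z\<close>, gives
  \<open>D(X, Y, Z') = T(X, Y, Z')\<close>, and then evaluating it on \<open>(X, Y, Z')\<close> gives \<open>T\<^sup>c = -T\<close>. The proof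
  below is the real form of this.\<close>

lemma chern_torsion_eq_Br:
  assumes z: "z \<in> Om" and bil: "bilinear \<Gamma>"
    and Jl: "\<And>x y. \<Gamma> (J x) y = J (\<Gamma> x y)" and Jr: "\<And>x y. \<Gamma> x (J y) = J (\<Gamma> x y)"
    and compat: "\<And>u v w. G z (\<Gamma> u v) w + G z v (\<Gamma> u w) = ddir (\<lambda>z. G z v w) u z"
  shows "\<Gamma> x y - \<Gamma> y x = Br z x y"
proof (rule G_nondegenerate[OF z])
  fix w
  note Gs = bilinear_ladd[OF G_bilinear[OF z]] bilinear_lsub[OF G_bilinear[OF z]]
    bilinear_lmul[OF G_bilinear[OF z]] bilinear_lneg[OF G_bilinear[OF z]]
    bilinear_rneg[OF G_bilinear[OF z]]
  define t where "t x y w = G z (Tor z x y) w" for x y w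
  define tc where "tc x y w = G z (\<Gamma> x y - \<Gamma> y x) w" for x y w
  define d where "d x y w = G z (Gam z x y - \<Gamma> x y) w" for x y w
  have td: "t x y w - tc x y w = d x y w - d y x w" for x y w
    by (simp add: t_def tc_def d_def Tor_def Gs)
  have dskew: "d x y w = - d x w y" for x y w
    using compat[of x y w] G_compat[OF z, of y w x] G_sym[OF z, of y] by (simp add: d_def Gs)
  have dJ: "d x (J y) (J w) = d x y w" for x y w
    by (simp add: d_def Gam_J[OF z] Jr linear_diff[OF J_linear, symmetric] G_J[OF z])
  have d0: "d (- x) y w = - d x y w" "d x (- y) w = - d x y w" "d x y (- w) = - d x y w" for x y w
    using bilinear_lneg[OF bil] bilinear_rneg[OF bil] bilinear_lneg[OF Gam_bilinear[OF z]] bilinear_rneg[OF Gam_bilinear[OF z]]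
    by (simp_all add: d_def Gs)
  have tcJ: "tc (J x) (J y) w = - tc x y w" for x y w
    by (simp add: tc_def Jl Jr J_J Gs)
  have tskew: "t x y w = - t x w y" "t x y w = - t y x w" for x y w
    using Tor_skew[OF z, of x y w] Tor_antisym[of z x y] by (simp_all add: t_def Gs)
  have tJ: "t (J x) (J y) w = t x y w - t (J x) y (J w) - t x (J y) (J w)" for x y w
  proof -
    have "G z (J a) w = - G z a (J w)" for a
      using G_J[OF z, of a "J w"] by (simp add: J_J Gs)
    then show ?thesis by (simp add: t_def Tor_J_J[OF z, of x y] Gs)
  qed
  \<comment> \<open>Half the real part of \<open>D(X, Y, Z') = T(X, Y, Z')\<close>; on the right
    \<open>tJ\<close> has been used to remove the terms with \<open>J w\<close>.\<close>
  have p: "d x y w + d (J x) y (J w) = t x y w - t (J x) (J y) w" for x y w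
  proof -
    \<comment> \<open>The real part of \<open>T - T\<^sup>c\<close> on \<open>(X, Z', Y)\<close>.
      Here \<open>T\<^sup>c\<close> vanishes on the mixed pair, and \<open>D(Z', X, Y) = 0\<close>
      because \<open>D\<close> is \<open>J\<close>-invariant in its last two slots. The same
      invariance makes the remaining terms equal in pairs, hence the factor 2.\<close>
    have "t x w y + t (J x) (J w) y - t (J x) w (J y) + t x (J w) (J y) = 2 * (d x w y + d (J x) (J w) y)"
      using td[of x w y] td[of "J x" "J w" y] td[of "J x" w "J y"] td[of x "J w" "J y"]
        tcJ[of x w y] tcJ[of x "J w" "J y"] dJ[of x w y] dJ[of "J x" w y] dJ[of w x y] dJ[of "J w" x y]
        dJ[of "J x" "J w" y] dJ[of "J w" "J x" y] dJ[of x "J w" y] dJ[of w "J x" y]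
      by (simp add: J_J d0 tc_def Jl Jr Gs)
    then show ?thesis
      using tJ[of x y w] tskew(1)[of x w y] tskew(1)[of "J x" "J w" y] tskew(1)[of "J x" w "J y"] tskew(1)[of x "J w" "J y"]
        dskew[of x w y] dskew[of "J x" "J w" y] by argo
  qed
  have "t x y w - t (J x) (J y) w = 2 * tc x y w + (d x y w - d y x w) - (d (J x) (J y) w - d (J y) (J x) w)"
    using td[of x y w] td[of "J x" "J y" w] tcJ[of x y w] by linarith
  moreover have "d (J x) (J y) w = - d (J x) y (J w)" "d (J y) (J x) w = - d (J y) x (J w)"
    using dJ[of "J x" y "J w"] dJ[of "J y" x "J w"] by (simp_all add: J_J d0)
  ultimately have "2 * tc x y w = t (J x) (J y) w - t x y w"
    using p[of x y w] p[of y x w] tskew(2)[of x y w] tskew(2)[of "J x" "J y" w] by linarith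
  then show "G z (\<Gamma> x y - \<Gamma> y x) w = G z (Br z x y) w"
    by (simp add: tc_def t_def Br_def Gs)
qed

section \<open>Sections parallel along rays\<close>

definition rparallel :: "'v \<Rightarrow> real \<Rightarrow> ('v \<Rightarrow> 'v) \<Rightarrow> bool" where
  "rparallel a r X \<longleftrightarrow> smooth_on (ball a r) X \<and> (\<forall>z\<in>ball a r. nab X (z - a) z = 0)"

lemma rparallel_differentiable: "rparallel a r X \<Longrightarrow> z \<in> ball a r \<Longrightarrow> X differentiable (at z)"
  unfolding rparallel_def using smooth_on_differentiable by blast

lemma rparallel_add: "ball a r \<subseteq> Om \<Longrightarrow> rparallel a r X \<Longrightarrow> rparallel a r Y \<Longrightarrow> rparallel a r (\<lambda>z. X z + Y z)"
  using nab_add rparallel_differentiable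
  by (auto simp: rparallel_def smooth_on_add subset_iff smooth_on_differentiable)

lemma rparallel_diff: "ball a r \<subseteq> Om \<Longrightarrow> rparallel a r X \<Longrightarrow> rparallel a r Y \<Longrightarrow> rparallel a r (\<lambda>z. X z - Y z)"
  by (auto simp: rparallel_def smooth_on_diff subset_iff nab_diff smooth_on_differentiable)

lemma rparallel_scale: "ball a r \<subseteq> Om \<Longrightarrow> rparallel a r X \<Longrightarrow> rparallel a r (\<lambda>z. c *\<^sub>R X z)"
  by (auto simp: rparallel_def smooth_on_bounded_linear[OF _ bounded_linear_scaleR_right] subset_iff nab_scale smooth_on_differentiable)

lemma rparallel_J: "ball a r \<subseteq> Om \<Longrightarrow> rparallel a r X \<Longrightarrow> rparallel a r (\<lambda>z. J (X z))"
  using J_linear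
  by (auto simp: rparallel_def smooth_on_bounded_linear linear_conv_bounded_linear subset_iff nab_J
      smooth_on_differentiable linear_0)

text \<open>The point where parallel torsion yields local triviality: \<open>nab_Tor\<close> is a
  Leibniz rule in every direction, and in the radial one both of its terms vanish.\<close>

lemma rparallel_Tor:
  assumes sub: "ball a r \<subseteq> Om" and X: "rparallel a r X" and Y: "rparallel a r Y"
  shows "rparallel a r (\<lambda>z. Tor z (X z) (Y z))"
  unfolding rparallel_def
proof (intro conjI ballI)
  show "smooth_on (ball a r) (\<lambda>z. Tor z (X z) (Y z))"
    using X Y sub by (intro bilinear_family_smooth[where B=Tor, OF open_ball _ smooth_on_subset[OF Tor_smooth sub]])
      (auto simp: rparallel_def intro: Tor_bilinear)
  fix z assume z: "z \<in> ball a r"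
  with sub have "z \<in> Om" by blast
  note T = Tor_bilinear[OF this]
  show "nab (\<lambda>z. Tor z (X z) (Y z)) (z - a) z = 0"
    using nab_Tor[OF \<open>z \<in> Om\<close> rparallel_differentiable[OF X z] rparallel_differentiable[OF Y z], of "z - a"] X Y z
    by (simp add: rparallel_def bilinear_lzero[OF T] bilinear_rzero[OF T])
qed

lemma rparallel_Br:
  assumes "ball a r \<subseteq> Om" and "rparallel a r X" and "rparallel a r Y"
  shows "rparallel a r (\<lambda>z. Br z (X z) (Y z))"
  unfolding Br_def by (intro rparallel_scale rparallel_diff rparallel_Tor rparallel_J assms)

text \<open>\<open>nab\<close> is metric, so the squared length has zero derivative in the radial
  direction; the mean value theorem on the segment from \<open>a\<close> to \<open>z\<close>
  concludes.\<close>

lemma rparallel_isometric: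
  assumes sub: "ball a r \<subseteq> Om" and X: "rparallel a r X" and z: "z \<in> ball a r"
  shows "G z (X z) (X z) = G a (X a) (X a)"
proof -
  define h where "h y = G y (X y) (X y)" for y
  have hs: "smooth_on (ball a r) h"
    unfolding h_def[abs_def]
    using X sub by (intro bilinear_family_smooth[where B=G, OF open_ball _ smooth_on_subset[OF G_smooth sub]])
      (auto simp: rparallel_def intro: G_bilinear)
  have h0: "ddir h (y - a) y = 0" if y: "y \<in> ball a r" for y
  proof -
    from sub y have "y \<in> Om" by blast
    note Gb = G_bilinear[OF this]
    show ?thesis
      unfolding h_def[abs_def]
      using G_nab[OF \<open>y \<in> Om\<close> rparallel_differentiable[OF X y] rparallel_differentiable[OF X y], of "y - a"] X y
      by (simp add: rparallel_def bilinear_lzero[OF Gb] bilinear_rzero[OF Gb])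
  qed
  have inb: "a + t *\<^sub>R (z - a) \<in> ball a r" if "0 \<le> t" "t \<le> 1" for t
    using scaleR_unit_in_ball[of t "z - a" r] that z by (simp add: dist_norm norm_minus_commute)
  have der: "((\<lambda>t. h (a + t *\<^sub>R (z - a))) has_derivative (\<lambda>s. s *\<^sub>R ddir h (z - a) (a + t *\<^sub>R (z - a)))) (at t)"
    if t: "0 \<le> t" "t \<le> 1" for t
  proof -
    have d: "h differentiable (at (a + t *\<^sub>R (z - a)))"
      by (rule smooth_on_differentiable[OF hs inb[OF t]])
    have "((\<lambda>t. a + t *\<^sub>R (z - a)) has_derivative (\<lambda>s. s *\<^sub>R (z - a))) (at t)" by (auto intro!: derivative_eq_intros)
    from has_derivative_compose[OF this has_derivative_ddir[OF d]]
    show ?thesis using linear_cmul[OF linear_ddir[OF d]] by simp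
  qed
  have "\<exists>\<xi>. 0 < \<xi> \<and> \<xi> < 1 \<and> h (a + 1 *\<^sub>R (z - a)) - h (a + 0 *\<^sub>R (z - a)) = (1 - 0) *\<^sub>R ddir h (z - a) (a + \<xi> *\<^sub>R (z - a))"
  proof (rule mvt[of 0 1 "\<lambda>t. h (a + t *\<^sub>R (z - a))" "\<lambda>t s. s *\<^sub>R ddir h (z - a) (a + t *\<^sub>R (z - a))", simplified])
    show "continuous_on {0..1} (\<lambda>t. h (a + t *\<^sub>R (z - a)))"
      using der by (intro continuous_at_imp_continuous_on ballI has_derivative_continuous) auto
  qed (use der in auto)
  then obtain \<xi> where \<xi>: "0 < \<xi>" "\<xi> < 1" "h z - h a = ddir h (z - a) (a + \<xi> *\<^sub>R (z - a))"
    by auto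
  \<comment> \<open>The radial vector at the intermediate point is not \<open>z - a\<close> but its
    multiple by \<open>\<xi>\<close>, which is nonzero and can be divided out.\<close>
  have "\<xi> *\<^sub>R ddir h (z - a) (a + \<xi> *\<^sub>R (z - a)) = ddir h (\<xi> *\<^sub>R (z - a)) (a + \<xi> *\<^sub>R (z - a))"
    using linear_cmul[OF linear_ddir[OF smooth_on_differentiable[OF hs inb]]] \<xi> by simp
  also have "\<dots> = 0" using h0[OF inb, of \<xi>] \<xi> by simp
  finally show ?thesis using \<xi> by (simp add: h_def)
qed

lemma rparallel_unique:
  assumes sub: "ball a r \<subseteq> Om" and X: "rparallel a r X" and Y: "rparallel a r Y"
    and eq: "X a = Y a" and z: "z \<in> ball a r"
  shows "X z = Y z"
proof (rule ccontr)
  assume "X z \<noteq> Y z"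
  have "a \<in> Om" using z sub by (metis ball_eq_empty centre_in_ball empty_iff not_le subsetD)
  have "G z (X z - Y z) (X z - Y z) = G a (X a - Y a) (X a - Y a)"
    by (rule rparallel_isometric[OF sub rparallel_diff[OF sub X Y] z])
  then show False
    using G_pos[of z "X z - Y z"] \<open>X z \<noteq> Y z\<close> sub z eq bilinear_lzero[OF G_bilinear[OF \<open>a \<in> Om\<close>]] by auto
qed

lemma rparallel_exists:
  assumes a: "a \<in> Om"
  obtains r where "r > 0" "ball a r \<subseteq> Om" "\<And>w. \<exists>X. rparallel a r X \<and> X a = w"
proof -
  obtain R where R: "R > 0" "cball a R \<subseteq> Om" using open_Om a open_contains_cball by blast
  \<comment> \<open>The elementary bilinear maps, as constant operators. With them \<open>N\<close>
    becomes a finite sum with smooth scalar coefficients, which gives its smoothness in operator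
    norm.\<close>
  define E where "E b c e = Blinfun (\<lambda>w. (w \<bullet> c) *\<^sub>R Blinfun (\<lambda>u. (u \<bullet> b) *\<^sub>R e))" for b c e :: 'v
  have E: "E b c e w u = (w \<bullet> c) *\<^sub>R (u \<bullet> b) *\<^sub>R e" for b c e w u
  proof -
    have 1: "bounded_linear (\<lambda>u. (u \<bullet> b) *\<^sub>R e)"
      by (intro bounded_linear_scaleR_const bounded_linear_inner_left)
    have 2: "bounded_linear (\<lambda>w. (w \<bullet> c) *\<^sub>R Blinfun (\<lambda>u. (u \<bullet> b) *\<^sub>R e))"
      by (intro bounded_linear_scaleR_const bounded_linear_inner_left)
    show ?thesis by (simp add: E_def bounded_linear_Blinfun_apply[OF 1] bounded_linear_Blinfun_apply[OF 2] scaleR_blinfun.rep_eq)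
  qed
  \<comment> \<open>Minus \<open>Gam\<close>, recentred at \<open>a\<close> and with its arguments
    swapped: \<open>transport_op\<close> supplies the fibre vector first, \<open>Gam\<close> expects
    the direction first.\<close>
  define N where "N y = (\<Sum>b\<in>Basis. \<Sum>c\<in>Basis. \<Sum>e\<in>Basis. (- (Gam (a + y) b c \<bullet> e)) *\<^sub>R E b c e)" for y
  have N: "N y w u = - Gam (a + y) u w" if "a + y \<in> Om" for y w u
  proof -
    note bl = Gam_bilinear[OF that]
    have "Gam (a + y) u w = (\<Sum>b\<in>Basis. (u \<bullet> b) *\<^sub>R Gam (a + y) b w)"
      using bl by (intro linear_Basis_expand) (simp add: bilinear_def)
    also have "\<dots> = (\<Sum>b\<in>Basis. (u \<bullet> b) *\<^sub>R (\<Sum>c\<in>Basis. (w \<bullet> c) *\<^sub>R Gam (a + y) b c))"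
      using bl by (intro sum.cong refl arg_cong[of _ _ "\<lambda>x. _ *\<^sub>R x"] linear_Basis_expand) (simp add: bilinear_def)
    also have "\<dots> = (\<Sum>b\<in>Basis. (u \<bullet> b) *\<^sub>R (\<Sum>c\<in>Basis. (w \<bullet> c) *\<^sub>R (\<Sum>e\<in>Basis. (Gam (a + y) b c \<bullet> e) *\<^sub>R e)))"
      by (simp add: euclidean_representation)
    finally show ?thesis
      by (simp add: N_def blinfun.sum_left scaleR_blinfun.rep_eq E scaleR_sum_right sum_negf mult_ac uminus_blinfun.rep_eq)
  qed
  have sm: "smooth_on (ball 0 R) N"
  proof -
    have "smooth_on (ball 0 R) (\<lambda>y. Gam (a + y) b c)" for b c
    proof (rule smooth_on_compose[OF open_ball _ _ Gam_smooth])
      show "(\<lambda>y. a + y) ` ball 0 R \<subseteq> Om" using R(2) by (force simp: dist_norm)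
      show "smooth_on (ball 0 R) ((+) a)" by (intro smooth_on_add) auto
    qed
    then show ?thesis
      unfolding N_def[abs_def]
      by (intro smooth_on_sum open_ball smooth_on_bilinear[OF open_ball bounded_bilinear_scaleR]
          smooth_on_minus smooth_on_bounded_linear[OF open_ball bounded_linear_inner_left] smooth_on_const)
  qed
  have "continuous_on (cball 0 (R/2)) N"
    using R by (intro continuous_on_subset[OF smooth_on_continuous_on[OF sm]]) auto
  then have "bounded (N ` cball 0 (R/2))" by (intro compact_imp_bounded compact_continuous_image) auto
  then obtain B where B: "B > 0" "\<And>y. norm y \<le> R/2 \<Longrightarrow> norm (N y) \<le> B" unfolding bounded_pos by auto
  \<comment> \<open>The ball of radius \<open>R/2\<close> is compact inside the domain of
    \<open>N\<close>, which gives the bound \<open>B\<close>. The other term makes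
    \<open>r * B \<le> 1/2\<close>, the contraction factor required by \<open>small\<close>.\<close>
  define r where "r = min (R/2) (1 / (2 * B))"
  have r: "r > 0" "r \<le> R/2" "r * B \<le> 1/2"
    using R B by (auto simp: r_def min_def field_simps)
  have sub: "ball a r \<subseteq> Om" using r R by (auto simp: subset_iff)
  have smr: "smooth_on (ball 0 r) N" using r R by (intro smooth_on_subset[OF sm]) auto
  have small: "norm (N y w) * r \<le> norm w / 2" if y: "y \<in> ball 0 r" for y w
  proof -
    have "norm (N y w) * r \<le> (norm (N y) * norm w) * r"
      using r by (intro mult_right_mono norm_blinfun) simp
    also have "\<dots> \<le> (B * norm w) * r" using r y by (intro mult_right_mono B) auto
    also have "\<dots> = (r * B) * norm w" by simp
    also have "\<dots> \<le> (1/2) * norm w" using r by (intro mult_right_mono) auto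
    finally show ?thesis by simp
  qed
  show ?thesis
  proof (rule that[OF r(1) sub])
    fix w
    obtain F where F: "smooth_on (ball 0 r) F" "F 0 = w"
      "\<And>z. z \<in> ball 0 r \<Longrightarrow> ddir F z z = N z (F z) z"
      using radial_transport[OF smr r(1) small, of w] by blast
    have in0: "z - a \<in> ball 0 r" if "z \<in> ball a r" for z using that by (simp add: dist_norm norm_minus_commute)
    have sh: "smooth_on (ball a r) (\<lambda>z. z - a)" by (intro smooth_on_diff) auto
    have "rparallel a r (\<lambda>z. F (z - a))"
      unfolding rparallel_def
    proof (intro conjI ballI)
      show "smooth_on (ball a r) (\<lambda>z. F (z - a))"
        by (rule smooth_on_compose[OF open_ball _ sh F(1)]) (use in0 in blast)
      fix z assume z: "z \<in> ball a r"
      have "ddir (\<lambda>z. F (z - a)) (z - a) z = ddir F (ddir (\<lambda>z. z - a) (z - a) z) (z - a)"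
        by (rule ddir_compose[OF smooth_on_differentiable[OF sh z] smooth_on_differentiable[OF F(1) in0[OF z]]])
      also have "ddir (\<lambda>z. z - a) (z - a) z = z - a"
        by (rule ddir_eqI) (auto intro!: derivative_eq_intros)
      finally show "nab (\<lambda>z. F (z - a)) (z - a) z = 0"
        using F(3)[OF in0[OF z]] N[of "z - a"] z sub by (auto simp: nab_def)
    qed
    then show "\<exists>X. rparallel a r X \<and> X a = w" using F(2) by (intro exI[of _ "\<lambda>z. F (z - a)"]) simp
  qed
qed

text \<open>The frame consists of the radially parallel sections with prescribed value at
  \<open>a\<close>. Each algebraic property compares two such sections that agree at
  \<open>a\<close>, so \<open>rparallel_unique\<close> carries it to \<open>z\<close>. Preservation
  of length gives injectivity, and equality of dimensions gives bijectivity.\<close>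

lemma parallel_frame:
  assumes a: "a \<in> Om"
  obtains r \<Phi> where "r > 0" "ball a r \<subseteq> Om" "\<And>w. smooth_on (ball a r) (\<lambda>z. \<Phi> z w)"
    "\<And>z. z \<in> ball a r \<Longrightarrow> linear (\<Phi> z)" "\<And>z. z \<in> ball a r \<Longrightarrow> bij (\<Phi> z)"
    "\<And>z w. z \<in> ball a r \<Longrightarrow> \<Phi> z (J w) = J (\<Phi> z w)"
    "\<And>z u v. z \<in> ball a r \<Longrightarrow> \<Phi> z (Br a u v) = Br z (\<Phi> z u) (\<Phi> z v)"
proof -
  obtain r where r: "r > 0" and sub: "ball a r \<subseteq> Om" and "\<And>w. \<exists>X. rparallel a r X \<and> X a = w"
    using rparallel_exists[OF a] by blast
  then obtain X where X: "\<And>w. rparallel a r (X w)" "\<And>w. X w a = w" by metis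
  show ?thesis
  proof (rule that[of r "\<lambda>z w. X w z", OF r sub])
    show "smooth_on (ball a r) (X w)" for w using X(1) by (simp add: rparallel_def)
    fix z assume z: "z \<in> ball a r"
    note uniq = rparallel_unique[OF sub _ _ _ z]
    show lin: "linear (\<lambda>w. X w z)"
    proof (rule linearI)
      show "X (u + v) z = X u z + X v z" for u v
        by (rule uniq[OF X(1) rparallel_add[OF sub X(1) X(1)]]) (simp add: X)
      show "X (c *\<^sub>R u) z = c *\<^sub>R X u z" for c u
        by (rule uniq[OF X(1) rparallel_scale[OF sub X(1)]]) (simp add: X)
    qed
    have "X w z \<noteq> 0" if "w \<noteq> 0" for w
    proof
      assume "X w z = 0"
      then have "G z 0 0 = G a w w" using rparallel_isometric[OF sub X(1)[of w] z] X(2) by simp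
      moreover have "G z 0 0 = 0" using z sub by (intro bilinear_lzero[OF G_bilinear]) blast
      ultimately show False using G_pos[OF a that] by simp
    qed
    then have "inj (\<lambda>w. X w z)" using lin by (subst linear_injective_0) auto
    then show "bij (\<lambda>w. X w z)" using linear_injective_imp_surjective[OF lin] by (simp add: bij_def)
    show "X (J w) z = J (X w z)" for w
      by (rule uniq[OF X(1) rparallel_J[OF sub X(1)]]) (simp add: X)
    show "X (Br a u v) z = Br z (X u z) (X v z)" for u v
      by (rule uniq[OF X(1) rparallel_Br[OF sub X(1) X(1)]]) (simp add: X)
  qed
qed

end

section \<open>Tangent vectors and connections in charts\<close>

lemma scaleR_fun_apply [simp]: "(r *\<^sub>R f) x = r *\<^sub>R f x"
  by (simp add: scaleR_fun_def)

lemma sum_fun_apply: "(\<Sum>i\<in>I. f i) x = (\<Sum>i\<in>I. f i x)"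
  by (induction I rule: infinite_finite_induct) auto

lemma Jop_apply [simp]: "Jop v c = \<i> *s v c"
  by (simp add: Jop_def)

lemma linear_scalar_mult: "linear (\<lambda>v :: complex^'n. a *s v)"
  by (rule linearI) (simp_all add: vec_eq_iff algebra_simps)

lemma i_i_scalar_mult: "\<i> *s (\<i> *s v) = - (v :: complex^'n)"
  by (simp add: vec_eq_iff flip: mult.assoc)

lemma Jop_Jop [simp]: "Jop (Jop v) = - v"
  by (rule ext) (simp add: i_i_scalar_mult)

lemma Jop_add: "Jop (x + y) = Jop x + Jop y"
  by (simp add: fun_eq_iff linear_add[OF linear_scalar_mult])

lemma Jop_scaleR: "Jop (r *\<^sub>R x) = r *\<^sub>R Jop x"
  by (simp add: fun_eq_iff linear_cmul[OF linear_scalar_mult])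

lemma Jop_minus: "Jop (- x) = - Jop x"
  using Jop_scaleR[of "-1" x] by simp

abbreviation transition :: "('m, 'n) chart \<Rightarrow> ('m, 'n) chart \<Rightarrow> complex^'n \<Rightarrow> complex^'n" where
  "transition c d \<equiv> snd d \<circ> chart_inv c"

text \<open>The tangent vector at \<open>p\<close> with coordinates \<open>w\<close> in the chart
  \<open>c\<close>. For fixed \<open>w\<close>, \<open>\<lambda>q. tv A c q w\<close> is the field
  on the chart domain that corresponds to a constant field in coordinates.\<close>

definition tv :: "('m, 'n::finite) chart set \<Rightarrow> ('m, 'n) chart \<Rightarrow> 'm \<Rightarrow> complex^'n \<Rightarrow> ('m, 'n) tvec" where
  "tv A c p w = (\<lambda>d. if d \<in> A \<and> p \<in> fst d then ddir (transition c d) w (snd c p) else 0)"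

definition coords :: "('m, 'n) chart \<Rightarrow> ('m \<Rightarrow> ('m, 'n::finite) tvec) \<Rightarrow> complex^'n \<Rightarrow> complex^'n" where
  "coords c X z = X (chart_inv c z) c"

lemma chart_deriv_ddir: "chart_deriv c p w f = ddir (f \<circ> chart_inv c) w (snd c p)"
  by (simp add: chart_deriv_def ddir_def)

section \<open>Charts, coordinate changes and tangent spaces\<close>

locale cx_manifold =
  fixes A :: "('m::topological_space, 'n::finite) chart set"
  assumes atlas: "complex_atlas A"
begin

lemma obtain_chart: obtains c where "c \<in> A" "p \<in> fst c"
  using atlas unfolding complex_atlas_def by blast

lemma chart:
  assumes "c \<in> A"
  shows "open (fst c)" "open (snd c ` fst c)" "homeomorphism (fst c) (snd c ` fst c) (snd c) (chart_inv c)"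
  using atlas assms unfolding complex_atlas_def by blast+

lemma chart_inv_chart [simp]: "c \<in> A \<Longrightarrow> p \<in> fst c \<Longrightarrow> chart_inv c (snd c p) = p"
  using chart(3)[of c] unfolding homeomorphism_def by blast

lemma open_chart_image:
  assumes "c \<in> A" "open U"
  shows "open (snd c ` (U \<inter> fst c))"
proof -
  have "openin (top_of_set (fst c)) (U \<inter> fst c)"
    using assms(2) by (metis inf_commute openin_open_Int)
  from homeomorphism_imp_open_map[OF chart(3)[OF assms(1)] this]
  show ?thesis using chart(2)[OF assms(1)] openin_open_trans by blast
qed

lemma open_chart_preimage:
  assumes "c \<in> A" "open W"
  shows "open {p \<in> fst c. snd c p \<in> W}"
proof -
  have "continuous_on (fst c) (snd c)" using chart(3)[OF assms(1)] unfolding homeomorphism_def by blast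
  from continuous_open_preimage[OF this chart(1)[OF assms(1)] assms(2)]
  show ?thesis by (simp add: vimage_def Int_def)
qed

lemma transition_smooth:
  "c \<in> A \<Longrightarrow> d \<in> A \<Longrightarrow> smooth_on (snd c ` (fst c \<inter> fst d)) (transition c d)"
  using atlas unfolding complex_atlas_def holomorphic_map_on_def by blast

lemma transition_complex_linear:
  "c \<in> A \<Longrightarrow> d \<in> A \<Longrightarrow> p \<in> fst c \<Longrightarrow> p \<in> fst d \<Longrightarrow>
    ddir (transition c d) (a *s v) (snd c p) = a *s ddir (transition c d) v (snd c p)"
  using atlas unfolding complex_atlas_def holomorphic_map_on_def ddir_def by blast

lemma transition_open: "c \<in> A \<Longrightarrow> d \<in> A \<Longrightarrow> open (snd c ` (fst c \<inter> fst d))"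
  using open_chart_image[OF _ chart(1), of c d] by (simp add: inf_commute)

lemma transition_differentiable:
  "c \<in> A \<Longrightarrow> d \<in> A \<Longrightarrow> p \<in> fst c \<Longrightarrow> p \<in> fst d \<Longrightarrow> transition c d differentiable (at (snd c p))"
  by (rule smooth_on_differentiable[OF transition_smooth]) auto

lemma transition_apply: "c \<in> A \<Longrightarrow> p \<in> fst c \<Longrightarrow> transition c d (snd c p) = snd d p"
  by simp

lemma ddir_transition_self:
  assumes "c \<in> A" "p \<in> fst c"
  shows "ddir (transition c c) v (snd c p) = v"
proof -
  have "ddir (transition c c) v (snd c p) = ddir (\<lambda>z. z) v (snd c p)"
    by (rule ddir_cong[OF chart(2)[OF assms(1)]]) (use assms in auto)
  then show ?thesis by simp
qed

lemma ddir_change_chart: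
  fixes f :: "'m \<Rightarrow> 'b::real_normed_vector"
  assumes cd: "c \<in> A" "d \<in> A" and p: "p \<in> fst c" "p \<in> fst d"
    and f: "(f \<circ> chart_inv d) differentiable (at (snd d p))"
  shows "ddir (f \<circ> chart_inv c) v (snd c p) =
    ddir (f \<circ> chart_inv d) (ddir (transition c d) v (snd c p)) (snd d p)"
proof -
  have "ddir (f \<circ> chart_inv c) v (snd c p) = ddir (\<lambda>z. (f \<circ> chart_inv d) (transition c d z)) v (snd c p)"
    by (rule ddir_cong[OF transition_open[OF cd]]) (use cd p in auto)
  also have "\<dots> = ddir (f \<circ> chart_inv d) (ddir (transition c d) v (snd c p)) (transition c d (snd c p))"
    by (rule ddir_compose[OF transition_differentiable[OF cd p]]) (subst transition_apply[OF cd(1) p(1)], rule f)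
  finally show ?thesis using cd p by simp
qed

lemma ddir_transition_trans:
  assumes "c \<in> A" "d \<in> A" "e \<in> A" and p: "p \<in> fst c" "p \<in> fst d" "p \<in> fst e"
  shows "ddir (transition c e) v (snd c p) = ddir (transition d e) (ddir (transition c d) v (snd c p)) (snd d p)"
  by (rule ddir_change_chart[OF assms(1,2) p(1,2) transition_differentiable[OF assms(2,3) p(2,3)]])

lemma tangent_iff:
  "v \<in> tangent_space A p \<longleftrightarrow> (\<forall>c. \<not> (c \<in> A \<and> p \<in> fst c) \<longrightarrow> v c = 0) \<and>
    (\<forall>c\<in>A. \<forall>d\<in>A. p \<in> fst c \<longrightarrow> p \<in> fst d \<longrightarrow> v d = ddir (transition c d) (v c) (snd c p))"
  unfolding tangent_space_def ddir_def by auto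

lemma linear_transition:
  "c \<in> A \<Longrightarrow> d \<in> A \<Longrightarrow> p \<in> fst c \<Longrightarrow> p \<in> fst d \<Longrightarrow> linear (\<lambda>v. ddir (transition c d) v (snd c p))"
  by (intro linear_ddir transition_differentiable)

lemma tv_self [simp]: "c \<in> A \<Longrightarrow> p \<in> fst c \<Longrightarrow> tv A c p w c = w"
  by (simp add: tv_def ddir_transition_self)

lemma tv_tangent:
  assumes "c \<in> A" "p \<in> fst c"
  shows "tv A c p w \<in> tangent_space A p"
  unfolding tangent_iff
proof (intro conjI allI impI ballI)
  show "tv A c p w d = 0" if "\<not> (d \<in> A \<and> p \<in> fst d)" for d
    unfolding tv_def using that by (rule if_not_P)
  show "tv A c p w e = ddir (transition d e) (tv A c p w d) (snd d p)"
    if "d \<in> A" "e \<in> A" "p \<in> fst d" "p \<in> fst e" for d e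
    using ddir_transition_trans[OF assms(1) that(1,2) assms(2) that(3,4), of w] that unfolding tv_def by simp
qed

lemma tv_component:
  assumes "c \<in> A" "p \<in> fst c" "v \<in> tangent_space A p"
  shows "tv A c p (v c) = v"
proof (rule ext)
  fix d
  show "tv A c p (v c) d = v d"
  proof (cases "d \<in> A \<and> p \<in> fst d")
    case True
    then have "v d = ddir (transition c d) (v c) (snd c p)"
      using assms unfolding tangent_iff by blast
    with True show ?thesis by (simp add: tv_def)
  next
    case False
    then have "v d = 0" using assms(3) unfolding tangent_iff by blast
    with False show ?thesis by (simp only: tv_def if_False)
  qed
qed

text \<open>Reduces identities between tangent vectors, in particular between values of the torsion,
  to components in a single chart.\<close>

lemma tangent_eqI:
  assumes "c \<in> A" "p \<in> fst c" "v \<in> tangent_space A p" "w \<in> tangent_space A p" "v c = w c"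
  shows "v = w"
  using tv_component[OF assms(1-3)] tv_component[OF assms(1,2,4)] unfolding assms(5) by (rule trans[OF sym])

lemma tv_eqI:
  assumes "\<And>d. d \<in> A \<Longrightarrow> p \<in> fst d \<Longrightarrow> ddir (transition c d) w (snd c p) = v d"
    and "\<And>d. \<not> (d \<in> A \<and> p \<in> fst d) \<Longrightarrow> v d = 0"
  shows "tv A c p w = v"
  unfolding tv_def using assms by (intro ext) metis

lemma tv_outside: "\<not> (d \<in> A \<and> p \<in> fst d) \<Longrightarrow> tv A c p w d = 0"
  unfolding tv_def by (rule if_not_P)

text \<open>The third claim rests on the holomorphy of the atlas: the differentials of coordinate
  changes are complex linear, so multiplication by \<open>\<i>\<close> means the same in every
  chart.\<close>

lemma
  assumes "c \<in> A" "p \<in> fst c"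
  shows tv_add: "tv A c p (u + v) = tv A c p u + tv A c p v"
    and tv_scaleR: "tv A c p (r *\<^sub>R v) = r *\<^sub>R tv A c p v"
    and tv_Jop: "tv A c p (\<i> *s v) = Jop (tv A c p v)"
proof -
  note lin = linear_transition[OF assms(1) _ assms(2)]
  show "tv A c p (u + v) = tv A c p u + tv A c p v"
    by (rule tv_eqI) (simp add: tv_def linear_add[OF lin], simp add: tv_outside)
  show "tv A c p (r *\<^sub>R v) = r *\<^sub>R tv A c p v"
    by (rule tv_eqI) (simp add: tv_def linear_cmul[OF lin], simp add: tv_outside)
  show "tv A c p (\<i> *s v) = Jop (tv A c p v)"
    by (rule tv_eqI) (simp add: tv_def transition_complex_linear assms, simp add: tv_outside)
qed

lemma linear_tv: "c \<in> A \<Longrightarrow> p \<in> fst c \<Longrightarrow> linear (tv A c p)"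
  by (rule linearI) (simp_all add: tv_add tv_scaleR)

lemma tangent_add: "v \<in> tangent_space A p \<Longrightarrow> w \<in> tangent_space A p \<Longrightarrow> v + w \<in> tangent_space A p"
proof -
  assume v: "v \<in> tangent_space A p" and w: "w \<in> tangent_space A p"
  obtain c where c: "c \<in> A" "p \<in> fst c" by (rule obtain_chart)
  show ?thesis using tv_tangent[OF c, of "v c + w c"] by (simp add: tv_add[OF c] tv_component[OF c] v w)
qed

lemma tangent_scaleR: "v \<in> tangent_space A p \<Longrightarrow> r *\<^sub>R v \<in> tangent_space A p"
proof -
  assume v: "v \<in> tangent_space A p"
  obtain c where c: "c \<in> A" "p \<in> fst c" by (rule obtain_chart)
  show ?thesis using tv_tangent[OF c, of "r *\<^sub>R v c"] by (simp add: tv_scaleR[OF c] tv_component[OF c] v)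
qed

lemma tangent_Jop: "v \<in> tangent_space A p \<Longrightarrow> Jop v \<in> tangent_space A p"
proof -
  assume v: "v \<in> tangent_space A p"
  obtain c where c: "c \<in> A" "p \<in> fst c" by (rule obtain_chart)
  show ?thesis using tv_tangent[OF c, of "\<i> *s v c"] by (simp add: tv_Jop[OF c] tv_component[OF c] v)
qed

lemma tangent_minus: "v \<in> tangent_space A p \<Longrightarrow> - v \<in> tangent_space A p"
  using tangent_scaleR[of v p "-1"] by simp

lemma tangent_diff: "v \<in> tangent_space A p \<Longrightarrow> w \<in> tangent_space A p \<Longrightarrow> v - w \<in> tangent_space A p"
  using tangent_add[of v p "- w"] tangent_minus[of w p] by simp

lemma tangent_zero: "0 \<in> tangent_space A p"
  by (simp add: tangent_iff linear_0[OF linear_transition])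

section \<open>Smooth vector fields\<close>

lemma smooth_vfI:
  assumes "\<And>p. p \<in> U \<Longrightarrow> X p \<in> tangent_space A p"
    and "\<And>c. c \<in> A \<Longrightarrow> smooth_on (snd c ` (U \<inter> fst c)) (coords c X)"
  shows "smooth_vf A U X"
  using assms unfolding smooth_vf_def coords_def[abs_def] by blast

lemma smooth_vf_coords: "smooth_vf A U X \<Longrightarrow> c \<in> A \<Longrightarrow> smooth_on (snd c ` (U \<inter> fst c)) (coords c X)"
  unfolding smooth_vf_def coords_def[abs_def] by blast

lemma smooth_vf_tangent: "smooth_vf A U X \<Longrightarrow> p \<in> U \<Longrightarrow> X p \<in> tangent_space A p"
  unfolding smooth_vf_def by blast

lemma smooth_vf_coords_differentiable:
  "smooth_vf A U X \<Longrightarrow> c \<in> A \<Longrightarrow> p \<in> U \<Longrightarrow> p \<in> fst c \<Longrightarrow> coords c X differentiable (at (snd c p))"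
  by (rule smooth_on_differentiable[OF smooth_vf_coords]) auto

lemma smooth_vf_subset: "smooth_vf A U X \<Longrightarrow> V \<subseteq> U \<Longrightarrow> smooth_vf A V X"
  by (rule smooth_vfI) (auto intro: smooth_vf_tangent smooth_on_subset[OF smooth_vf_coords])

lemma smooth_vf_cong:
  assumes "open U" "\<And>q. q \<in> U \<Longrightarrow> X q = Y q" "smooth_vf A U X"
  shows "smooth_vf A U Y"
proof (rule smooth_vfI)
  show "Y p \<in> tangent_space A p" if "p \<in> U" for p
    using smooth_vf_tangent[OF assms(3) that] assms(2)[OF that] by simp
  show "smooth_on (snd c ` (U \<inter> fst c)) (coords c Y)" if "c \<in> A" for c
    by (rule smooth_on_cong[OF open_chart_image[OF that assms(1)] _ smooth_vf_coords[OF assms(3) that]])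
      (use assms(2) that in \<open>auto simp: coords_def\<close>)
qed

lemma transition_compose_smooth:
  assumes "c \<in> A" "d \<in> A" "open U" "U \<subseteq> fst c" "smooth_on (snd c ` U) F"
  shows "smooth_on (snd d ` (U \<inter> fst d)) (\<lambda>z. F (transition d c z))"
proof (rule smooth_on_compose[OF open_chart_image[OF assms(2,3)] _ _ assms(5)])
  show "transition d c ` snd d ` (U \<inter> fst d) \<subseteq> snd c ` U" using assms by auto
  show "smooth_on (snd d ` (U \<inter> fst d)) (transition d c)"
    by (rule smooth_on_subset[OF transition_smooth[OF assms(2,1)]]) (use assms(4) in auto)
qed

lemma smooth_fun_chart:
  fixes F :: "complex^'n \<Rightarrow> 'b::real_normed_vector"
  assumes "c \<in> A" "open U" "U \<subseteq> fst c" "smooth_on (snd c ` U) F"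
  shows "smooth_fun A U (\<lambda>q. F (snd c q))"
  unfolding smooth_fun_def
  using transition_compose_smooth[OF assms(1) _ assms(2-4)] by (simp add: o_def)

text \<open>In another chart \<open>d\<close> the coordinates are the derivative of the coordinate
  change along \<open>F\<close>, read through the inverse change. Both the derivative along a smooth
  field and the composition are smooth.\<close>

lemma smooth_vf_tv:
  assumes c: "c \<in> A" and U: "open U" "U \<subseteq> fst c" and F: "smooth_on (snd c ` U) F"
  shows "smooth_vf A U (\<lambda>q. tv A c q (F (snd c q)))"
proof (rule smooth_vfI)
  show "tv A c p (F (snd c p)) \<in> tangent_space A p" if "p \<in> U" for p
    using that U(2) by (intro tv_tangent[OF c]) auto
  fix d assume d: "d \<in> A"
  define V where "V = U \<inter> fst d"
  have V: "open V" "V \<subseteq> fst c" using U chart(1)[OF d] by (auto simp: V_def)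
  have oV: "open (snd c ` V)" using open_chart_image[OF c V(1)] V(2) by (simp add: Int_absorb2)
  have "smooth_on (snd c ` V) (\<lambda>z. ddir (transition c d) (F z) z)"
  proof (rule smooth_on_ddir_along[OF oV])
    show "smooth_on (snd c ` V) (transition c d)"
      by (rule smooth_on_subset[OF transition_smooth[OF c d]]) (use U(2) in \<open>auto simp: V_def\<close>)
    show "smooth_on (snd c ` V) F" by (rule smooth_on_subset[OF F]) (auto simp: V_def)
  qed
  from transition_compose_smooth[OF c d V this]
  have "smooth_on (snd d ` (U \<inter> fst d)) (\<lambda>z. ddir (transition c d) (F (transition d c z)) (transition d c z))"
    by (simp add: V_def Int_absorb)
  then show "smooth_on (snd d ` (U \<inter> fst d)) (coords d (\<lambda>q. tv A c q (F (snd c q))))"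
    by (rule smooth_on_cong[OF open_chart_image[OF d U(1)], rotated]) (use d in \<open>auto simp: coords_def tv_def\<close>)
qed

lemma smooth_vf_tv_const: "c \<in> A \<Longrightarrow> smooth_vf A (fst c) (\<lambda>q. tv A c q w)"
  using smooth_vf_tv[of c "fst c" "\<lambda>z. w"] chart(1) by simp

lemma smooth_vf_eq_tv:
  assumes "smooth_vf A U X" "c \<in> A" "q \<in> U" "q \<in> fst c"
  shows "X q = tv A c q (coords c X (snd c q))"
  using tv_component[OF assms(2,4) smooth_vf_tangent[OF assms(1,3)]] assms by (simp add: coords_def)

lemma smooth_vf_add:
  assumes "open U" "smooth_vf A U X" "smooth_vf A U Y"
  shows "smooth_vf A U (\<lambda>q. X q + Y q)"
proof (rule smooth_vfI)
  show "X p + Y p \<in> tangent_space A p" if "p \<in> U" for p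
    using that assms by (intro tangent_add smooth_vf_tangent)
  fix c assume c: "c \<in> A"
  have "coords c (\<lambda>q. X q + Y q) = (\<lambda>z. coords c X z + coords c Y z)" by (simp add: coords_def fun_eq_iff)
  then show "smooth_on (snd c ` (U \<inter> fst c)) (coords c (\<lambda>q. X q + Y q))"
    using smooth_on_add[OF open_chart_image[OF c assms(1)] smooth_vf_coords[OF assms(2) c] smooth_vf_coords[OF assms(3) c]]
    by simp
qed

lemma smooth_vf_scaleR:
  assumes "open U" "smooth_vf A U X" "smooth_fun A U f"
  shows "smooth_vf A U (\<lambda>q. f q *\<^sub>R X q)"
proof (rule smooth_vfI)
  show "f p *\<^sub>R X p \<in> tangent_space A p" if "p \<in> U" for p
    using that assms by (intro tangent_scaleR smooth_vf_tangent)
  fix c assume c: "c \<in> A"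
  have "coords c (\<lambda>q. f q *\<^sub>R X q) = (\<lambda>z. (f \<circ> chart_inv c) z *\<^sub>R coords c X z)" by (simp add: coords_def fun_eq_iff)
  moreover have "smooth_on (snd c ` (U \<inter> fst c)) (f \<circ> chart_inv c)" using assms(3) c by (simp add: smooth_fun_def)
  ultimately show "smooth_on (snd c ` (U \<inter> fst c)) (coords c (\<lambda>q. f q *\<^sub>R X q))"
    using smooth_on_bilinear[OF open_chart_image[OF c assms(1)] bounded_bilinear_scaleR, of "f \<circ> chart_inv c", OF _ smooth_vf_coords[OF assms(2) c]]
    by simp
qed

lemma smooth_vf_Jop:
  assumes "open U" "smooth_vf A U X"
  shows "smooth_vf A U (\<lambda>q. Jop (X q))"
proof (rule smooth_vfI)
  show "Jop (X p) \<in> tangent_space A p" if "p \<in> U" for p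
    using that assms by (intro tangent_Jop smooth_vf_tangent)
  fix c assume c: "c \<in> A"
  have "coords c (\<lambda>q. Jop (X q)) = (\<lambda>z. \<i> *s coords c X z)" by (simp add: coords_def fun_eq_iff)
  then show "smooth_on (snd c ` (U \<inter> fst c)) (coords c (\<lambda>q. Jop (X q)))"
    using smooth_on_bounded_linear[OF open_chart_image[OF c assms(1)] linear_conv_bounded_linear[THEN iffD1, OF linear_scalar_mult] smooth_vf_coords[OF assms(2) c]]
    by simp
qed

lemma smooth_fun_const: "smooth_fun A U (\<lambda>q. r)"
  by (simp add: smooth_fun_def o_def)

section \<open>Directional derivatives and the Lie bracket\<close>

lemma dir_deriv_eq:
  fixes f :: "'m \<Rightarrow> 'b::real_normed_vector"
  assumes f: "smooth_fun A U f" and p: "p \<in> U" and c: "c \<in> A" "p \<in> fst c" and v: "v \<in> tangent_space A p"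
  shows "dir_deriv A p v f = ddir (f \<circ> chart_inv c) (v c) (snd c p)"
proof -
  define d where "d = (SOME c. c \<in> A \<and> p \<in> fst c)"
  have d: "d \<in> A" "p \<in> fst d" using someI[of "\<lambda>c. c \<in> A \<and> p \<in> fst c", OF conjI[OF c]] unfolding d_def by blast+
  have "(f \<circ> chart_inv c) differentiable (at (snd c p))"
    using f c p by (intro smooth_on_differentiable[of "snd c ` (U \<inter> fst c)"]) (auto simp: smooth_fun_def)
  from ddir_change_chart[OF d(1) c(1) d(2) c(2) this, of "v d"]
  have "dir_deriv A p v f = ddir (f \<circ> chart_inv c) (ddir (transition d c) (v d) (snd d p)) (snd c p)"
    by (simp add: dir_deriv_def chart_deriv_ddir flip: d_def)
  moreover have "ddir (transition d c) (v d) (snd d p) = v c"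
    using v c d unfolding tangent_iff by metis
  ultimately show ?thesis by simp
qed

lemma lie_bracket_component:
  "c \<in> A \<Longrightarrow> p \<in> fst c \<Longrightarrow> lie_bracket A X Y p c =
    ddir (coords c Y) (X p c) (snd c p) - ddir (coords c X) (Y p c) (snd c p)"
  by (simp add: lie_bracket_def chart_deriv_ddir coords_def[abs_def] o_def)

text \<open>Under a coordinate change \<open>\<phi>\<close> each half of the bracket acquires a
  second derivative of \<open>\<phi>\<close>. It is symmetric in the two fields and cancels in the
  difference.\<close>

lemma lie_bracket_tangent:
  assumes U: "open U" "p \<in> U" and X: "smooth_vf A U X" and Y: "smooth_vf A U Y"
  shows "lie_bracket A X Y p \<in> tangent_space A p"
  unfolding tangent_iff
proof (intro conjI allI impI ballI)
  show "lie_bracket A X Y p c = 0" if "\<not> (c \<in> A \<and> p \<in> fst c)" for c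
    unfolding lie_bracket_def using that by (rule if_not_P)
  fix c d assume cd: "c \<in> A" "d \<in> A" and p: "p \<in> fst c" "p \<in> fst d"
  define W where "W = snd c ` (U \<inter> fst d \<inter> fst c)"
  define \<phi> where "\<phi> = transition c d"
  define a where "a = snd c p"
  have W: "open W" "a \<in> W"
    using open_chart_image[OF cd(1), of "U \<inter> fst d"] U p chart(1)[OF cd(2)] by (auto simp: W_def a_def)
  have \<phi>: "smooth_on W \<phi>"
    unfolding \<phi>_def by (rule smooth_on_subset[OF transition_smooth[OF cd]]) (auto simp: W_def)
  have \<phi>a: "\<phi> a = snd d p" using cd p by (simp add: \<phi>_def a_def)
  have half: "ddir (coords d Y) (X p d) (snd d p) =
      ddir (ddir \<phi> (Y p c)) (X p c) a + ddir \<phi> (ddir (coords c Y) (X p c) a) a"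
    if X: "smooth_vf A U X" and Y: "smooth_vf A U Y" for X Y
  proof -
    have comp: "Z q d = ddir \<phi> (Z q c) (snd c q)" if "smooth_vf A U Z" "q \<in> U" "q \<in> fst c" "q \<in> fst d" for Z q
      using smooth_vf_tangent[OF that(1,2)] that cd unfolding tangent_iff \<phi>_def by blast
    have dY: "coords d Y differentiable (at (snd d p))"
      by (rule smooth_vf_coords_differentiable[OF Y cd(2) U(2) p(2)])
    have dYc: "coords c Y differentiable (at a)"
      unfolding a_def by (rule smooth_vf_coords_differentiable[OF Y cd(1) U(2) p(1)])
    have "ddir (coords d Y) (X p d) (snd d p) = ddir (coords d Y) (ddir \<phi> (X p c) a) (\<phi> a)"
      using comp[OF X U(2) p] unfolding \<phi>a a_def[symmetric] by simp
    also have "\<dots> = ddir (\<lambda>z. coords d Y (\<phi> z)) (X p c) a"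
      by (rule ddir_compose[symmetric]) (use smooth_on_differentiable[OF \<phi> W(2)] dY in \<open>auto simp: \<phi>a\<close>)
    also have "\<dots> = ddir (\<lambda>z. ddir \<phi> (coords c Y z) z) (X p c) a"
    proof (rule ddir_cong[OF W(1) _ W(2)])
      fix z assume "z \<in> W"
      then obtain q where q: "z = snd c q" "q \<in> U" "q \<in> fst c" "q \<in> fst d" by (auto simp: W_def)
      then show "coords d Y (\<phi> z) = ddir \<phi> (coords c Y z) z"
        using comp[OF Y q(2-4)] cd by (simp add: coords_def \<phi>_def)
    qed
    also have "\<dots> = ddir (\<lambda>z. ddir \<phi> (coords c Y a) z) (X p c) a + ddir \<phi> (ddir (coords c Y) (X p c) a) a"
      by (rule linear_family_differentiable(2)[where L="\<lambda>z v. ddir \<phi> v z", OF W])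
        (auto intro: linear_ddir smooth_on_differentiable[OF \<phi>] smooth_on_differentiable[OF smooth_on_ddir[OF \<phi>] W(2)] dYc)
    finally show ?thesis using cd p by (simp add: coords_def a_def)
  qed
  have "lie_bracket A X Y p d = ddir (ddir \<phi> (Y p c)) (X p c) a + ddir \<phi> (ddir (coords c Y) (X p c) a) a
      - (ddir (ddir \<phi> (X p c)) (Y p c) a + ddir \<phi> (ddir (coords c X) (Y p c) a) a)"
    unfolding lie_bracket_component[OF cd(2) p(2)] half[OF X Y] half[OF Y X] ..
  also have "\<dots> = ddir \<phi> (ddir (coords c Y) (X p c) a) a - ddir \<phi> (ddir (coords c X) (Y p c) a) a"
    using ddir_commute[OF W(1) \<phi> W(2), of "Y p c" "X p c"] by simp
  also have "\<dots> = ddir \<phi> (lie_bracket A X Y p c) a"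
    unfolding lie_bracket_component[OF cd(1) p(1)] a_def[symmetric]
    using linear_diff[OF linear_ddir[OF smooth_on_differentiable[OF \<phi> W(2)]]] by simp
  finally show "lie_bracket A X Y p d = ddir (transition c d) (lie_bracket A X Y p c) (snd c p)"
    by (simp add: \<phi>_def a_def)
qed

lemma local_extension:
  assumes "x \<in> tangent_space A p"
  obtains U where "open U" "p \<in> U" "smooth_vf A U (local_extension A p x)" "local_extension A p x p = x"
proof -
  obtain c where c: "c \<in> A" "p \<in> fst c" by (rule obtain_chart)
  have "\<exists>X. X p = x \<and> (\<exists>U. open U \<and> p \<in> U \<and> smooth_vf A U X)"
    using smooth_vf_tv_const[OF c(1)] chart(1)[OF c(1)] c tv_component[OF c assms]
    by (intro exI[of _ "\<lambda>q. tv A c q (x c)"]) auto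
  from someI_ex[OF this] show ?thesis using that unfolding local_extension_def by blast
qed

end

text \<open>The Christoffel symbol of \<open>nabla\<close> in the chart \<open>c\<close>, contracted
  with \<open>u\<close> and \<open>v\<close>, as a function on the chart image.\<close>

definition Gm :: "('m::topological_space, 'n::finite) chart set \<Rightarrow> ('m, 'n) conn \<Rightarrow> ('m, 'n) chart \<Rightarrow>
    complex^'n \<Rightarrow> complex^'n \<Rightarrow> complex^'n \<Rightarrow> complex^'n" where
  "Gm A nabla c z u v = nabla (chart_inv c z) (tv A c (chart_inv c z) u) (\<lambda>q. tv A c q v) c"

section \<open>Connections in coordinates\<close>

locale cx_connection = cx_manifold A for A :: "('m::topological_space, 'n::finite) chart set" +
  fixes nabla :: "('m, 'n) conn"
  assumes conn: "connection A nabla"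
begin

lemma
  assumes "open U" "smooth_vf A U Y" "p \<in> U" "v \<in> tangent_space A p"
  shows nabla_tangent: "nabla p v Y \<in> tangent_space A p"
    and nabla_add_left: "\<And>w. w \<in> tangent_space A p \<Longrightarrow> nabla p (v + w) Y = nabla p v Y + nabla p w Y"
    and nabla_scaleR_left: "\<And>r. nabla p (r *\<^sub>R v) Y = r *\<^sub>R nabla p v Y"
    and nabla_add: "\<And>Z. smooth_vf A U Z \<Longrightarrow> nabla p v (\<lambda>q. Y q + Z q) = nabla p v Y + nabla p v Z"
    and nabla_Leibniz: "\<And>f :: 'm \<Rightarrow> real. smooth_fun A U f \<Longrightarrow>
      nabla p v (\<lambda>q. f q *\<^sub>R Y q) = dir_deriv A p v f *\<^sub>R Y p + f p *\<^sub>R nabla p v Y"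
    and nabla_cong: "\<And>Z. (\<And>q. q \<in> U \<Longrightarrow> Z q = Y q) \<Longrightarrow> nabla p v Z = nabla p v Y"
proof -
  note * = conn[unfolded connection_def, THEN spec, of U, THEN spec, of Y, THEN mp, OF conjI[OF assms(1,2)],
      THEN conjunct1, THEN bspec, OF assms(3), THEN bspec, OF assms(4)]
  show "nabla p v Y \<in> tangent_space A p" using * by (elim conjE)
  show "nabla p (v + w) Y = nabla p v Y + nabla p w Y" if "w \<in> tangent_space A p" for w
    using *[THEN conjunct2, THEN conjunct1, THEN bspec, OF that] .
  show "nabla p (r *\<^sub>R v) Y = r *\<^sub>R nabla p v Y" for r
    using *[THEN conjunct2, THEN conjunct2, THEN conjunct1, THEN spec] .
  show "nabla p v (\<lambda>q. Y q + Z q) = nabla p v Y + nabla p v Z" if "smooth_vf A U Z" for Z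
    using *[THEN conjunct2, THEN conjunct2, THEN conjunct2, THEN conjunct1, THEN spec, THEN mp, OF that] .
  show "nabla p v (\<lambda>q. f q *\<^sub>R Y q) = dir_deriv A p v f *\<^sub>R Y p + f p *\<^sub>R nabla p v Y"
    if "smooth_fun A U f" for f :: "'m \<Rightarrow> real"
    using *[THEN conjunct2, THEN conjunct2, THEN conjunct2, THEN conjunct2, THEN conjunct1, THEN spec, THEN mp, OF that] .
  show "nabla p v Z = nabla p v Y" if "\<And>q. q \<in> U \<Longrightarrow> Z q = Y q" for Z
    using *[THEN conjunct2, THEN conjunct2, THEN conjunct2, THEN conjunct2, THEN conjunct2, THEN spec, THEN mp] that by blast
qed

lemma nabla_smooth:
  assumes "open U" "smooth_vf A U X" "smooth_vf A U Y"
  shows "smooth_vf A U (\<lambda>p. nabla p (X p) Y)"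
  by (rule conn[unfolded connection_def, THEN spec, of U, THEN spec, of Y, THEN mp, OF conjI[OF assms(1,3)],
      THEN conjunct2, THEN spec, THEN mp, OF assms(2)])

lemma dir_deriv_const: "p \<in> U \<Longrightarrow> v \<in> tangent_space A p \<Longrightarrow> dir_deriv A p v (\<lambda>q. r :: real) = 0"
proof -
  assume "p \<in> U" "v \<in> tangent_space A p"
  obtain c where c: "c \<in> A" "p \<in> fst c" by (rule obtain_chart)
  show ?thesis using dir_deriv_eq[OF smooth_fun_const \<open>p \<in> U\<close> c \<open>v \<in> _\<close>, of r] by (simp add: o_def)
qed

lemma nabla_scaleR:
  assumes "open U" "smooth_vf A U Y" "p \<in> U" "v \<in> tangent_space A p"
  shows "nabla p v (\<lambda>q. r *\<^sub>R Y q) = r *\<^sub>R nabla p v Y"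
  using nabla_Leibniz[OF assms smooth_fun_const, of r] dir_deriv_const[OF assms(3,4)] by simp

text \<open>Smoothness of the sum is proved alongside, since \<open>nabla_add\<close> asks for it in
  every step. The induction starts from one summand, so the zero field does not occur.\<close>

lemma nabla_sum:
  fixes f :: "'i \<Rightarrow> 'm \<Rightarrow> real"
  assumes U: "open U" "p \<in> U" "v \<in> tangent_space A p" "finite I" and "I \<noteq> {}"
    and f: "\<And>i. i \<in> I \<Longrightarrow> smooth_fun A U (f i)" and E: "\<And>i. i \<in> I \<Longrightarrow> smooth_vf A U (E i)"
  shows "smooth_vf A U (\<lambda>q. \<Sum>i\<in>I. f i q *\<^sub>R E i q) \<and>
    nabla p v (\<lambda>q. \<Sum>i\<in>I. f i q *\<^sub>R E i q) = (\<Sum>i\<in>I. dir_deriv A p v (f i) *\<^sub>R E i p + f i p *\<^sub>R nabla p v (E i))"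
  using U(4) \<open>I \<noteq> {}\<close> f E
proof (induction I rule: finite_ne_induct)
  case (singleton i)
  then have f: "smooth_fun A U (f i)" and E: "smooth_vf A U (E i)" by auto
  show ?case
    using nabla_Leibniz[OF U(1) E U(2,3) f] smooth_vf_scaleR[OF U(1) E f]
    by (simp only: sum.insert finite.emptyI empty_iff not_False_eq_True sum.empty add_0_right simp_thms)
next
  case (insert i I)
  have 1: "smooth_vf A U (\<lambda>q. f i q *\<^sub>R E i q)" using insert.prems by (simp add: smooth_vf_scaleR U)
  have 2: "smooth_vf A U (\<lambda>q. \<Sum>i\<in>I. f i q *\<^sub>R E i q)"
    and 3: "nabla p v (\<lambda>q. \<Sum>i\<in>I. f i q *\<^sub>R E i q) = (\<Sum>i\<in>I. dir_deriv A p v (f i) *\<^sub>R E i p + f i p *\<^sub>R nabla p v (E i))"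
    using insert.IH[OF insert.prems] by (blast intro: insertI2)+
  have 4: "nabla p v (\<lambda>q. f i q *\<^sub>R E i q) = dir_deriv A p v (f i) *\<^sub>R E i p + f i p *\<^sub>R nabla p v (E i)"
    using insert.prems by (intro nabla_Leibniz[OF U(1) _ U(2,3)]) auto
  show ?case
    unfolding sum.insert[OF insert.hyps(1,3)] 4[symmetric] 3[symmetric]
    using smooth_vf_add[OF U(1) 1 2] nabla_add[OF U(1) 1 U(2,3) 2] by (rule conjI)
qed

lemma Gm_at: "c \<in> A \<Longrightarrow> p \<in> fst c \<Longrightarrow> Gm A nabla c (snd c p) u v = nabla p (tv A c p u) (\<lambda>q. tv A c q v) c"
  by (simp add: Gm_def)

lemma Gm_bilinear:
  assumes c: "c \<in> A" and z: "z \<in> snd c ` fst c"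
  shows "bilinear (Gm A nabla c z)"
proof -
  obtain p where p: "p \<in> fst c" "z = snd c p" using z by blast
  note t = tv_tangent[OF c p(1)]
  note s = smooth_vf_tv_const[OF c] and o = chart(1)[OF c]
  show ?thesis
    unfolding bilinear_def
  proof (intro conjI allI linearI)
    fix u v w r
    show "Gm A nabla c z u (v + w) = Gm A nabla c z u v + Gm A nabla c z u w"
    proof -
      have "nabla p (tv A c p u) (\<lambda>q. tv A c q (v + w)) = nabla p (tv A c p u) (\<lambda>q. tv A c q v + tv A c q w)"
        by (rule nabla_cong[OF o smooth_vf_add[OF o s s] p(1) t]) (simp add: tv_add[OF c])
      then show ?thesis unfolding p(2) Gm_at[OF c p(1)] nabla_add[OF o s p(1) t s] by simp
    qed
    show "Gm A nabla c z u (r *\<^sub>R v) = r *\<^sub>R Gm A nabla c z u v"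
    proof -
      have "nabla p (tv A c p u) (\<lambda>q. tv A c q (r *\<^sub>R v)) = nabla p (tv A c p u) (\<lambda>q. r *\<^sub>R tv A c q v)"
        by (rule nabla_cong[OF o smooth_vf_scaleR[OF o s smooth_fun_const] p(1) t]) (simp add: tv_scaleR[OF c])
      then show ?thesis unfolding p(2) Gm_at[OF c p(1)] nabla_scaleR[OF o s p(1) t] by simp
    qed
    show "Gm A nabla c z (v + w) u = Gm A nabla c z v u + Gm A nabla c z w u"
      unfolding p(2) Gm_at[OF c p(1)] tv_add[OF c p(1)] nabla_add_left[OF o s p(1) t t] by simp
    show "Gm A nabla c z (r *\<^sub>R v) u = r *\<^sub>R Gm A nabla c z v u"
      unfolding p(2) Gm_at[OF c p(1)] tv_scaleR[OF c p(1)] nabla_scaleR_left[OF o s p(1) t] by simp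
  qed
qed

lemma Gm_smooth:
  assumes c: "c \<in> A"
  shows "smooth_on (snd c ` fst c) (\<lambda>z. Gm A nabla c z u v)"
  using smooth_vf_coords[OF nabla_smooth[OF chart(1)[OF c] smooth_vf_tv_const[OF c] smooth_vf_tv_const[OF c]] c, of u v]
  by (simp add: Gm_def coords_def[abs_def])

text \<open>On the part of \<open>U\<close> inside the chart, \<open>Y\<close> is a combination of
  coordinate fields with smooth real coefficients. Locality of \<open>nabla\<close> allows the
  restriction, and the Leibniz rule yields the derivative of the coefficients plus the Christoffel
  terms.\<close>

lemma nabla_component:
  assumes U: "open U" "smooth_vf A U Y" "p \<in> U" and v: "v \<in> tangent_space A p" and c: "c \<in> A" "p \<in> fst c"
  shows "nabla p v Y c = ddir (coords c Y) (v c) (snd c p) + Gm A nabla c (snd c p) (v c) (Y p c)"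
proof -
  define V where "V = U \<inter> fst c"
  have V: "open V" "p \<in> V" "V \<subseteq> fst c" "V \<subseteq> U" using U chart(1)[OF c(1)] c by (auto simp: V_def)
  define f where "f b q = coords c Y (snd c q) \<bullet> b" for b q
  have yV: "smooth_on (snd c ` V) (coords c Y)" using smooth_vf_coords[OF U(2) c(1)] by (simp add: V_def)
  have oV: "open (snd c ` V)" using open_chart_image[OF c(1) U(1)] by (simp add: V_def)
  have f: "smooth_fun A V (f b)" for b
    unfolding f_def[abs_def]
    by (rule smooth_fun_chart[OF c(1) V(1,3), of "\<lambda>z. coords c Y z \<bullet> b"])
      (rule smooth_on_bounded_linear[OF oV bounded_linear_inner_left yV])
  have E: "smooth_vf A V (\<lambda>q. tv A c q b)" for b
    by (rule smooth_vf_subset[OF smooth_vf_tv_const[OF c(1)] V(3)])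
  note ns = nabla_sum[where f=f and E="\<lambda>b q. tv A c q b", OF V(1,2) v finite_Basis nonempty_Basis f E]
  have "Y q = (\<Sum>b\<in>Basis. f b q *\<^sub>R tv A c q b)" if "q \<in> V" for q
  proof -
    have q: "q \<in> U" "q \<in> fst c" using that V by auto
    have "tv A c q (\<Sum>b\<in>Basis. f b q *\<^sub>R b) = (\<Sum>b\<in>Basis. f b q *\<^sub>R tv A c q b)"
      by (simp add: linear_sum[OF linear_tv[OF c(1) q(2)]] tv_scaleR[OF c(1) q(2)])
    then show ?thesis using smooth_vf_eq_tv[OF U(2) c(1) q] by (simp add: f_def euclidean_representation)
  qed
  then have "nabla p v Y = nabla p v (\<lambda>q. \<Sum>b\<in>Basis. f b q *\<^sub>R tv A c q b)"
    using ns by (intro nabla_cong[OF V(1) _ V(2) v]) auto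
  also have "\<dots> = (\<Sum>b\<in>Basis. dir_deriv A p v (f b) *\<^sub>R tv A c p b + f b p *\<^sub>R nabla p v (\<lambda>q. tv A c q b))"
    using ns by blast
  finally have "nabla p v Y c = (\<Sum>b\<in>Basis. dir_deriv A p v (f b) *\<^sub>R b) + (\<Sum>b\<in>Basis. f b p *\<^sub>R nabla p v (\<lambda>q. tv A c q b) c)"
    by (simp add: sum_fun_apply sum.distrib c)
  also have "(\<Sum>b\<in>Basis. dir_deriv A p v (f b) *\<^sub>R b) = ddir (coords c Y) (v c) (snd c p)"
  proof -
    have "dir_deriv A p v (f b) = ddir (coords c Y) (v c) (snd c p) \<bullet> b" for b
    proof -
      have "dir_deriv A p v (f b) = ddir (f b \<circ> chart_inv c) (v c) (snd c p)"
        by (rule dir_deriv_eq[OF f V(2) c v])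
      also have "\<dots> = ddir (\<lambda>z. coords c Y z \<bullet> b) (v c) (snd c p)"
        by (rule ddir_cong[OF oV]) (use V c in \<open>auto simp: f_def\<close>)
      also have "\<dots> = ddir (coords c Y) (v c) (snd c p) \<bullet> b"
        by (rule ddir_bounded_linear[OF bounded_linear_inner_left smooth_vf_coords_differentiable[OF U(2) c(1) U(3) c(2)]])
      finally show ?thesis .
    qed
    then show ?thesis by (simp add: euclidean_representation)
  qed
  also have "(\<Sum>b\<in>Basis. f b p *\<^sub>R nabla p v (\<lambda>q. tv A c q b) c) = Gm A nabla c (snd c p) (v c) (Y p c)"
  proof -
    have lin: "linear (Gm A nabla c (snd c p) (v c))"
      using Gm_bilinear[OF c(1), of "snd c p"] c by (simp add: bilinear_def)
    show ?thesis
      unfolding linear_Basis_expand[OF lin, of "Y p c"]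
      by (simp add: f_def coords_def c Gm_at tv_component[OF c v])
  qed
  finally show ?thesis .
qed

text \<open>The derivatives of the two extensions add up to the component of the Lie bracket and
  cancel against it. Only values at \<open>p\<close> remain, so the chosen extensions do not
  matter.\<close>

lemma torsion_component:
  assumes x: "x \<in> tangent_space A p" and y: "y \<in> tangent_space A p" and c: "c \<in> A" "p \<in> fst c"
  shows "torsion A nabla p x y c = Gm A nabla c (snd c p) (x c) (y c) - Gm A nabla c (snd c p) (y c) (x c)"
proof -
  obtain U where U: "open U" "p \<in> U" "smooth_vf A U (local_extension A p x)" and [simp]: "local_extension A p x p = x"
    using local_extension[OF x] by blast
  obtain V where V: "open V" "p \<in> V" "smooth_vf A V (local_extension A p y)" and [simp]: "local_extension A p y p = y"
    using local_extension[OF y] by blast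
  show ?thesis
    using nabla_component[OF U(1,3,2) y c] nabla_component[OF V(1,3,2) x c]
    by (simp add: torsion_def Let_def lie_bracket_component[OF c])
qed

lemma torsion_tangent:
  assumes x: "x \<in> tangent_space A p" and y: "y \<in> tangent_space A p"
  shows "torsion A nabla p x y \<in> tangent_space A p"
proof -
  obtain U where U: "open U" "p \<in> U" "smooth_vf A U (local_extension A p x)"
    using local_extension[OF x] by blast
  obtain V where V: "open V" "p \<in> V" "smooth_vf A V (local_extension A p y)"
    using local_extension[OF y] by blast
  have "lie_bracket A (local_extension A p x) (local_extension A p y) p \<in> tangent_space A p"
    using U V by (intro lie_bracket_tangent[of "U \<inter> V"]) (auto intro: smooth_vf_subset)
  then show ?thesis
    unfolding torsion_def Let_def
    by (intro tangent_diff nabla_tangent[OF U(1,3,2) y] nabla_tangent[OF V(1,3,2) x])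
qed

end

section \<open>Complexified Lie algebras with a complex structure\<close>

lemma vector_space_cscale: "vector_space (cscale :: complex \<Rightarrow> 'v::real_vector \<times> 'v \<Rightarrow> 'v \<times> 'v)"
  by unfold_locales (auto simp: cscale_def algebra_simps)

lemma subspace_cscale_iff:
  "module.subspace cscale S \<longleftrightarrow> 0 \<in> S \<and> (\<forall>x\<in>S. \<forall>y\<in>S. x + y \<in> S) \<and> (\<forall>c. \<forall>x\<in>S. cscale c x \<in> S)"
  by (rule module.subspace_def[OF module_iff_vector_space[THEN iffD2, OF vector_space_cscale]])

lemma lie_ideal_complex_lie_algebra:
  "complex_lie_algebra smul L br \<Longrightarrow> lie_ideal smul L br I \<Longrightarrow> complex_lie_algebra smul I br"
  unfolding complex_lie_algebra_def lie_ideal_def by (auto simp: subset_iff)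

text \<open>The axioms are pulled back along an injective linear map. A bracket-preserving
  isomorphism onto one fibre thus certifies the model bracket of a local frame.\<close>

lemma complex_lie_algebra_transport:
  assumes L: "complex_lie_algebra s2 L br" and lin: "Vector_Spaces.linear s1 s2 f"
    and bij: "bij_betw f UNIV L" and hom: "\<And>v w. f (B v w) = br (f v) (f w)"
  shows "complex_lie_algebra s1 UNIV B"
proof -
  have vs: "vector_space s1" and add: "f (x + y) = f x + f y" and scale: "f (s1 c x) = s2 c (f x)" for x y c
    using lin unfolding Vector_Spaces.linear_iff by blast+
  have inj: "f x = f y \<longleftrightarrow> x = y" for x y using bij by (auto simp: bij_betw_def inj_on_def)
  have in_L: "f x \<in> L" for x using bij by (auto simp: bij_betw_def)
  have zero: "f 0 = 0" using add[of 0 0] by simp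
  note Lfacts = L[unfolded complex_lie_algebra_def]
  have 1: "br x x = 0" if "x \<in> L" for x
    using Lfacts that by blast
  have 2: "br (s2 c x) y = s2 c (br x y)" "br x (s2 c y) = s2 c (br x y)" if "x \<in> L" "y \<in> L" for x y c
    using Lfacts that by blast+
  have 3: "br (x + y) z = br x z + br y z" "br z (x + y) = br z x + br z y"
    "br x (br y z) + br y (br z x) + br z (br x y) = 0" if "x \<in> L" "y \<in> L" "z \<in> L" for x y z
    using Lfacts that by blast+
  have "module.subspace s1 UNIV"
    using vs by (simp add: module.subspace_def vector_space_def module_def)
  moreover have "B (x + y) z = B x z + B y z" "B z (x + y) = B z x + B z y"
    "B (s1 c x) y = s1 c (B x y)" "B x (s1 c y) = s1 c (B x y)" "B x x = 0"
    "B x (B y z) + B y (B z x) + B z (B x y) = 0" for x y z c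
    by (subst inj[symmetric], simp only: hom add scale zero 1 2 3 in_L)+
  ultimately show ?thesis unfolding complex_lie_algebra_def using vs by blast
qed

definition local_lie_frame ::
    "('m::topological_space, 'n::finite) chart set \<Rightarrow> ('m \<Rightarrow> ('m, 'n) ctvec set) \<Rightarrow>
     ('m \<Rightarrow> ('m, 'n) ctvec \<Rightarrow> ('m, 'n) ctvec \<Rightarrow> ('m, 'n) ctvec) \<Rightarrow> 'm set \<Rightarrow>
     (complex^'k \<Rightarrow> complex^'k \<Rightarrow> complex^'k) \<Rightarrow> ('m \<Rightarrow> complex^'k::finite \<Rightarrow> ('m, 'n) ctvec) \<Rightarrow> bool" where
  "local_lie_frame A E br U B \<Phi> \<longleftrightarrow> open U \<and>
     (\<forall>q\<in>U. Vector_Spaces.linear (*s) cscale (\<Phi> q) \<and> bij_betw (\<Phi> q) UNIV (E q) \<and>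
       (\<forall>v w. \<Phi> q (B v w) = br q (\<Phi> q v) (\<Phi> q w))) \<and>
     (\<forall>w. smooth_cvf A U (\<lambda>q. \<Phi> q w))"

lemma lie_algebra_bundleI:
  fixes E :: "'m::topological_space \<Rightarrow> ('m, 'n::finite) ctvec set"
  assumes sub: "\<And>p. E p \<subseteq> TC A p" and lie: "\<And>p. complex_lie_algebra cscale (E p) (br p)"
    and frame: "\<And>p. \<exists>U (B :: complex^'k \<Rightarrow> complex^'k \<Rightarrow> complex^'k) \<Phi>. p \<in> U \<and> local_lie_frame A E br U B \<Phi>"
  shows "lie_algebra_bundle A TYPE('k::finite) E br"
  unfolding lie_algebra_bundle_def
proof (intro conjI allI sub lie)
  fix p
  obtain U and B :: "complex^'k \<Rightarrow> complex^'k \<Rightarrow> complex^'k" and \<Phi> where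
    p: "p \<in> U" and *: "open U" "\<forall>q\<in>U. Vector_Spaces.linear (*s) cscale (\<Phi> q) \<and> bij_betw (\<Phi> q) UNIV (E q) \<and>
      (\<forall>v w. \<Phi> q (B v w) = br q (\<Phi> q v) (\<Phi> q w))" "\<forall>w. smooth_cvf A U (\<lambda>q. \<Phi> q w)"
    using frame[of p] unfolding local_lie_frame_def by blast
  have "complex_lie_algebra (*s) UNIV B"
    by (rule complex_lie_algebra_transport[where f="\<Phi> p", OF lie[of p]]) (use p * in auto)
  with p * show "\<exists>U (B :: complex^'k \<Rightarrow> complex^'k \<Rightarrow> complex^'k) \<Phi>. open U \<and> p \<in> U \<and>
      complex_lie_algebra (*s) UNIV B \<and>
      (\<forall>q\<in>U. Vector_Spaces.linear (*s) cscale (\<Phi> q) \<and> bij_betw (\<Phi> q) UNIV (E q) \<and>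
        (\<forall>v w. \<Phi> q (B v w) = br q (\<Phi> q v) (\<Phi> q w))) \<and>
      (\<forall>w. smooth_cvf A U (\<lambda>q. \<Phi> q w))" by blast
qed

lemma scalar_mult_Re_Im: "c *s w = Re c *\<^sub>R w + Im c *\<^sub>R (\<i> *s w)" for w :: "complex^'n"
  by (simp add: vec_eq_iff complex_eq_iff)

section \<open>Coordinates on the sum of a space and its conjugate\<close>

definition left_part :: "complex^('n + 'n) \<Rightarrow> complex^'n" where
  "left_part v = (\<chi> i. v $ Inl i)"

text \<open>Conjugated, as \<open>a \<mapsto> (a + \<i> J a) / 2\<close> is antilinear into \<open>T\<^sup>0\<^sup>,\<^sup>1M\<close>.\<close>

definition right_part :: "complex^('n + 'n) \<Rightarrow> complex^'n" where
  "right_part v = (\<chi> i. cnj (v $ Inr i))"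

definition join_parts :: "complex^'n \<Rightarrow> complex^'n \<Rightarrow> complex^('n + 'n)" where
  "join_parts a b = (\<chi> i. case i of Inl j \<Rightarrow> a $ j | Inr j \<Rightarrow> cnj (b $ j))"

lemma parts_join [simp]: "left_part (join_parts a b) = a" "right_part (join_parts a b) = b"
  by (simp_all add: left_part_def right_part_def join_parts_def vec_eq_iff)

lemma parts_eqI:
  assumes "left_part v = left_part w" "right_part v = right_part w"
  shows "v = w"
  unfolding vec_eq_iff
proof
  fix i
  show "v $ i = w $ i"
    using assms by (cases i) (auto simp: left_part_def right_part_def vec_eq_iff)
qed

lemma parts_add: "left_part (v + w) = left_part v + left_part w" "right_part (v + w) = right_part v + right_part w"
  by (simp_all add: left_part_def right_part_def vec_eq_iff)

lemma parts_scale: "left_part (c *s v) = c *s left_part v" "right_part (c *s v) = cnj c *s right_part v"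
  by (simp_all add: left_part_def right_part_def vec_eq_iff)

text \<open>By \<open>br_J\<close> and antisymmetry the bracket is complex bilinear for
  \<open>J\<close>: \<open>T\<close> is a complex Lie algebra described over the reals. Its
  complexification is then the sum of a copy and a conjugate copy of \<open>T\<close>, the
  eigenspaces of \<open>J\<close>.\<close>

locale complex_structure_lie =
  fixes T :: "'v::real_vector set" and J :: "'v \<Rightarrow> 'v" and br :: "'v \<Rightarrow> 'v \<Rightarrow> 'v"
  assumes T0: "0 \<in> T" and T_add: "x \<in> T \<Longrightarrow> y \<in> T \<Longrightarrow> x + y \<in> T" and T_scale: "x \<in> T \<Longrightarrow> r *\<^sub>R x \<in> T"
    and T_J: "x \<in> T \<Longrightarrow> J x \<in> T" and J_add: "J (x + y) = J x + J y" and J_scale: "J (r *\<^sub>R x) = r *\<^sub>R J x"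
    and J_J: "J (J x) = - x"
    and br_closed: "x \<in> T \<Longrightarrow> y \<in> T \<Longrightarrow> br x y \<in> T"
    and br_antisym: "x \<in> T \<Longrightarrow> y \<in> T \<Longrightarrow> br y x = - br x y"
    and br_add: "x \<in> T \<Longrightarrow> y \<in> T \<Longrightarrow> z \<in> T \<Longrightarrow> br (x + y) z = br x z + br y z"
    and br_scale: "x \<in> T \<Longrightarrow> y \<in> T \<Longrightarrow> br (r *\<^sub>R x) y = r *\<^sub>R br x y"
    and br_J: "x \<in> T \<Longrightarrow> y \<in> T \<Longrightarrow> br (J x) y = J (br x y)"
    and Jacobi: "x \<in> T \<Longrightarrow> y \<in> T \<Longrightarrow> z \<in> T \<Longrightarrow> br (br x y) z + br (br y z) x + br (br z x) y = 0"
begin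

lemma T_minus: "x \<in> T \<Longrightarrow> - x \<in> T"
  using T_scale[of x "-1"] by simp

lemma T_diff: "x \<in> T \<Longrightarrow> y \<in> T \<Longrightarrow> x - y \<in> T"
  using T_add[of x "- y"] T_minus[of y] by simp

lemma J_minus: "J (- x) = - J x"
  using J_scale[of "-1" x] by simp

lemma J_diff: "J (x - y) = J x - J y"
  using J_add[of x "- y"] J_minus[of y] by simp

lemma J_zero: "J 0 = 0"
  using J_scale[of 0 0] by simp

lemma br_minus: "x \<in> T \<Longrightarrow> y \<in> T \<Longrightarrow> br (- x) y = - br x y"
  using br_scale[of x y "-1"] by simp

lemma br_diff: "x \<in> T \<Longrightarrow> y \<in> T \<Longrightarrow> z \<in> T \<Longrightarrow> br (x - y) z = br x z - br y z"
  using br_add[of x "- y" z] br_minus[of y z] T_minus[of y] by simp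

lemma br_right:
  assumes "x \<in> T" "y \<in> T" "z \<in> T"
  shows "br z (x + y) = br z x + br z y" "br z (x - y) = br z x - br z y" "br z (r *\<^sub>R x) = r *\<^sub>R br z x"
    "br z (- x) = - br z x" "br z (J x) = J (br z x)"
proof -
  show "br z (x + y) = br z x + br z y"
    using br_antisym[of "x + y" z] br_antisym[of x z] br_antisym[of y z] br_add[of x y z] assms T_add by simp
  show "br z (x - y) = br z x - br z y"
    using br_antisym[of "x - y" z] br_antisym[of x z] br_antisym[of y z] br_diff[of x y z] assms T_diff by simp
  show "br z (r *\<^sub>R x) = r *\<^sub>R br z x"
    using br_antisym[of "r *\<^sub>R x" z] br_antisym[of x z] br_scale[of x z r] assms T_scale by simp
  show "br z (- x) = - br z x"
    using br_antisym[of "- x" z] br_antisym[of x z] br_minus[of x z] assms T_minus by simp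
  show "br z (J x) = J (br z x)"
    using br_antisym[of "J x" z] br_antisym[of x z] br_J[of x z] assms T_J by (simp add: J_minus)
qed

lemmas T_closed = T0 T_add T_scale T_minus T_diff T_J br_closed
lemmas J_simps = J_zero J_add J_scale J_minus J_diff J_J
lemmas br_simps = br_add br_scale br_minus br_diff br_J br_right

lemma br_self: "x \<in> T \<Longrightarrow> br x x = 0"
proof -
  assume "x \<in> T"
  then have "br x x + br x x = 0" using br_antisym[of x x] by (metis add.right_inverse)
  then show ?thesis by (simp flip: scaleR_2)
qed

lemma Jacobi_right:
  assumes "x \<in> T" "y \<in> T" "z \<in> T"
  shows "br x (br y z) + br y (br z x) + br z (br x y) = 0"
proof -
  have "br x (br y z) = - br (br y z) x" "br y (br z x) = - br (br z x) y" "br z (br x y) = - br (br x y) z"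
    using assms by (auto intro: br_antisym br_closed)
  then have "br x (br y z) + br y (br z x) + br z (br x y) = - (br (br x y) z + br (br y z) x + br (br z x) y)"
    by (simp add: algebra_simps)
  then show ?thesis using Jacobi[OF assms] by simp
qed

lemma complex_lie_algebra_cbilin: "complex_lie_algebra cscale (T \<times> T) (cbilin br)"
  unfolding complex_lie_algebra_def
proof (intro conjI ballI allI)
  show "vector_space (cscale :: complex \<Rightarrow> 'v \<times> 'v \<Rightarrow> 'v \<times> 'v)" by (rule vector_space_cscale)
  show "module.subspace cscale (T \<times> T)"
    unfolding subspace_cscale_iff by (auto simp: cscale_def T_closed zero_prod_def)
  fix x y assume x: "x \<in> T \<times> T" and y: "y \<in> T \<times> T"
  show "cbilin br x y \<in> T \<times> T"
    using x y by (auto simp: cbilin_def T_closed)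
  show "cbilin br (cscale c x) y = cscale c (cbilin br x y)"
    "cbilin br x (cscale c y) = cscale c (cbilin br x y)" for c
    using x y by (auto simp: cbilin_def cscale_def br_simps T_closed algebra_simps)
  fix z assume z: "z \<in> T \<times> T"
  show "cbilin br (x + y) z = cbilin br x z + cbilin br y z"
    "cbilin br z (x + y) = cbilin br z x + cbilin br z y"
    using x y z by (auto simp: cbilin_def br_simps T_closed)
  show "cbilin br x (cbilin br y z) + cbilin br y (cbilin br z x) + cbilin br z (cbilin br x y) = 0"
  proof -
    obtain x1 x2 y1 y2 z1 z2 where xyz: "x = (x1, x2)" "y = (y1, y2)" "z = (z1, z2)" by (meson surj_pair)
    then have m: "x1 \<in> T" "x2 \<in> T" "y1 \<in> T" "y2 \<in> T" "z1 \<in> T" "z2 \<in> T" using x y z by auto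
    \<comment> \<open>The two components of the complex Jacobi sum are the real and the imaginary
      part of the trilinear extension of \<open>Q\<close>.\<close>
    define Q where "Q u v w = br u (br v w) + br v (br w u) + br w (br u v)" for u v w
    have "fst (cbilin br x (cbilin br y z) + cbilin br y (cbilin br z x) + cbilin br z (cbilin br x y)) =
        Q x1 y1 z1 - Q x1 y2 z2 - Q x2 y1 z2 - Q x2 y2 z1"
      using m by (simp add: xyz cbilin_def br_simps T_closed Q_def)
    moreover have "snd (cbilin br x (cbilin br y z) + cbilin br y (cbilin br z x) + cbilin br z (cbilin br x y)) =
        Q x2 y1 z1 + Q x1 y2 z1 + Q x1 y1 z2 - Q x2 y2 z2"
      using m by (simp add: xyz cbilin_def br_simps T_closed Q_def)
    ultimately show ?thesis using m by (simp add: prod_eq_iff Q_def Jacobi_right)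
  qed
next
  fix x assume "x \<in> T \<times> T"
  then obtain x1 x2 where "x = (x1, x2)" "x1 \<in> T" "x2 \<in> T" by blast
  then show "cbilin br x x = 0"
    using br_antisym[of x1 x2] by (simp add: cbilin_def br_self zero_prod_def)
qed

text \<open>The (1,0) part of the real vector \<open>x\<close>, as in \<open>holo_vec\<close>. It is
  complex linear on \<open>T\<close> with \<open>J\<close>; the factor \<open>1/2\<close> makes it
  preserve brackets.\<close>

definition hol :: "'v \<Rightarrow> 'v \<times> 'v" where "hol x = ((1/2) *\<^sub>R x, - ((1/2) *\<^sub>R J x))"

definition ahol :: "'v \<Rightarrow> 'v \<times> 'v" where "ahol x = ((1/2) *\<^sub>R x, (1/2) *\<^sub>R J x)"

lemma type_10_iff: "{V \<in> T \<times> T. map_prod J J V = cscale \<i> V} = hol ` T"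
proof (intro set_eqI iffI)
  fix V assume "V \<in> {V \<in> T \<times> T. map_prod J J V = cscale \<i> V}"
  then obtain a b where ab: "V = (a, b)" "a \<in> T" "b \<in> T" "J a = - b"
    by (auto simp: cscale_def)
  then have "V = hol (2 *\<^sub>R a)" by (simp add: hol_def J_scale)
  then show "V \<in> hol ` T" using ab T_scale by blast
next
  fix V assume "V \<in> hol ` T"
  then show "V \<in> {V \<in> T \<times> T. map_prod J J V = cscale \<i> V}"
    by (auto simp: hol_def cscale_def J_simps T_closed)
qed

lemma type_01_iff: "{V \<in> T \<times> T. map_prod J J V = cscale (- \<i>) V} = ahol ` T"
proof (intro set_eqI iffI)
  fix V assume "V \<in> {V \<in> T \<times> T. map_prod J J V = cscale (- \<i>) V}"
  then obtain a b where ab: "V = (a, b)" "a \<in> T" "b \<in> T" "J a = b"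
    by (auto simp: cscale_def)
  then have "V = ahol (2 *\<^sub>R a)" by (simp add: ahol_def J_scale)
  then show "V \<in> ahol ` T" using ab T_scale by blast
next
  fix V assume "V \<in> ahol ` T"
  then show "V \<in> {V \<in> T \<times> T. map_prod J J V = cscale (- \<i>) V}"
    by (auto simp: ahol_def cscale_def J_simps T_closed)
qed

lemma hol_add: "hol (x + y) = hol x + hol y" and ahol_add: "ahol (x + y) = ahol x + ahol y"
  by (simp_all add: hol_def ahol_def J_simps algebra_simps)

lemma cscale_hol: "cscale c (hol x) = hol (Re c *\<^sub>R x + Im c *\<^sub>R J x)"
  by (simp add: hol_def cscale_def J_simps algebra_simps)

lemma cscale_ahol: "cscale c (ahol x) = ahol (Re c *\<^sub>R x - Im c *\<^sub>R J x)"
  by (simp add: ahol_def cscale_def J_simps algebra_simps)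

text \<open>\<open>br (J x) (J y) = - br x y\<close> doubles the real part, and the two
  contributions to the imaginary part agree likewise, so of the two factors \<open>1/2\<close> one
  is left.\<close>

lemma cbilin_hol:
  assumes "x \<in> T" "y \<in> T"
  shows "cbilin br (hol x) (hol y) = hol (br x y)"
proof -
  have half: "(1/2) *\<^sub>R v = (1/4) *\<^sub>R v + (1/4) *\<^sub>R v" for v :: 'v
    by (simp flip: scaleR_add_left)
  show ?thesis
    unfolding hol_def[of "br x y"] half using assms by (simp add: hol_def cbilin_def br_simps T_closed J_simps)
qed

lemma cbilin_ahol: "x \<in> T \<Longrightarrow> y \<in> T \<Longrightarrow> cbilin br (ahol x) (ahol y) = ahol (br x y)"
  by (simp add: ahol_def cbilin_def br_simps T_closed J_simps flip: scaleR_add_left)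

text \<open>Up to a factor the real part is \<open>br x y + br (J x) (J y)\<close> and the imaginary
  part \<open>br x (J y) - br (J x) y\<close>. Both vanish for a bracket that is complex bilinear
  for \<open>J\<close>.\<close>

lemma cbilin_hol_ahol:
  assumes "x \<in> T" "y \<in> T"
  shows "cbilin br (hol x) (ahol y) = 0" "cbilin br (ahol y) (hol x) = 0"
  using assms by (simp_all add: hol_def ahol_def cbilin_def br_simps T_closed J_simps zero_prod_def)

lemma cbilin_hol_ahol_sum:
  assumes "x \<in> T" "y \<in> T" "x' \<in> T" "y' \<in> T"
  shows "cbilin br (hol x + ahol y) (hol x' + ahol y') = hol (br x x') + ahol (br y y')"
proof -
  have m: "hol x \<in> T \<times> T" "ahol x \<in> T \<times> T" if "x \<in> T" for x
    using that by (auto simp: hol_def ahol_def T_closed)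
  have "cbilin br (u + v) w = cbilin br u w + cbilin br v w" "cbilin br w (u + v) = cbilin br w u + cbilin br w v"
    if "u \<in> T \<times> T" "v \<in> T \<times> T" "w \<in> T \<times> T" for u v w
    using complex_lie_algebra_cbilin that unfolding complex_lie_algebra_def by blast+
  moreover have "hol x + ahol y \<in> T \<times> T"
    using m[OF assms(1)] m[OF assms(2)] by (auto simp: mem_Times_iff T_closed)
  ultimately show ?thesis
    using m assms by (simp add: cbilin_hol cbilin_ahol cbilin_hol_ahol)
qed

lemma hol_ahol_eq_iff: "hol x + ahol y = hol x' + ahol y' \<longleftrightarrow> x = x' \<and> y = y'"
proof
  assume "hol x + ahol y = hol x' + ahol y'"
  then have 1: "x + y = x' + y'" and 2: "J y - J x = J y' - J x'"
    by (auto simp: hol_def ahol_def simp flip: scaleR_add_right scaleR_diff_right)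
  have "x - y = x' - y'" using arg_cong[OF 2, of J] by (simp add: J_simps)
  then have "2 *\<^sub>R x = 2 *\<^sub>R x'" using 1 by (metis add_diff_cancel_left' add_diff_eq diff_add_cancel scaleR_2 add.assoc add.commute)
  then show "x = x' \<and> y = y'" using 1 by simp
qed simp

lemma hol_ahol_decomp: "(a, b) = hol (a + J b) + ahol (a - J b)"
  by (simp add: hol_def ahol_def J_simps algebra_simps flip: scaleR_add_left)

lemma lie_ideal_hol: "lie_ideal cscale (T \<times> T) (cbilin br) (hol ` T)"
  unfolding lie_ideal_def subspace_cscale_iff
proof (intro conjI ballI allI)
  show "0 \<in> hol ` T" using T0 by (auto simp: hol_def zero_prod_def J_simps intro!: image_eqI[of _ _ 0])
  show "u + v \<in> hol ` T" if "u \<in> hol ` T" "v \<in> hol ` T" for u v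
    using that T_add by (auto simp flip: hol_add)
  show "cscale c u \<in> hol ` T" if "u \<in> hol ` T" for c u
    using that by (auto simp: cscale_hol intro!: imageI T_closed)
  show "hol ` T \<subseteq> T \<times> T" by (auto simp: hol_def T_closed)
  fix u v assume u: "u \<in> T \<times> T" and "v \<in> hol ` T"
  then obtain a b y where "u = (a, b)" "a \<in> T" "b \<in> T" "v = hol y" "y \<in> T" by blast
  \<comment> \<open>Only \<open>hol (a + J b)\<close>, the (1,0) part of \<open>a + \<i> b\<close>,
    contributes: in a bracket with \<open>hol y\<close> the formal \<open>\<i>\<close> acts like
    \<open>J\<close>.\<close>
  moreover have "cbilin br (a, b) (hol y) = hol (br (a + J b) y)" if "a \<in> T" "b \<in> T" "y \<in> T"
    using that by (simp add: hol_def cbilin_def br_simps T_closed J_simps algebra_simps)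
  ultimately show "cbilin br u v \<in> hol ` T" by (auto intro!: imageI T_closed)
qed

text \<open>Passing to the conjugate complex structure \<open>-J\<close> exchanges the two types.\<close>

lemma conjugate: "complex_structure_lie T (\<lambda>x. - J x) br"
  by unfold_locales ((rule br_antisym; assumption) | simp add: br_simps T_closed J_simps Jacobi)+

lemma lie_ideal_ahol: "lie_ideal cscale (T \<times> T) (cbilin br) (ahol ` T)"
proof -
  have "complex_structure_lie.hol (\<lambda>x. - J x) = ahol"
    by (rule ext) (simp add: complex_structure_lie.hol_def[OF conjugate] ahol_def)
  then show ?thesis using complex_structure_lie.lie_ideal_hol[OF conjugate] by simp
qed

lemma hol_ahol_direct_sum:
  assumes "V \<in> T \<times> T"
  shows "\<exists>!W. fst W \<in> hol ` T \<and> snd W \<in> ahol ` T \<and> V = fst W + snd W"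
proof -
  obtain a b where V: "V = (a, b)" "a \<in> T" "b \<in> T" using assms by blast
  show ?thesis
  proof (rule ex1I[of _ "(hol (a + J b), ahol (a - J b))"])
    show "fst (hol (a + J b), ahol (a - J b)) \<in> hol ` T \<and> snd (hol (a + J b), ahol (a - J b)) \<in> ahol ` T \<and>
        V = fst (hol (a + J b), ahol (a - J b)) + snd (hol (a + J b), ahol (a - J b))"
      using V hol_ahol_decomp[of a b] by (auto intro!: imageI T_closed)
    fix W assume "fst W \<in> hol ` T \<and> snd W \<in> ahol ` T \<and> V = fst W + snd W"
    then obtain x y where "W = (hol x, ahol y)" "V = hol x + ahol y" by (cases W) auto
    then show "W = (hol (a + J b), ahol (a - J b))"
      using hol_ahol_decomp[of a b] by (simp add: V(1) hol_ahol_eq_iff)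
  qed
qed

end

section \<open>The Chern torsion of a Hermitian manifold with parallel Bismut torsion\<close>

locale parallel_bismut_manifold =
  fixes A :: "('m::topological_space, 'n::finite) chart set"
    and g :: "'m \<Rightarrow> ('m, 'n) tvec \<Rightarrow> ('m, 'n) tvec \<Rightarrow> real"
    and nabla nablac :: "('m, 'n) conn"
  assumes hermitian: "hermitian_manifold A g"
    and bismut: "bismut_connection A g nabla"
    and parallel: "parallel_torsion A nabla"
    and chern: "chern_connection A g nablac"
begin

sublocale cx_connection A nabla
  using hermitian bismut
  by unfold_locales (auto simp: hermitian_manifold_def bismut_connection_def hermitian_connection_def)

sublocale nc: cx_connection A nablac
  using chern by unfold_locales (auto simp: chern_connection_def hermitian_connection_def)

section \<open>The metric and both connections in charts\<close>

lemma metric: "hermitian_metric A g"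
  using hermitian by (simp add: hermitian_manifold_def)

lemma
  assumes "x \<in> tangent_space A p" "y \<in> tangent_space A p"
  shows g_sym: "g p x y = g p y x"
    and g_add: "\<And>z. z \<in> tangent_space A p \<Longrightarrow> g p (x + y) z = g p x z + g p y z"
    and g_scaleR: "\<And>r. g p (r *\<^sub>R x) y = r * g p x y"
    and g_pos: "x \<noteq> 0 \<Longrightarrow> g p x x > 0"
    and g_Jop: "g p (Jop x) (Jop y) = g p x y"
proof -
  note * = metric[unfolded hermitian_metric_def, THEN conjunct1, THEN spec, of p, THEN bspec, OF assms(1), THEN bspec, OF assms(2)]
  show "g p x y = g p y x" using * by (elim conjE)
  show "g p (x + y) z = g p x z + g p y z" if "z \<in> tangent_space A p" for z
    using *[THEN conjunct2, THEN conjunct1, THEN bspec, OF that] .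
  show "g p (r *\<^sub>R x) y = r * g p x y" for r
    using *[THEN conjunct2, THEN conjunct2, THEN conjunct1, THEN spec] .
  show "x \<noteq> 0 \<Longrightarrow> g p x x > 0" using * by (elim conjE) (rule mp)
  show "g p (Jop x) (Jop y) = g p x y" using * by (elim conjE)
qed

lemma g_smooth: "open U \<Longrightarrow> smooth_vf A U X \<Longrightarrow> smooth_vf A U Y \<Longrightarrow> smooth_fun A U (\<lambda>p. g p (X p) (Y p))"
  using metric[unfolded hermitian_metric_def, THEN conjunct2, THEN spec, of U, THEN spec, of X, THEN spec, of Y] by (rule mp) blast

definition Gc :: "('m, 'n) chart \<Rightarrow> complex^'n \<Rightarrow> complex^'n \<Rightarrow> complex^'n \<Rightarrow> real" where
  "Gc c z u v = g (chart_inv c z) (tv A c (chart_inv c z) u) (tv A c (chart_inv c z) v)"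

lemma Gc_at: "c \<in> A \<Longrightarrow> p \<in> fst c \<Longrightarrow> Gc c (snd c p) u v = g p (tv A c p u) (tv A c p v)"
  by (simp add: Gc_def)

lemma Gc_bilinear:
  assumes c: "c \<in> A" and z: "z \<in> snd c ` fst c"
  shows "bilinear (Gc c z)"
proof -
  obtain p where p: "p \<in> fst c" "z = snd c p" using z by blast
  note t = tv_tangent[OF c p(1)]
  have sym: "Gc c z u v = Gc c z v u" for u v
    unfolding p(2) Gc_at[OF c p(1)] by (rule g_sym[OF t t])
  have lin: "linear (\<lambda>u. Gc c z u v)" for v
    unfolding p(2) Gc_at[OF c p(1)]
    by (rule linearI) (simp_all add: tv_add[OF c p(1)] tv_scaleR[OF c p(1)] g_add[OF t t t] g_scaleR[OF t t])
  moreover have "linear (Gc c z u)" for u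
  proof -
    have "Gc c z u = (\<lambda>v. Gc c z v u)" by (rule ext) (rule sym)
    then show ?thesis using lin[of u] by simp
  qed
  ultimately show ?thesis unfolding bilinear_def by blast
qed

lemma hermitian_conn_metric:
  assumes "hermitian_connection A g D" "open U" "smooth_vf A U Y" "smooth_vf A U Z" "p \<in> U" "v \<in> tangent_space A p"
  shows "dir_deriv A p v (\<lambda>q. g q (Y q) (Z q)) = g p (D p v Y) (Z p) + g p (Y p) (D p v Z)"
    and "D p v (\<lambda>q. Jop (Y q)) = Jop (D p v Y)"
  using assms(1)[unfolded hermitian_connection_def, THEN conjunct2, THEN spec, of U, THEN spec, of Y, THEN spec, of Z,
      THEN mp, OF conjI[OF assms(2) conjI[OF assms(3,4)]], THEN bspec, OF assms(5), THEN bspec, OF assms(6)]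
  by (blast elim: conjE)+

text \<open>The coordinate field of \<open>\<i> *s v\<close> is \<open>Jop\<close> of the coordinate
  field of \<open>v\<close>, and a Hermitian connection commutes with \<open>Jop\<close>.\<close>

lemma Gm_i:
  assumes D: "hermitian_connection A g D" and c: "c \<in> A" and z: "z \<in> snd c ` fst c"
  shows "Gm A D c z u (\<i> *s v) = \<i> *s Gm A D c z u v"
proof -
  obtain p where p: "p \<in> fst c" "z = snd c p" using z by blast
  interpret D: cx_connection A D
    using D by unfold_locales (simp add: hermitian_connection_def)
  note s = smooth_vf_tv_const[OF c] and o = chart(1)[OF c] and t = tv_tangent[OF c p(1)]
  have "D p (tv A c p u) (\<lambda>q. tv A c q (\<i> *s v)) = D p (tv A c p u) (\<lambda>q. Jop (tv A c q v))"
    by (rule D.nabla_cong[OF o smooth_vf_Jop[OF o s] p(1) t]) (rule tv_Jop[OF c])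
  also have "\<dots> = Jop (D p (tv A c p u) (\<lambda>q. tv A c q v))"
    by (rule hermitian_conn_metric(2)[OF D o s s p(1) t])
  finally show ?thesis unfolding p(2) D.Gm_at[OF c p(1)] by simp
qed

lemma Gc_compat:
  assumes D: "hermitian_connection A g D" and c: "c \<in> A" and z: "z \<in> snd c ` fst c"
  shows "ddir (\<lambda>z. Gc c z v w) u z = Gc c z (Gm A D c z u v) w + Gc c z v (Gm A D c z u w)"
proof -
  obtain p where p: "p \<in> fst c" "z = snd c p" using z by blast
  interpret D: cx_connection A D
    using D by unfold_locales (simp add: hermitian_connection_def)
  note s = smooth_vf_tv_const[OF c] and o = chart(1)[OF c] and t = tv_tangent[OF c p(1)]
  have tvD: "tv A c p (Gm A D c (snd c p) u v) = D p (tv A c p u) (\<lambda>q. tv A c q v)" for v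
    unfolding D.Gm_at[OF c p(1)] by (rule tv_component[OF c p(1) D.nabla_tangent[OF o s p(1) t]])
  have "ddir (\<lambda>z. Gc c z v w) u z = dir_deriv A p (tv A c p u) (\<lambda>q. g q (tv A c q v) (tv A c q w))"
    by (subst dir_deriv_eq[OF g_smooth[OF o s s] p(1) c p(1) t]) (simp add: Gc_def[abs_def] o_def p c)
  also have "\<dots> = g p (D p (tv A c p u) (\<lambda>q. tv A c q v)) (tv A c p w) + g p (tv A c p v) (D p (tv A c p u) (\<lambda>q. tv A c q w))"
    by (rule hermitian_conn_metric(1)[OF D o s s p(1) t])
  finally show ?thesis unfolding p(2) Gc_at[OF c p(1)] tvD .
qed

lemma bismut_hermitian: "hermitian_connection A g nabla"
  using bismut by (simp add: bismut_connection_def)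

lemma chern_hermitian: "hermitian_connection A g nablac"
  using chern by (simp add: chern_connection_def)

lemma metric_chart:
  assumes c: "c \<in> A"
  shows "metric_chart (snd c ` fst c) (Gm A nabla c) (Gc c) (\<lambda>v. \<i> *s v)"
proof (rule metric_chart.intro)
  show "open (snd c ` fst c)" by (rule chart(2)[OF c])
  show "smooth_on (snd c ` fst c) (\<lambda>z. Gm A nabla c z u v)" for u v by (rule Gm_smooth[OF c])
  show "linear (\<lambda>v :: complex^'n. \<i> *s v)" by (rule linear_scalar_mult)
  show "\<i> *s (\<i> *s x) = - x" for x :: "complex^'n" by (rule i_i_scalar_mult)
  show "smooth_on (snd c ` fst c) (\<lambda>z. Gc c z u v)" for u v
    using g_smooth[OF chart(1)[OF c] smooth_vf_tv_const[OF c] smooth_vf_tv_const[OF c], of u v] c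
    by (auto simp: smooth_fun_def Gc_def[abs_def] o_def dest: bspec[of _ _ c])
  fix z assume z: "z \<in> snd c ` fst c"
  then obtain p where p: "p \<in> fst c" "z = snd c p" by blast
  note t = tv_tangent[OF c p(1)]
  show "bilinear (Gm A nabla c z)" by (rule Gm_bilinear[OF c z])
  show "Gm A nabla c z u (\<i> *s v) = \<i> *s Gm A nabla c z u v" for u v by (rule Gm_i[OF bismut_hermitian c z])
  show "bilinear (Gc c z)" by (rule Gc_bilinear[OF c z])
  show "Gc c z x y = Gc c z y x" for x y unfolding p(2) Gc_at[OF c p(1)] by (rule g_sym[OF t t])
  show "0 < Gc c z x x" if "x \<noteq> 0" for x
  proof -
    have "tv A c p x \<noteq> 0"
    proof
      assume "tv A c p x = 0"
      then have "tv A c p x c = 0" by simp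
      with that show False by (simp add: c p(1))
    qed
    then show ?thesis unfolding p(2) Gc_at[OF c p(1)] by (rule g_pos[OF t t])
  qed
  show "Gc c z (\<i> *s x) (\<i> *s y) = Gc c z x y" for x y
    unfolding p(2) Gc_at[OF c p(1)] tv_Jop[OF c p(1)] by (rule g_Jop[OF t t])
  show "ddir (\<lambda>z. Gc c z v w) u z = Gc c z (Gm A nabla c z u v) w + Gc c z v (Gm A nabla c z u w)" for u v w
    by (rule Gc_compat[OF bismut_hermitian c z])
qed

text \<open>The torsion of two coordinate fields is a smooth field, \<open>S\<close> below, with
  coordinates \<open>Tor _ v w\<close>. Evaluating its covariant derivative by
  \<open>nabla_component\<close> turns the invariant condition of parallel torsion into
  \<open>Tor_parallel\<close>.\<close>

lemma bismut_chart:
  assumes c: "c \<in> A"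
  shows "bismut_chart (snd c ` fst c) (Gm A nabla c) (Gc c) (\<lambda>v. \<i> *s v)"
proof -
  interpret metric_chart "snd c ` fst c" "Gm A nabla c" "Gc c" "\<lambda>v. \<i> *s v" by (rule metric_chart[OF c])
  show ?thesis
  proof
    fix z assume z: "z \<in> snd c ` fst c"
    then obtain p where p: "p \<in> fst c" "z = snd c p" by blast
    note s = smooth_vf_tv_const[OF c] and o = chart(1)[OF c]
    have T: "torsion A nabla q (tv A c q x) (tv A c q y) = tv A c q (Tor (snd c q) x y)" if q: "q \<in> fst c" for q x y
    proof -
      note t = tv_tangent[OF c q]
      show ?thesis
        using tv_component[OF c q torsion_tangent[OF t t], of x y]
        unfolding torsion_component[OF t t c q] Tor_def by (simp add: c q)
    qed
    show "Gc c z (Tor z x y) w = - Gc c z (Tor z x w) y" for x y w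
    proof -
      note t = tv_tangent[OF c p(1)]
      have "g p (torsion A nabla p (tv A c p x) (tv A c p y)) (tv A c p w) = - g p (torsion A nabla p (tv A c p x) (tv A c p w)) (tv A c p y)"
        using bismut t unfolding bismut_connection_def by blast
      then show ?thesis unfolding p(2) Gc_at[OF c p(1)] T[OF p(1)] .
    qed
    show "nab (\<lambda>y. Tor y v w) u z = Tor z (Gm A nabla c z u v) w + Tor z v (Gm A nabla c z u w)" for u v w
    proof -
      note t = tv_tangent[OF c p(1)]
      define S where "S q = torsion A nabla q (tv A c q v) (tv A c q w)" for q
      have S: "smooth_vf A (fst c) S"
        by (rule smooth_vf_cong[OF o _ smooth_vf_tv[OF c o subset_refl Tor_smooth, of v w]]) (simp add: S_def T)
      have tvD: "nabla p (tv A c p u) (\<lambda>q. tv A c q v) = tv A c p (Gm A nabla c (snd c p) u v)" for v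
        unfolding Gm_at[OF c p(1)] by (rule tv_component[OF c p(1) nabla_tangent[OF o s p(1) t], symmetric])
      have "nabla p (tv A c p u) S - torsion A nabla p (nabla p (tv A c p u) (\<lambda>q. tv A c q v)) (tv A c p w)
          - torsion A nabla p (tv A c p v) (nabla p (tv A c p u) (\<lambda>q. tv A c q w)) = 0"
        unfolding S_def
        using parallel[unfolded parallel_torsion_def, THEN spec, of "fst c", THEN spec, of "\<lambda>q. tv A c q v", THEN spec,
            of "\<lambda>q. tv A c q w", THEN mp, OF conjI[OF o conjI[OF s s]], THEN bspec, OF p(1), THEN bspec, OF t[of u]] .
      then have "nabla p (tv A c p u) S = tv A c p (Tor z (Gm A nabla c z u v) w) + tv A c p (Tor z v (Gm A nabla c z u w))"
        unfolding tvD T[OF p(1)] p(2) by (simp only: diff_diff_eq right_minus_eq)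
      then have "nabla p (tv A c p u) S c = Tor z (Gm A nabla c z u v) w + Tor z v (Gm A nabla c z u w)"
        by (simp add: c p(1))
      moreover have "nabla p (tv A c p u) S c = nab (\<lambda>y. Tor y v w) u z"
      proof -
        have "nabla p (tv A c p u) S c = ddir (coords c S) u z + Gm A nabla c z u (S p c)"
          using nabla_component[OF o S p(1) t c p(1), of u] by (simp add: c p)
        also have "ddir (coords c S) u z = ddir (\<lambda>y. Tor y v w) u z"
          by (rule ddir_cong[OF chart(2)[OF c] _ z]) (auto simp: coords_def c S_def T)
        also have "S p c = Tor z v w" by (simp add: S_def T p c)
        finally show ?thesis by (simp add: nab_def)
      qed
      ultimately show ?thesis by simp
    qed
  qed
qed

text \<open>In the chart \<open>c\<close> the section has the constant holomorphic components
  \<open>y\<close>, so the derivatives in \<open>dbar\<close> vanish: it is a holomorphic coordinate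
  field.\<close>

lemma dbar_holo_vec_const:
  assumes c: "c \<in> A" "p \<in> fst c"
  shows "fst (dbar A p V (\<lambda>q. holo_vec (tv A c q y))) c = 0"
proof -
  have dz: "dz c (holo_vec (tv A c q y)) = y" if "q \<in> fst c" for q
  proof -
    have "fst (holo_vec (tv A c q y)) c = (1/2) *\<^sub>R y" "snd (holo_vec (tv A c q y)) c = - ((1/2) *\<^sub>R (\<i> *s y))"
      using that c by (simp_all add: holo_vec_def)
    then show ?thesis
      by (simp add: dz_def linear_neg[OF linear_scalar_mult] linear_cmul[OF linear_scalar_mult]
          i_i_scalar_mult flip: scaleR_add_left)
  qed
  have "chart_deriv c p w (\<lambda>q. dz c (holo_vec (tv A c q y))) = 0" for w
  proof -
    have "ddir ((\<lambda>q. dz c (holo_vec (tv A c q y))) \<circ> chart_inv c) w (snd c p) = ddir (\<lambda>z. y) w (snd c p)"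
      by (rule ddir_cong[OF chart(2)[OF c(1)]]) (use c dz in auto)
    then show ?thesis by (simp add: chart_deriv_ddir)
  qed
  then show ?thesis using c by (simp add: dbar_def holo_vec_def)
qed

text \<open>Apply the defining condition of the Chern connection to the holomorphic field
  \<open>Y\<close> and the (0,1) vector \<open>x + \<i> J x\<close>. With \<open>\<Gamma>\<close>
  for the Chern Christoffel symbol, the real part of the result is half of
  \<open>\<Gamma> x y + J (\<Gamma> (J x) y) = 0\<close>. Combined with \<open>Gm_i\<close> this
  makes \<open>\<Gamma>\<close> complex bilinear.\<close>

lemma chern_Gm_i:
  assumes c: "c \<in> A" and z: "z \<in> snd c ` fst c"
  shows "Gm A nablac c z (\<i> *s x) y = \<i> *s Gm A nablac c z x y"
proof -
  obtain p where p: "p \<in> fst c" "z = snd c p" using z by blast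
  note s = smooth_vf_tv_const[OF c] and o = chart(1)[OF c] and t = tv_tangent[OF c p(1)]
  define Y where "Y q = holo_vec (tv A c q y)" for q
  have sJ: "smooth_vf A (fst c) (\<lambda>q. Jop (tv A c q y))" by (rule smooth_vf_Jop[OF o s])
  have Y: "smooth_cvf A (fst c) Y"
    using smooth_vf_scaleR[OF o s smooth_fun_const, of "1/2" y] smooth_vf_scaleR[OF o sJ smooth_fun_const, of "-1/2"]
    by (simp add: smooth_cvf_def Y_def holo_vec_def)
  have Y10: "Y q \<in> T10 A q" if "q \<in> fst c" for q
    using tv_tangent[OF c that, of y]
    by (auto simp: Y_def holo_vec_def T10_def TC_def cscale_def Jop_scaleR Jop_minus
        intro!: tangent_scaleR tangent_minus tangent_Jop)
  have V: "(tv A c p x, Jop (tv A c p x)) \<in> T01 A p"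
    using t by (auto simp: T01_def TC_def cscale_def intro!: tangent_Jop)
  have "cnabla nablac p (tv A c p x, Jop (tv A c p x)) Y = dbar A p (tv A c p x, Jop (tv A c p x)) Y"
    using chern[unfolded chern_connection_def, THEN conjunct2, THEN spec, of "fst c", THEN spec, of Y] o Y Y10 p(1) V by blast
  then have "fst (cnabla nablac p (tv A c p x, Jop (tv A c p x)) Y) c = 0"
    using dbar_holo_vec_const[OF c p(1)] by (simp add: Y_def[abs_def])
  moreover have "fst (cnabla nablac p (tv A c p x, Jop (tv A c p x)) Y) c =
      (1/2) *\<^sub>R (Gm A nablac c z x y + \<i> *s Gm A nablac c z (\<i> *s x) y)"
  proof -
    have 1: "nablac p (tv A c p x) (\<lambda>q. (1/2) *\<^sub>R tv A c q y) = (1/2) *\<^sub>R nablac p (tv A c p x) (\<lambda>q. tv A c q y)"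
      by (rule nc.nabla_scaleR[OF o s p(1) t])
    have 2: "nablac p (tv A c p (\<i> *s x)) (\<lambda>q. (-1/2) *\<^sub>R Jop (tv A c q y)) =
        (-1/2) *\<^sub>R Jop (nablac p (tv A c p (\<i> *s x)) (\<lambda>q. tv A c q y))"
      unfolding nc.nabla_scaleR[OF o sJ p(1) t] hermitian_conn_metric(2)[OF chern_hermitian o s s p(1) t] ..
    have 3: "(\<lambda>q. - ((1/2) *\<^sub>R Jop (tv A c q y))) = (\<lambda>q. (-1/2) *\<^sub>R Jop (tv A c q y))" by simp
    show ?thesis
      unfolding cnabla_def Y_def holo_vec_def fst_conv snd_conv 3 tv_Jop[OF c p(1), symmetric] 1 2
      by (simp add: p c nc.Gm_at scaleR_add_right)
  qed
  ultimately have "Gm A nablac c z x y + \<i> *s Gm A nablac c z (\<i> *s x) y = 0" by simp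
  then have "\<i> *s (\<i> *s Gm A nablac c z (\<i> *s x) y) = \<i> *s (- Gm A nablac c z x y)"
    by (metis add_eq_0_iff)
  then show ?thesis unfolding i_i_scalar_mult by (simp add: vec_eq_iff)
qed

lemma chern_torsion_component:
  assumes c: "c \<in> A" "p \<in> fst c" and x: "x \<in> tangent_space A p" and y: "y \<in> tangent_space A p"
  shows "torsion A nablac p x y c = bismut_chart.Br (Gm A nabla c) (\<lambda>v. \<i> *s v) (snd c p) (x c) (y c)"
proof -
  have z: "snd c p \<in> snd c ` fst c" using c by blast
  show ?thesis
    unfolding nc.torsion_component[OF x y c]
    by (rule bismut_chart.chern_torsion_eq_Br[OF bismut_chart[OF c(1)] z nc.Gm_bilinear[OF c(1) z]])
      (simp_all add: chern_Gm_i[OF c(1) z] Gm_i[OF chern_hermitian c(1) z] Gc_compat[OF chern_hermitian c(1) z])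
qed

text \<open>The bracket axioms are identities between tangent vectors at one point, hence can be
  checked on components in one chart, where the Chern torsion is \<open>Br\<close>.\<close>

lemma complex_structure_lie: "complex_structure_lie (tangent_space A p) Jop (torsion A nablac p)"
proof -
  obtain c where c: "c \<in> A" "p \<in> fst c" by (rule obtain_chart)
  interpret bc: bismut_chart "snd c ` fst c" "Gm A nabla c" "Gc c" "\<lambda>v. \<i> *s v" by (rule bismut_chart[OF c(1)])
  have z: "snd c p \<in> snd c ` fst c" using c by blast
  note comp = chern_torsion_component[OF c]
  note tt = nc.torsion_tangent
  note bil = bc.Br_bilinear[OF z]
  show ?thesis
  proof
    show "0 \<in> tangent_space A p" by (rule tangent_zero)
    fix x y z :: "('m, 'n) tvec" and r :: real
    show "Jop (x + y) = Jop x + Jop y" "Jop (r *\<^sub>R x) = r *\<^sub>R Jop x"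
      by (rule Jop_add, rule Jop_scaleR)
    show "Jop (Jop x) = - x" by simp
    assume x: "x \<in> tangent_space A p"
    show "r *\<^sub>R x \<in> tangent_space A p" by (rule tangent_scaleR[OF x])
    show "Jop x \<in> tangent_space A p" by (rule tangent_Jop[OF x])
    assume y: "y \<in> tangent_space A p"
    show "x + y \<in> tangent_space A p" by (rule tangent_add[OF x y])
    show "torsion A nablac p x y \<in> tangent_space A p" by (rule tt[OF x y])
    show "torsion A nablac p y x = - torsion A nablac p x y"
      by (rule tangent_eqI[OF c]) (simp_all add: tt x y tangent_minus comp bc.Br_antisym[of _ "y c" "x c"])
    show "torsion A nablac p (r *\<^sub>R x) y = r *\<^sub>R torsion A nablac p x y"
      by (rule tangent_eqI[OF c]) (simp_all add: tt x y tangent_scaleR comp bilinear_lmul[OF bil])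
    show "torsion A nablac p (Jop x) y = Jop (torsion A nablac p x y)"
      by (rule tangent_eqI[OF c]) (simp_all add: tt x y tangent_Jop comp bc.J_Br[OF z])
    assume z: "z \<in> tangent_space A p"
    show "torsion A nablac p (x + y) z = torsion A nablac p x z + torsion A nablac p y z"
      by (rule tangent_eqI[OF c]) (simp_all add: tt x y z tangent_add comp bilinear_ladd[OF bil])
    show "torsion A nablac p (torsion A nablac p x y) z + torsion A nablac p (torsion A nablac p y z) x +
        torsion A nablac p (torsion A nablac p z x) y = 0"
    proof (rule tangent_eqI[OF c])
      show "(torsion A nablac p (torsion A nablac p x y) z + torsion A nablac p (torsion A nablac p y z) x +
        torsion A nablac p (torsion A nablac p z x) y) c = 0 c"
        using bc.Br_Jacobi[OF \<open>snd c p \<in> _\<close>] by (simp add: tt x y z comp)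
    qed (simp_all add: tt x y z tangent_add tangent_zero)
  qed
qed

text \<open>A real frame with one bracket \<open>B\<close> for all fibres over \<open>U\<close>. As
  \<open>\<Psi> q\<close> intertwines \<open>\<i>\<close> with \<open>Jop\<close>, composing it with
  \<open>hol\<close> and \<open>ahol\<close> produces the trivializations of both bundles.\<close>

definition parallel_frame :: "'m set \<Rightarrow> ('m \<Rightarrow> complex^'n \<Rightarrow> ('m, 'n) tvec) \<Rightarrow> (complex^'n \<Rightarrow> complex^'n \<Rightarrow> complex^'n) \<Rightarrow> bool" where
  "parallel_frame U \<Psi> B \<longleftrightarrow> open U \<and> (\<forall>w. smooth_vf A U (\<lambda>q. \<Psi> q w)) \<and>
    (\<forall>q\<in>U. linear (\<Psi> q) \<and> bij_betw (\<Psi> q) UNIV (tangent_space A q) \<and>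
      (\<forall>w. \<Psi> q (\<i> *s w) = Jop (\<Psi> q w)) \<and>
      (\<forall>u v. \<Psi> q (B u v) = torsion A nablac q (\<Psi> q u) (\<Psi> q v)))"

lemma
  assumes "parallel_frame U \<Psi> B"
  shows frame_open: "open U" and frame_smooth: "smooth_vf A U (\<lambda>q. \<Psi> q w)"
    and frame_linear: "q \<in> U \<Longrightarrow> linear (\<Psi> q)"
    and frame_bij: "q \<in> U \<Longrightarrow> bij_betw (\<Psi> q) UNIV (tangent_space A q)"
    and frame_i: "q \<in> U \<Longrightarrow> \<Psi> q (\<i> *s w) = Jop (\<Psi> q w)"
    and frame_bracket: "q \<in> U \<Longrightarrow> \<Psi> q (B u v) = torsion A nablac q (\<Psi> q u) (\<Psi> q v)"
  using assms unfolding parallel_frame_def by blast+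

text \<open>The radially parallel frame of a chart, carried to the manifold by \<open>tv\<close>;
  the common bracket is \<open>Br\<close> at the centre \<open>snd c p\<close>.\<close>

lemma parallel_frame_exists: "\<exists>U \<Psi> B. p \<in> U \<and> parallel_frame U \<Psi> B"
proof -
  obtain c where c: "c \<in> A" "p \<in> fst c" by (rule obtain_chart)
  interpret bc: bismut_chart "snd c ` fst c" "Gm A nabla c" "Gc c" "\<lambda>v. \<i> *s v" by (rule bismut_chart[OF c(1)])
  have "snd c p \<in> snd c ` fst c" using c by blast
  then obtain r \<Phi> where r: "r > 0" "ball (snd c p) r \<subseteq> snd c ` fst c"
    and \<Phi>: "\<And>w. smooth_on (ball (snd c p) r) (\<lambda>z. \<Phi> z w)"
      "\<And>z. z \<in> ball (snd c p) r \<Longrightarrow> linear (\<Phi> z)" "\<And>z. z \<in> ball (snd c p) r \<Longrightarrow> bij (\<Phi> z)"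
      "\<And>z w. z \<in> ball (snd c p) r \<Longrightarrow> \<Phi> z (\<i> *s w) = \<i> *s \<Phi> z w"
      "\<And>z u v. z \<in> ball (snd c p) r \<Longrightarrow> \<Phi> z (bc.Br (snd c p) u v) = bc.Br z (\<Phi> z u) (\<Phi> z v)"
    using bc.parallel_frame by blast
  define U where "U = {q \<in> fst c. snd c q \<in> ball (snd c p) r}"
  have U: "open U" "p \<in> U" "U \<subseteq> fst c"
    using open_chart_preimage[OF c(1) open_ball, of "snd c p" r] c r by (auto simp: U_def)
  have q: "q \<in> fst c" "snd c q \<in> ball (snd c p) r" if "q \<in> U" for q using that by (auto simp: U_def)
  define \<Psi> where "\<Psi> q w = tv A c q (\<Phi> (snd c q) w)" for q w
  have "parallel_frame U \<Psi> (bc.Br (snd c p))"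
    unfolding parallel_frame_def
  proof (intro conjI ballI allI)
    show "open U" by (rule U(1))
    show "smooth_vf A U (\<lambda>q. \<Psi> q w)" for w
      unfolding \<Psi>_def
      by (rule smooth_vf_tv[OF c(1) U(1,3), of "\<lambda>z. \<Phi> z w"], rule smooth_on_subset[OF \<Phi>(1)]) (use q in blast)
    fix q' assume q': "q' \<in> U"
    note q = q[OF q']
    show "linear (\<Psi> q')"
      using linear_compose[OF \<Phi>(2)[OF q(2)] linear_tv[OF c(1) q(1)]] by (simp add: \<Psi>_def[abs_def] o_def)
    show "bij_betw (\<Psi> q') UNIV (tangent_space A q')"
      unfolding bij_betw_def
    proof
      show "inj (\<Psi> q')"
      proof (rule injI)
        fix u v assume "\<Psi> q' u = \<Psi> q' v"
        then have "tv A c q' (\<Phi> (snd c q') u) c = tv A c q' (\<Phi> (snd c q') v) c" by (simp add: \<Psi>_def)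
        then show "u = v" using bij_is_inj[OF \<Phi>(3)[OF q(2)]] by (simp add: c q inj_eq)
      qed
      show "range (\<Psi> q') = tangent_space A q'"
      proof (intro equalityI subsetI)
        fix v assume v: "v \<in> tangent_space A q'"
        obtain w where "v c = \<Phi> (snd c q') w" using bij_is_surj[OF \<Phi>(3)[OF q(2)]] by (metis surjD)
        then have "v = \<Psi> q' w" using tv_component[OF c(1) q(1) v] by (simp add: \<Psi>_def)
        then show "v \<in> range (\<Psi> q')" by blast
      qed (use tv_tangent[OF c(1) q(1)] in \<open>auto simp: \<Psi>_def\<close>)
    qed
    show "\<Psi> q' (\<i> *s w) = Jop (\<Psi> q' w)" for w
      unfolding \<Psi>_def \<Phi>(4)[OF q(2)] by (rule tv_Jop[OF c(1) q(1)])
    show "\<Psi> q' (bc.Br (snd c p) u v) = torsion A nablac q' (\<Psi> q' u) (\<Psi> q' v)" for u v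
    proof -
      note t = tv_tangent[OF c(1) q(1)]
      show ?thesis
        unfolding \<Psi>_def \<Phi>(5)[OF q(2)]
        by (rule tangent_eqI[OF c(1) q(1) t nc.torsion_tangent[OF t t]])
          (simp add: chern_torsion_component[OF c(1) q(1) t t] c(1) q(1))
    qed
  qed
  then show ?thesis using U(2) by blast
qed

section \<open>Ideals, splitting and local trivializations\<close>

abbreviation "hol \<equiv> complex_structure_lie.hol (Jop :: ('m, 'n) tvec \<Rightarrow> ('m, 'n) tvec)"

abbreviation "ahol \<equiv> complex_structure_lie.ahol (Jop :: ('m, 'n) tvec \<Rightarrow> ('m, 'n) tvec)"

lemma T10_eq: "T10 A p = hol ` tangent_space A p" and T01_eq: "T01 A p = ahol ` tangent_space A p"
  using complex_structure_lie.type_10_iff[OF complex_structure_lie, of p]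
    complex_structure_lie.type_01_iff[OF complex_structure_lie, of p]
  by (simp_all add: T10_def T01_def TC_def)

lemma TC_lie_algebra: "complex_lie_algebra cscale (TC A p) (ctorsion A nablac p)"
  unfolding TC_def ctorsion_def by (rule complex_structure_lie.complex_lie_algebra_cbilin[OF complex_structure_lie])

lemma T10_ideal: "lie_ideal cscale (TC A p) (ctorsion A nablac p) (T10 A p)"
  unfolding TC_def ctorsion_def T10_eq by (rule complex_structure_lie.lie_ideal_hol[OF complex_structure_lie])

lemma T10_lie_algebra: "complex_lie_algebra cscale (T10 A p) (ctorsion A nablac p)"
  by (rule lie_ideal_complex_lie_algebra[OF TC_lie_algebra T10_ideal])

lemma T01_ideal: "lie_ideal cscale (TC A p) (ctorsion A nablac p) (T01 A p)"
  unfolding TC_def ctorsion_def T01_eq by (rule complex_structure_lie.lie_ideal_ahol[OF complex_structure_lie])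

lemma T10_T01_direct_sum:
  "V \<in> TC A p \<Longrightarrow> \<exists>!W. fst W \<in> T10 A p \<and> snd W \<in> T01 A p \<and> V = fst W + snd W"
  unfolding TC_def T10_eq T01_eq by (rule complex_structure_lie.hol_ahol_direct_sum[OF complex_structure_lie])

lemma smooth_cvf_hol_ahol:
  assumes U: "open U" and X: "smooth_vf A U X"
  shows "smooth_cvf A U (\<lambda>q. hol (X q))" and "smooth_cvf A U (\<lambda>q. ahol (X q))"
proof -
  note J = smooth_vf_Jop[OF U X] and defs = complex_structure_lie.hol_def[OF complex_structure_lie]
    complex_structure_lie.ahol_def[OF complex_structure_lie]
  note s = smooth_vf_scaleR[OF U X smooth_fun_const, of "1/2"] smooth_vf_scaleR[OF U J smooth_fun_const, of "-1/2"]
    smooth_vf_scaleR[OF U J smooth_fun_const, of "1/2"]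
  show "smooth_cvf A U (\<lambda>q. hol (X q))" "smooth_cvf A U (\<lambda>q. ahol (X q))"
    using s by (simp_all add: smooth_cvf_def defs)
qed

lemma smooth_cvf_add:
  "open U \<Longrightarrow> smooth_cvf A U X \<Longrightarrow> smooth_cvf A U Y \<Longrightarrow> smooth_cvf A U (\<lambda>q. X q + Y q)"
  by (simp add: smooth_cvf_def smooth_vf_add)

lemma T10_bundle: "lie_algebra_bundle A TYPE('n) (T10 A) (ctorsion A nablac)"
proof (rule lie_algebra_bundleI)
  fix p
  show "T10 A p \<subseteq> TC A p" by (auto simp: T10_def)
  show "complex_lie_algebra cscale (T10 A p) (ctorsion A nablac p)" by (rule T10_lie_algebra)
  obtain U \<Psi> B where p: "p \<in> U" and F: "parallel_frame U \<Psi> B"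
    using parallel_frame_exists by blast
  note U = frame_open[OF F] p and sm = frame_smooth[OF F] and lin = frame_linear[OF F]
    and bij = frame_bij[OF F] and \<Psi>i = frame_i[OF F] and \<Psi>B = frame_bracket[OF F]
  define \<Phi> where "\<Phi> q w = hol (\<Psi> q w)" for q w
  have \<Phi>: "Vector_Spaces.linear (*s) cscale (\<Phi> q)" "bij_betw (\<Phi> q) UNIV (T10 A q)"
    "\<Phi> q (B v w) = ctorsion A nablac q (\<Phi> q v) (\<Phi> q w)" if q: "q \<in> U" for q v w
  proof -
    interpret L: complex_structure_lie "tangent_space A q" Jop "torsion A nablac q" by (rule complex_structure_lie)
    have inT: "\<Psi> q w \<in> tangent_space A q" for w using bij[OF q] by (auto simp: bij_betw_def)
    show "Vector_Spaces.linear (*s) cscale (\<Phi> q)"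
      unfolding Vector_Spaces.linear_iff \<Phi>_def
    proof (intro conjI allI)
      show "vector_space ((*s) :: complex \<Rightarrow> complex^'n \<Rightarrow> complex^'n)" by (rule vec.vector_space_axioms)
      show "vector_space (cscale :: complex \<Rightarrow> ('m, 'n) ctvec \<Rightarrow> ('m, 'n) ctvec)" by (rule vector_space_cscale)
      show "hol (\<Psi> q (x + y)) = hol (\<Psi> q x) + hol (\<Psi> q y)" for x y
        by (simp add: linear_add[OF lin[OF q]] L.hol_add)
      show "hol (\<Psi> q (a *s x)) = cscale a (hol (\<Psi> q x))" for a x
        unfolding scalar_mult_Re_Im[of a x] L.cscale_hol
        by (simp add: linear_add[OF lin[OF q]] linear_cmul[OF lin[OF q]] \<Psi>i[OF q])
    qed
    have "inj hol"
    proof (rule injI)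
      show "x = y" if "hol x = hol y" for x y
        using L.hol_ahol_eq_iff[of x 0 y 0] that by simp
    qed
    then have "bij_betw hol (tangent_space A q) (T10 A q)"
      unfolding T10_eq by (rule inj_on_imp_bij_betw[OF inj_on_subset[OF _ subset_UNIV]])
    from bij_betw_trans[OF bij[OF q] this] show "bij_betw (\<Phi> q) UNIV (T10 A q)"
      by (simp add: \<Phi>_def[abs_def] o_def)
    show "\<Phi> q (B v w) = ctorsion A nablac q (\<Phi> q v) (\<Phi> q w)"
      by (simp add: \<Phi>_def ctorsion_def L.cbilin_hol[OF inT inT] \<Psi>B[OF q])
  qed
  have "smooth_cvf A U (\<lambda>q. \<Phi> q w)" for w
    unfolding \<Phi>_def by (rule smooth_cvf_hol_ahol(1)[OF U(1) sm])
  then have "local_lie_frame A (T10 A) (ctorsion A nablac) U B \<Phi>"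
    unfolding local_lie_frame_def using U(1) \<Phi> by blast
  then show "\<exists>U (B :: complex^'n \<Rightarrow> _) \<Phi>. p \<in> U \<and> local_lie_frame A (T10 A) (ctorsion A nablac) U B \<Phi>"
    using U(2) by blast
qed

lemma TC_bundle: "lie_algebra_bundle A TYPE('n + 'n) (TC A) (ctorsion A nablac)"
proof (rule lie_algebra_bundleI)
  fix p
  show "TC A p \<subseteq> TC A p" by simp
  show "complex_lie_algebra cscale (TC A p) (ctorsion A nablac p)" by (rule TC_lie_algebra)
  obtain U \<Psi> B where p: "p \<in> U" and F: "parallel_frame U \<Psi> B"
    using parallel_frame_exists by blast
  note U = frame_open[OF F] p and sm = frame_smooth[OF F] and lin = frame_linear[OF F]
    and bij = frame_bij[OF F] and \<Psi>i = frame_i[OF F] and \<Psi>B = frame_bracket[OF F]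
  define \<Phi> where "\<Phi> q w = hol (\<Psi> q (left_part w)) + ahol (\<Psi> q (right_part w))" for q and w :: "complex^('n + 'n)"
  \<comment> \<open>The product of \<open>B\<close> with its complex conjugate. The conjugations in
    \<open>right_part\<close> and \<open>join_parts\<close> make up for the antilinearity of
    \<open>ahol\<close>.\<close>
  define B' where "B' v w = join_parts (B (left_part v) (left_part w)) (B (right_part v) (right_part w))" for v w
  have \<Phi>: "Vector_Spaces.linear (*s) cscale (\<Phi> q)" "bij_betw (\<Phi> q) UNIV (TC A q)"
    "\<Phi> q (B' v w) = ctorsion A nablac q (\<Phi> q v) (\<Phi> q w)" if q: "q \<in> U" for q v w
  proof -
    interpret L: complex_structure_lie "tangent_space A q" Jop "torsion A nablac q" by (rule complex_structure_lie)
    have inT: "\<Psi> q w \<in> tangent_space A q" for w using bij[OF q] by (auto simp: bij_betw_def)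
    have eq_iff: "\<Psi> q v = \<Psi> q w \<longleftrightarrow> v = w" for v w using bij[OF q] by (auto simp: bij_betw_def inj_eq)
    show "Vector_Spaces.linear (*s) cscale (\<Phi> q)"
      unfolding Vector_Spaces.linear_iff
    proof (intro conjI allI)
      show "vector_space ((*s) :: complex \<Rightarrow> complex^('n + 'n) \<Rightarrow> complex^('n + 'n))" by (rule vec.vector_space_axioms)
      show "vector_space (cscale :: complex \<Rightarrow> ('m, 'n) ctvec \<Rightarrow> ('m, 'n) ctvec)" by (rule vector_space_cscale)
      then have cadd: "cscale a (u + v) = cscale a u + cscale a v" for a and u v :: "('m, 'n) ctvec"
        unfolding vector_space_def by blast
      show "\<Phi> q (x + y) = \<Phi> q x + \<Phi> q y" for x y
        by (simp add: \<Phi>_def parts_add linear_add[OF lin[OF q]] L.hol_add L.ahol_add add_ac)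
      show "\<Phi> q (a *s x) = cscale a (\<Phi> q x)" for a x
        unfolding \<Phi>_def cadd L.cscale_hol L.cscale_ahol parts_scale
          scalar_mult_Re_Im[of a "left_part x"] scalar_mult_Re_Im[of "cnj a" "right_part x"]
        by (simp add: linear_add[OF lin[OF q]] linear_cmul[OF lin[OF q]] \<Psi>i[OF q] linear_diff[OF lin[OF q]])
    qed
    show "bij_betw (\<Phi> q) UNIV (TC A q)"
      unfolding bij_betw_def
    proof
      show "inj (\<Phi> q)"
        by (rule injI) (auto simp: \<Phi>_def L.hol_ahol_eq_iff eq_iff intro: parts_eqI)
      show "range (\<Phi> q) = TC A q"
      proof (intro equalityI subsetI)
        fix V assume "V \<in> range (\<Phi> q)"
        then show "V \<in> TC A q"
          using inT by (auto simp: \<Phi>_def TC_def L.hol_def L.ahol_def intro!: L.T_closed)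
      next
        fix V assume "V \<in> TC A q"
        then obtain a b where V: "V = (a, b)" "a \<in> tangent_space A q" "b \<in> tangent_space A q" by (auto simp: TC_def)
        \<comment> \<open>The real vectors whose images under \<open>hol\<close> and
          \<open>ahol\<close> sum to \<open>V\<close>, by \<open>hol_ahol_decomp\<close>.\<close>
        then have "a + Jop b \<in> range (\<Psi> q)" "a - Jop b \<in> range (\<Psi> q)"
          using bij[OF q] by (auto simp: bij_betw_def intro!: L.T_closed)
        then obtain u w where "\<Psi> q u = a + Jop b" "\<Psi> q w = a - Jop b" by (metis imageE)
        then have "V = \<Phi> q (join_parts u w)" using L.hol_ahol_decomp[of a b] by (simp add: V \<Phi>_def)
        then show "V \<in> range (\<Phi> q)" by blast
      qed
    qed
    show "\<Phi> q (B' v w) = ctorsion A nablac q (\<Phi> q v) (\<Phi> q w)"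
      by (simp add: \<Phi>_def B'_def ctorsion_def L.cbilin_hol_ahol_sum[OF inT inT inT inT] \<Psi>B[OF q])
  qed
  have "smooth_cvf A U (\<lambda>q. \<Phi> q w)" for w
    unfolding \<Phi>_def by (intro smooth_cvf_add smooth_cvf_hol_ahol U(1) sm)
  then have "local_lie_frame A (TC A) (ctorsion A nablac) U B' \<Phi>"
    unfolding local_lie_frame_def using U(1) \<Phi> by blast
  then show "\<exists>U (B :: complex^('n + 'n) \<Rightarrow> _) \<Phi>. p \<in> U \<and> local_lie_frame A (TC A) (ctorsion A nablac) U B \<Phi>"
    using U(2) by blast
qed

end

theorem theorem4p1:
  fixes A :: "('m::{t2_space, second_countable_topology}, 'n::finite) chart set"
    and g :: "'m \<Rightarrow> ('m, 'n) tvec \<Rightarrow> ('m, 'n) tvec \<Rightarrow> real"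
    and nabla nablac :: "('m, 'n) conn"
  assumes "hermitian_manifold A g"
    and "bismut_connection A g nabla"
    and "parallel_torsion A nabla"
    and "chern_connection A g nablac"
  shows "lie_algebra_bundle A TYPE('n) (T10 A) (ctorsion A nablac) \<and>
    lie_algebra_bundle A TYPE('n + 'n) (TC A) (ctorsion A nablac) \<and>
    (\<forall>p. lie_ideal cscale (TC A p) (ctorsion A nablac p) (T10 A p) \<and>
         lie_ideal cscale (TC A p) (ctorsion A nablac p) (T01 A p) \<and>
         (\<forall>V\<in>TC A p. \<exists>!W. fst W \<in> T10 A p \<and> snd W \<in> T01 A p \<and> V = fst W + snd W))"
proof -
  interpret parallel_bismut_manifold A g nabla nablac
    by (rule parallel_bismut_manifold.intro[OF assms])
  show ?thesis
    using T10_bundle TC_bundle T10_ideal T01_ideal T10_T01_direct_sum by blast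
qed

end
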